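(* Let $q\in\mathcal{Q}_1$ be a generic reflectionless potential. Then the negative eigenvalues of the operators $T_q$, $T_q^+$, and $T_q^-$ uniquely determine $q$: if $\tilde q\in\mathcal{Q}_1$ is another generic reflectionless potential such that the operators $T_{\tilde q}$, $T_{\tilde q}^+$, $T_{\tilde q}^-$ have the same negative eigenvalues as $T_q$, $T_q^+$, $T_q^-$, respectively, then $\tilde q=q$.
   Context: $\mathcal{Q}_1$ is the set of all real-valued functions in $L_1(\mathbb{R})$. For $q\in\mathcal{Q}_1$, $T_q=-\frac{d^2}{dx^2}+q$ is the corresponding self-adjoint Schr\"odinger operator in $L_2(\mathbb{R})$; $T_q^+$ and $T_q^-$ are the self-adjoint operators in $L_2(\mathbb{R}_+)$ and $L_2(\mathbb{R}_-)$ generated by $-\frac{d^2}{dx^2}+q$ and the Dirichlet boundary condition $y(0)=0$; $T_q':=T_q^-\oplus T_q^+$. A potential $q\in\mathcal{Q}_1$ is called special if the negative spectra of $T_q$ and $T_q'$ have nonempty intersection, and generic otherwise. Jost solutions: for $\lambda\ne0$ with $\operatorname{Im}\lambda\ge0$, the right Jost solution $e_+(\cdot,\lambda;q)$ is the unique solution of $-y''+qy=\lambda^2y$ with $\lim_{x\to+\infty}e^{-i\lambda x}e_+(x,\lambda;q)=1$; for $\lambda\neq0$ with $\operatorname{Im}\lambda\le0$, the left Jost solution $e_-(\cdot,\lambda;q)$ is the unique solution of the same equation with $\lim_{x\to-\infty}e^{-i\lambda x}e_-(x,\lambda;q)=1$. Reflectionless potentials: for real $k\ne0$ there are unique $a(k),b(k)$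 with $e_+(x,k;q)=a(k)e_-(x,k;q)+b(k)e_-(x,-k;q)$, and $|a(k)|^2=1+|b(k)|^2$; the reflection coefficients are $r_-(k)=b(k)/a(k)$ and $r_+(k)=-b(-k)/a(k)$. A potential $q\in\mathcal{Q}_1$ is called (generalized) reflectionless if its reflection coefficients vanish identically on $\mathbb{R}\setminus\{0\}$. *)

theory Defs
  imports "HOL-Analysis.Analysis"
begin

(* Functions represent their classes modulo null sets. *)
definition Q1 :: "(real \<Rightarrow> real) set" where
  "Q1 = {q. integrable lebesgue q}"


text \<open>Square-integrable functions on a set \<open>I\<close>; only the values on \<open>I\<close> matter.\<close>

definition L2 :: "real set \<Rightarrow> (real \<Rightarrow> complex) set" where
  "L2 I = {f. f \<in> borel_measurable (lebesgue_on I) \<and>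
              integrable (lebesgue_on I) (\<lambda>x. (cmod (f x))\<^sup>2)}"

definition norm_L2 :: "real set \<Rightarrow> (real \<Rightarrow> complex) \<Rightarrow> real" where
  "norm_L2 I f = sqrt (integral\<^sup>L (lebesgue_on I) (\<lambda>x. (cmod (f x))\<^sup>2))"


text \<open>\<open>f\<close> is locally absolutely continuous on the interval \<open>I\<close> with derivative \<open>f'\<close>:
  it is an indefinite Lebesgue integral of the locally integrable function \<open>f'\<close>.
  For continuous \<open>f'\<close> this says that \<open>f\<close> is \<open>C\<^sup>1\<close> with derivative \<open>f'\<close>.\<close>

definition loc_AC :: "real set \<Rightarrow> (real \<Rightarrow> complex) \<Rightarrow> (real \<Rightarrow> complex) \<Rightarrow> bool" where
  "loc_AC I f f' \<longleftrightarrow> (\<forall>a\<in>I. \<forall>b\<in>I. a \<le> b \<longrightarrow>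
     f' absolutely_integrable_on {a..b} \<and> f b - f a = integral {a..b} f')"

text \<open>\<open>y\<close> and \<open>y'\<close> are locally absolutely continuous and \<open>-y'' + q y = g\<close> almost
  everywhere on \<open>I\<close>.\<close>

definition schrodinger_eq ::
    "(real \<Rightarrow> real) \<Rightarrow> real set \<Rightarrow> (real \<Rightarrow> complex) \<Rightarrow> (real \<Rightarrow> complex) \<Rightarrow> bool" where
  "schrodinger_eq q I y g \<longleftrightarrow> (\<exists>y' y''. loc_AC I y y' \<and> loc_AC I y' y'' \<and>
     (AE x in lebesgue_on I. - y'' x + complex_of_real (q x) * y x = g x))"


text \<open>An unbounded operator in \<open>L\<^sub>2(I)\<close> is given by the pairs \<open>(y, g)\<close> of
  representatives with \<open>y\<close> in the domain and \<open>g\<close> its image. For \<open>q\<close> in \<open>Q1\<close> both endpoints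
  \<open>\<plusminus>\<infinity>\<close> are limit-point, so the maximal operator on the line and, given the Dirichlet
  condition, the ones on the half-lines are self-adjoint. The half-lines are taken closed,
  so that absolute continuity extends up to the regular endpoint 0.\<close>

type_synonym l2_op = "((real \<Rightarrow> complex) \<times> (real \<Rightarrow> complex)) set"

definition T_line :: "(real \<Rightarrow> real) \<Rightarrow> l2_op" where
  "T_line q = {(y, g). y \<in> L2 UNIV \<and> g \<in> L2 UNIV \<and> schrodinger_eq q UNIV y g}"

definition T_plus :: "(real \<Rightarrow> real) \<Rightarrow> l2_op" where
  "T_plus q = {(y, g). y \<in> L2 {0..} \<and> g \<in> L2 {0..} \<and> schrodinger_eq q {0..} y g \<and> y 0 = 0}"

definition T_minus :: "(real \<Rightarrow> real) \<Rightarrow> l2_op" where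
  "T_minus q = {(y, g). y \<in> L2 {..0} \<and> g \<in> L2 {..0} \<and> schrodinger_eq q {..0} y g \<and> y 0 = 0}"

text \<open>Orthogonal sum, with \<open>L\<^sub>2(\<real>\<^sub>-) \<oplus> L\<^sub>2(\<real>\<^sub>+)\<close> identified with \<open>L\<^sub>2(\<real>)\<close> by
  gluing at 0.\<close>

definition glue :: "(real \<Rightarrow> complex) \<Rightarrow> (real \<Rightarrow> complex) \<Rightarrow> real \<Rightarrow> complex" where
  "glue u v = (\<lambda>x. if x < 0 then u x else v x)"

definition T_prime :: "(real \<Rightarrow> real) \<Rightarrow> l2_op" where
  "T_prime q = {(glue u v, glue f h) | u v f h. (u, f) \<in> T_minus q \<and> (v, h) \<in> T_plus q}"


definition eigenvalue :: "real set \<Rightarrow> l2_op \<Rightarrow> complex \<Rightarrow> bool" where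
  "eigenvalue I A z \<longleftrightarrow> (\<exists>(y, g)\<in>A. (AE x in lebesgue_on I. g x = z * y x) \<and>
     \<not> (AE x in lebesgue_on I. y x = 0))"

text \<open>\<open>A - z\<close> maps its domain bijectively onto \<open>L\<^sub>2(I)\<close> and has a bounded inverse.\<close>

definition resolvent_set :: "real set \<Rightarrow> l2_op \<Rightarrow> complex set" where
  "resolvent_set I A = {z.
     (\<forall>(y, g)\<in>A. (AE x in lebesgue_on I. g x - z * y x = 0) \<longrightarrow>
        (AE x in lebesgue_on I. y x = 0)) \<and>
     (\<forall>f\<in>L2 I. \<exists>(y, g)\<in>A. AE x in lebesgue_on I. g x - z * y x = f x) \<and>
     (\<exists>C. \<forall>(y, g)\<in>A. norm_L2 I y \<le> C * norm_L2 I (\<lambda>x. g x - z * y x))}"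

definition op_spectrum :: "real set \<Rightarrow> l2_op \<Rightarrow> complex set" where
  "op_spectrum I A = - resolvent_set I A"

definition neg_eigenvalues :: "real set \<Rightarrow> l2_op \<Rightarrow> real set" where
  "neg_eigenvalues I A = {l. l < 0 \<and> eigenvalue I A (complex_of_real l)}"

definition neg_spectrum :: "real set \<Rightarrow> l2_op \<Rightarrow> real set" where
  "neg_spectrum I A = {l. l < 0 \<and> complex_of_real l \<in> op_spectrum I A}"

definition special :: "(real \<Rightarrow> real) \<Rightarrow> bool" where
  "special q \<longleftrightarrow> neg_spectrum UNIV (T_line q) \<inter> neg_spectrum UNIV (T_prime q) \<noteq> {}"

abbreviation generic :: "(real \<Rightarrow> real) \<Rightarrow> bool" where
  "generic q \<equiv> \<not> special q"


text \<open>Jost solutions. The descriptions are meaningful for \<open>q\<close> in \<open>Q1\<close> and nonzero \<open>l\<close> with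
  \<open>Im l \<ge> 0\<close> (right) or \<open>Im l \<le> 0\<close> (left), where such a solution exists and is unique.\<close>

definition jost_right :: "(real \<Rightarrow> real) \<Rightarrow> complex \<Rightarrow> real \<Rightarrow> complex" where
  "jost_right q l = (THE y. schrodinger_eq q UNIV y (\<lambda>x. l\<^sup>2 * y x) \<and>
     ((\<lambda>x. exp (- \<i> * l * complex_of_real x) * y x) \<longlongrightarrow> 1) at_top)"

definition jost_left :: "(real \<Rightarrow> real) \<Rightarrow> complex \<Rightarrow> real \<Rightarrow> complex" where
  "jost_left q l = (THE y. schrodinger_eq q UNIV y (\<lambda>x. l\<^sup>2 * y x) \<and>
     ((\<lambda>x. exp (- \<i> * l * complex_of_real x) * y x) \<longlongrightarrow> 1) at_bot)"

text \<open>The pair \<open>(a(k), b(k))\<close>, for real \<open>k \<noteq> 0\<close>.\<close>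

definition scattering_coeffs :: "(real \<Rightarrow> real) \<Rightarrow> real \<Rightarrow> complex \<times> complex" where
  "scattering_coeffs q k = (THE (a, b). \<forall>x.
     jost_right q (complex_of_real k) x =
       a * jost_left q (complex_of_real k) x + b * jost_left q (- complex_of_real k) x)"

definition coeff_a :: "(real \<Rightarrow> real) \<Rightarrow> real \<Rightarrow> complex" where
  "coeff_a q k = fst (scattering_coeffs q k)"

definition coeff_b :: "(real \<Rightarrow> real) \<Rightarrow> real \<Rightarrow> complex" where
  "coeff_b q k = snd (scattering_coeffs q k)"

definition r_minus :: "(real \<Rightarrow> real) \<Rightarrow> real \<Rightarrow> complex" where
  "r_minus q k = coeff_b q k / coeff_a q k"

definition r_plus :: "(real \<Rightarrow> real) \<Rightarrow> real \<Rightarrow> complex" where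
  "r_plus q k = - coeff_b q (- k) / coeff_a q k"

definition reflectionless :: "(real \<Rightarrow> real) \<Rightarrow> bool" where
  "reflectionless q \<longleftrightarrow> (\<forall>k. k \<noteq> 0 \<longrightarrow> r_minus q k = 0 \<and> r_plus q k = 0)"

end

theory Submission
  imports Defs "HOL-Complex_Analysis.Complex_Analysis"
begin

text \<open>
  Write \<open>\<lambda> = i k\<close>, so that the right Jost solution is \<open>e(x, k) \<sim> exp (- k x)\<close> for \<open>Re k \<ge> 0\<close>, and let
  \<open>M k = - e'(0, k) / e(0, k)\<close>; let \<open>M\<^sup>-\<close> be the same function for the reflected potential \<open>q (- x)\<close>.
  If \<open>q\<close> is reflectionless, the right and left Jost solutions are proportional for real \<open>\<lambda> \<noteq> 0\<close>, so
  \<open>N z = M\<^sup>- z\<close> (\<open>Re z \<ge> 0\<close>), \<open>N z = - M (- z)\<close> (\<open>Re z \<le> 0\<close>) is meromorphic on \<open>\<complex> - {0}\<close> and maps the upper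
  half-plane into itself. For \<open>k > 0\<close>, the number \<open>- k\<^sup>2\<close> is an eigenvalue of \<open>T\<^sup>-\<close> iff \<open>k\<close> is a pole of \<open>N\<close>,
  one of \<open>T\<^sup>+\<close> iff \<open>- k\<close> is, and one of \<open>T\<close> that is not an eigenvalue of \<open>T\<^sup>\<plusminus>\<close> iff \<open>k\<close> is a zero of the odd
  Herglotz function \<open>D z = N z - N (- z)\<close>; all zeros and poles of \<open>D\<close> are simple.

  For two generic reflectionless potentials with the same eigenvalues, the quotient of the two functions \<open>D\<close> is
  holomorphic on \<open>\<complex> - {0}\<close>, omits the negative half-line and tends to 1 at infinity, hence equals 1, although
  poles may accumulate at 0. Being generic means that \<open>M\<close> and \<open>M\<^sup>-\<close> have no common poles; so the
  difference \<open>E\<close> of the two functions \<open>N\<close> is holomorphic on \<open>\<complex> - {0}\<close>. It is even, bounded at infinity, and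
  \<open>O (1 / \<bar>Im z\<bar>)\<close> at 0 by the Schwarz lemma, which forces it to be constant. The Borg--Marchenko theorem on
  both half-lines finishes the proof.
\<close>

section \<open>Locally absolutely continuous functions\<close>

text \<open>The obstacle is the point 0. Without a moment condition on the potential, the Jost
  solutions are controlled only for \<open>norm k \<ge> r > 0\<close>; infinitely many negative
  eigenvalues are possible, no finite product represents the functions D, and 0 may be an essential
  singularity of what is compared. Each comparison needs its own reason why 0 does no harm. The
  quotient of the functions D avoids a half-line, so a square root followed by a Cayley map makes it
  bounded. For E the growth bound leaves at most a polynomial of degree one in 1/z, and evenness
  removes the linear term. D has to come before E. At a pole of N genericity excludes a pole at the
  opposite point, so D inherits the principal part of N there; equality of the functions D then
  cancels the poles of E, and it also says that E is even. A constant survives because the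
  asymptotics used here fix N only up to a bounded term.\<close>

text \<open>Estimates that are additive or multiplicative over subdivisions, such as the product
  rule and the Gronwall-type bounds, only need a mesh. One \<open>d\<close> from uniform continuity
  replaces the pointwise radius of \<open>Bolzano\<close>, and short intervals do the work of almost
  everywhere differentiation.\<close>

lemma interval_induct_uniform:
  fixes a b :: real
  assumes "a \<le> b"
    and trans: "\<And>r s t. a \<le> r \<Longrightarrow> r \<le> s \<Longrightarrow> s \<le> t \<Longrightarrow> t \<le> b \<Longrightarrow> P r s \<Longrightarrow> P s t \<Longrightarrow> P r t"
    and "d > 0" and loc: "\<And>s t. a \<le> s \<Longrightarrow> s \<le> t \<Longrightarrow> t \<le> b \<Longrightarrow> t - s < d \<Longrightarrow> P s t"
  shows "P a b"
proof -
  \<comment> \<open>The bounds are part of the predicate because the small intervals of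
    \<open>Bolzano\<close> around an endpoint may leave \<open>{a..b}\<close>.\<close>
  define Q where "Q s t \<longleftrightarrow> (a \<le> s \<and> s \<le> t \<and> t \<le> b \<longrightarrow> P s t)" for s t
  have "Q a b"
    using \<open>a \<le> b\<close>
  proof (rule Bolzano)
    fix r s t assume "Q r s" "Q s t" "r \<le> s" "s \<le> t"
    then show "Q r t" using trans[of r s t] by (auto simp: Q_def)
  next
    fix x assume "a \<le> x" "x \<le> b"
    then show "\<exists>d>0. \<forall>s t. s \<le> x \<and> x \<le> t \<and> t - s < d \<longrightarrow> Q s t"
      using \<open>d > 0\<close> loc unfolding Q_def by blast
  qed
  then show ?thesis using \<open>a \<le> b\<close> by (simp add: Q_def)
qed

lemma absolutely_integrable_mult_continuous:
  fixes f g :: "real \<Rightarrow> complex"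
  assumes f: "f absolutely_integrable_on {a..b}" and g: "continuous_on {a..b} g"
  shows "(\<lambda>x. f x * g x) absolutely_integrable_on {a..b}" "(\<lambda>x. g x * f x) absolutely_integrable_on {a..b}"
proof -
  have "bounded (g ` {a..b})"
    using compact_continuous_image[OF g] compact_imp_bounded by blast
  moreover have "g \<in> borel_measurable (lebesgue_on {a..b})"
    by (rule continuous_imp_measurable_on_sets_lebesgue[OF g]) auto
  ultimately show "(\<lambda>x. g x * f x) absolutely_integrable_on {a..b}"
    using absolutely_integrable_bounded_measurable_product[OF bilinear_times _ _ _ f] by auto
  then show "(\<lambda>x. f x * g x) absolutely_integrable_on {a..b}" by (simp add: mult.commute)
qed

lemma absolutely_integrable_mult_continuous_real:
  fixes f g :: "real \<Rightarrow> real"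
  assumes f: "f absolutely_integrable_on {a..b}" and g: "continuous_on {a..b} g"
  shows "(\<lambda>x. f x * g x) absolutely_integrable_on {a..b}" 
proof -
  have "bounded (g ` {a..b})"
    using compact_continuous_image[OF g] compact_imp_bounded by blast
  moreover have "g \<in> borel_measurable (lebesgue_on {a..b})"
    by (rule continuous_imp_measurable_on_sets_lebesgue[OF g]) auto
  ultimately have "(\<lambda>x. g x * f x) absolutely_integrable_on {a..b}"
    using absolutely_integrable_bounded_measurable_product[OF bilinear_times _ _ _ f] by auto
  then show "(\<lambda>x. f x * g x) absolutely_integrable_on {a..b}" by (simp add: mult.commute)
qed

lemma absolutely_integrable_of_real:
  "f absolutely_integrable_on S \<Longrightarrow> (\<lambda>x. complex_of_real (f x)) absolutely_integrable_on S"
  using absolutely_integrable_linear[OF _ bounded_linear_of_real] by (fastforce simp: o_def)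

lemma uniformly_continuous_pos:
  fixes f :: "real \<Rightarrow> 'a::metric_space"
  assumes "continuous_on {a..b} f" "e > 0"
  obtains d where "d > 0" "\<And>s t. s \<in> {a..b} \<Longrightarrow> t \<in> {a..b} \<Longrightarrow> \<bar>t - s\<bar> < d \<Longrightarrow> dist (f s) (f t) < e"
  using compact_uniformly_continuous[OF assms(1)] assms(2)
  unfolding uniformly_continuous_on_def by (metis compact_Icc dist_real_def dist_commute)

section \<open>Calculus of indefinite integrals\<close>

lemma loc_AC_integrable:
  assumes "loc_AC I f f'" "a \<in> I" "b \<in> I"
  shows "f' absolutely_integrable_on {a..b}" "f' integrable_on {a..b}"
proof -
  show "f' absolutely_integrable_on {a..b}"
    using assms by (cases "a \<le> b") (auto simp: loc_AC_def)
  then show "f' integrable_on {a..b}" by (rule absolutely_integrable_on_def[THEN iffD1, THEN conjunct1])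
qed

lemma loc_AC_diff_eq: "loc_AC I f f' \<Longrightarrow> a \<in> I \<Longrightarrow> b \<in> I \<Longrightarrow> a \<le> b \<Longrightarrow> f b - f a = integral {a..b} f'"
  by (auto simp: loc_AC_def)

lemma loc_AC_subset: "loc_AC I f f' \<Longrightarrow> J \<subseteq> I \<Longrightarrow> loc_AC J f f'"
  unfolding loc_AC_def by blast

lemma loc_AC_interval:
  assumes "is_interval I"
  shows "loc_AC I f f' \<longleftrightarrow> (\<forall>a\<in>I. \<forall>b\<in>I. a \<le> b \<longrightarrow> loc_AC {a..b} f f')" (is "?L = ?R")
proof
  assume ?L
  then show ?R using assms 
    by (meson atLeastAtMost_iff loc_AC_subset mem_is_interval_1_I subsetI)
next
  assume ?R then show ?L unfolding loc_AC_def
    by (meson atLeastAtMost_iff order_refl)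
qed

lemma loc_AC_continuous_Icc:
  assumes "loc_AC {a..b} f f'" shows "continuous_on {a..b} f"
proof (cases "a \<le> b")
  case True
  have "continuous_on {a..b} (\<lambda>x. f a + integral {a..x} f')"
    by (intro continuous_intros indefinite_integral_continuous_1 loc_AC_integrable[OF assms]) (use True in auto)
  then show ?thesis
  proof (rule continuous_on_eq)
    fix x assume "x \<in> {a..b}"
    then show "f a + integral {a..x} f' = f x"
      using loc_AC_diff_eq[OF assms, of a x] by (auto simp: algebra_simps)
  qed
qed auto

lemma loc_AC_continuous:
  assumes "loc_AC I f f'" "{a..b} \<subseteq> I" shows "continuous_on {a..b} f"
  using loc_AC_continuous_Icc loc_AC_subset assms by blast

text \<open>On a short interval \<open>{s..t}\<close> the increment of the product is exactly the
  integral of \<open>f' r * g t + f s * g' r\<close>, which differs from that of \<open>?h\<close>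
  by at most \<open>e\<close> times the integral of \<open>?k\<close>. This error is additive over
  subdivisions, so it persists on \<open>{a..b}\<close>, and \<open>e\<close> is arbitrary.\<close>

lemma loc_AC_mult_Icc:
  assumes f: "loc_AC {a..b} f f'" and g: "loc_AC {a..b} g g'" and ab: "a \<le> b"
  shows "(\<lambda>x. f' x * g x + f x * g' x) absolutely_integrable_on {a..b}"
    and "f b * g b - f a * g a = integral {a..b} (\<lambda>x. f' x * g x + f x * g' x)"
proof -
  let ?h = "\<lambda>x. f' x * g x + f x * g' x"
  have cf: "continuous_on {a..b} f" and cg: "continuous_on {a..b} g"
    using f g loc_AC_continuous_Icc by auto
  have f': "f' absolutely_integrable_on {a..b}" and g': "g' absolutely_integrable_on {a..b}"
    using f g ab by (auto intro: loc_AC_integrable)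
  show h: "?h absolutely_integrable_on {a..b}"
    by (intro set_integral_add absolutely_integrable_mult_continuous f' g' cf cg)
  let ?k = "\<lambda>x. norm (f' x) + norm (g' x)"
  have k: "?k absolutely_integrable_on {a..b}"
    using absolutely_integrable_norm[OF f'] absolutely_integrable_norm[OF g'] by (intro set_integral_add) (auto simp: o_def)
  have sub: "F integrable_on {s..t}" if "F absolutely_integrable_on {a..b}" "a \<le> s" "t \<le> b"
    for F :: "real \<Rightarrow> 'z::euclidean_space" and s t
    using that integrable_on_subinterval[of F "{a..b}" s t] absolutely_integrable_on_def by auto
  have main: "norm (f b * g b - f a * g a - integral {a..b} ?h) \<le> e * integral {a..b} ?k" if "e > 0" for e
  proof -
    obtain d1 where d1: "d1 > 0" "\<And>s t. s \<in> {a..b} \<Longrightarrow> t \<in> {a..b} \<Longrightarrow> \<bar>t - s\<bar> < d1 \<Longrightarrow> dist (f s) (f t) < e"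
      using uniformly_continuous_pos[OF cf \<open>e > 0\<close>] by blast
    obtain d2 where d2: "d2 > 0" "\<And>s t. s \<in> {a..b} \<Longrightarrow> t \<in> {a..b} \<Longrightarrow> \<bar>t - s\<bar> < d2 \<Longrightarrow> dist (g s) (g t) < e"
      using uniformly_continuous_pos[OF cg \<open>e > 0\<close>] by blast
    show ?thesis
    proof (rule interval_induct_uniform[OF ab, where d = "min d1 d2"])
      fix r s t assume *: "a \<le> r" "r \<le> s" "s \<le> t" "t \<le> b"
        "norm (f s * g s - f r * g r - integral {r..s} ?h) \<le> e * integral {r..s} ?k"
        "norm (f t * g t - f s * g s - integral {s..t} ?h) \<le> e * integral {s..t} ?k"
      have 1: "integral {r..s} ?h + integral {s..t} ?h = integral {r..t} ?h"
        using * by (intro Henstock_Kurzweil_Integration.integral_combine sub h) auto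
      have 2: "integral {r..s} ?k + integral {s..t} ?k = integral {r..t} ?k"
        using * by (intro Henstock_Kurzweil_Integration.integral_combine sub k) auto
      have "f t * g t - f r * g r - integral {r..t} ?h = (f s * g s - f r * g r - integral {r..s} ?h) + (f t * g t - f s * g s - integral {s..t} ?h)"
        unfolding 1[symmetric] by simp
      also have "norm \<dots> \<le> e * integral {r..s} ?k + e * integral {s..t} ?k"
        using * norm_triangle_mono by blast
      also have "\<dots> = e * integral {r..t} ?k" unfolding 2[symmetric] by (simp add: distrib_left)
      finally show "norm (f t * g t - f r * g r - integral {r..t} ?h) \<le> e * integral {r..t} ?k" .
    next
      show "min d1 d2 > 0" using d1 d2 by auto
    next
      fix s t assume st: "a \<le> s" "s \<le> t" "t \<le> b" "t - s < min d1 d2"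
      have f's: "f' integrable_on {s..t}" and g's: "g' integrable_on {s..t}"
        using st by (auto intro: sub f' g')
      have "f t * g t - f s * g s = (f t - f s) * g t + f s * (g t - g s)"
        by (simp add: algebra_simps)
      also have "\<dots> = integral {s..t} f' * g t + f s * integral {s..t} g'"
        using st loc_AC_diff_eq[OF f, of s t] loc_AC_diff_eq[OF g, of s t] by simp
      also have "\<dots> = integral {s..t} (\<lambda>r. f' r * g t + f s * g' r)"
        by (subst integral_add) (auto intro: integrable_on_mult_left integrable_on_mult_right f's g's)
      finally have "f t * g t - f s * g s - integral {s..t} ?h = integral {s..t} (\<lambda>r. (f' r * g t + f s * g' r) - ?h r)"
        using st by (subst integral_diff) (auto intro!: integrable_on_mult_left integrable_on_mult_right integrable_add f's g's sub[OF h])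
      also have "norm \<dots> \<le> integral {s..t} (\<lambda>r. e * ?k r)"
      proof (rule integral_norm_bound_integral)
        show "(\<lambda>r. (f' r * g t + f s * g' r) - ?h r) integrable_on {s..t}"
          using st by (intro integrable_diff sub[OF h] integrable_add integrable_on_mult_left integrable_on_mult_right f's g's)
        show "(\<lambda>r. e * ?k r) integrable_on {s..t}"
          using st by (intro integrable_on_mult_right sub[OF k])
        fix r assume r: "r \<in> {s..t}"
        have "dist (g r) (g t) < e" "dist (f s) (f r) < e" using d1 d2 r st by auto
        then have "norm (g t - g r) \<le> e" "norm (f s - f r) \<le> e" by (auto simp: dist_norm norm_minus_commute)
        then have "norm (f' r * (g t - g r)) + norm ((f s - f r) * g' r) \<le> norm (f' r) * e + e * norm (g' r)"
          unfolding norm_mult by (intro add_mono mult_left_mono mult_right_mono) auto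
        moreover have "norm ((f' r * g t + f s * g' r) - ?h r) \<le> norm (f' r * (g t - g r)) + norm ((f s - f r) * g' r)"
          by (rule order_trans[OF _ norm_triangle_ineq]) (simp add: algebra_simps)
        ultimately show "norm ((f' r * g t + f s * g' r) - ?h r) \<le> e * ?k r" by (simp add: algebra_simps)
      qed
      also have "\<dots> = e * integral {s..t} ?k" by simp
      finally show "norm (f t * g t - f s * g s - integral {s..t} ?h) \<le> e * integral {s..t} ?k" .
    qed
  qed
  have "norm (f b * g b - f a * g a - integral {a..b} ?h) \<le> 0"
  proof (rule field_le_epsilon)
    fix e :: real assume e: "e > 0"
    let ?K = "integral {a..b} ?k"
    have K: "?K \<ge> 0" by (intro integral_nonneg sub k) auto
    have "e / (?K + 1) * ?K \<le> e" using e K by (simp add: field_simps)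
    then show "norm (f b * g b - f a * g a - integral {a..b} ?h) \<le> 0 + e"
      using main[of "e / (?K + 1)"] e K by auto
  qed
  then show "f b * g b - f a * g a = integral {a..b} ?h" by simp
qed

lemma loc_AC_mult:
  assumes "is_interval I" "loc_AC I f f'" "loc_AC I g g'"
  shows "loc_AC I (\<lambda>x. f x * g x) (\<lambda>x. f' x * g x + f x * g' x)"
  unfolding loc_AC_def
proof (intro ballI impI)
  fix a b assume "a \<in> I" "b \<in> I" "a \<le> b"
  then have "loc_AC {a..b} f f'" "loc_AC {a..b} g g'"
    using assms loc_AC_interval by blast+
  from loc_AC_mult_Icc[OF this \<open>a \<le> b\<close>]
  show "(\<lambda>x. f' x * g x + f x * g' x) absolutely_integrable_on {a..b} \<and>
       f b * g b - f a * g a = integral {a..b} (\<lambda>x. f' x * g x + f x * g' x)" by simp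
qed

lemma loc_AC_add:
  assumes f: "loc_AC I f f'" and g: "loc_AC I g g'"
  shows "loc_AC I (\<lambda>x. f x + g x) (\<lambda>x. f' x + g' x)"
  unfolding loc_AC_def
proof (intro ballI impI conjI)
  fix a b assume ab: "a \<in> I" "b \<in> I" "a \<le> b"
  show "(\<lambda>x. f' x + g' x) absolutely_integrable_on {a..b}"
    by (intro set_integral_add loc_AC_integrable[OF f] loc_AC_integrable[OF g] ab)
  show "f b + g b - (f a + g a) = integral {a..b} (\<lambda>x. f' x + g' x)"
    using loc_AC_diff_eq[OF f ab] loc_AC_diff_eq[OF g ab]
    by (simp add: integral_add loc_AC_integrable[OF f] loc_AC_integrable[OF g] ab algebra_simps)
qed

lemma loc_AC_cmult:
  assumes f: "loc_AC I f f'"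
  shows "loc_AC I (\<lambda>x. c * f x) (\<lambda>x. c * f' x)"
  unfolding loc_AC_def
proof (intro ballI impI conjI)
  fix a b assume ab: "a \<in> I" "b \<in> I" "a \<le> b"
  show "(\<lambda>x. c * f' x) absolutely_integrable_on {a..b}"
    by (intro set_integrable_mult_right loc_AC_integrable[OF f] ab)
  show "c * f b - c * f a = integral {a..b} (\<lambda>x. c * f' x)"
    using loc_AC_diff_eq[OF f ab] by (simp add: right_diff_distrib[symmetric])
qed

lemma loc_AC_diff:
  assumes f: "loc_AC I f f'" and g: "loc_AC I g g'"
  shows "loc_AC I (\<lambda>x. f x - g x) (\<lambda>x. f' x - g' x)"
  using loc_AC_add[OF f loc_AC_cmult[OF g, of "-1"]] by simp

lemma loc_AC_cnj:
  assumes f: "loc_AC I f f'"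
  shows "loc_AC I (\<lambda>x. cnj (f x)) (\<lambda>x. cnj (f' x))"
  unfolding loc_AC_def
proof (intro ballI impI conjI)
  fix a b assume ab: "a \<in> I" "b \<in> I" "a \<le> b"
  show "(\<lambda>x. cnj (f' x)) absolutely_integrable_on {a..b}"
    using absolutely_integrable_linear[OF loc_AC_integrable(1)[OF f ab(1,2)] bounded_linear_cnj] by (simp add: o_def)
  show "cnj (f b) - cnj (f a) = integral {a..b} (\<lambda>x. cnj (f' x))"
    using loc_AC_diff_eq[OF f ab] integral_linear[OF loc_AC_integrable(2)[OF f ab(1,2)] bounded_linear_cnj]
    by (simp add: o_def flip: complex_cnj_diff)
qed

lemma loc_AC_deriv:
  assumes "\<And>x. (f has_vector_derivative f' x) (at x)" "continuous_on UNIV f'"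
  shows "loc_AC I f f'"
  unfolding loc_AC_def
proof (intro ballI impI conjI)
  fix a b :: real assume ab: "a \<in> I" "b \<in> I" "a \<le> b"
  show "f' absolutely_integrable_on {a..b}"
    using absolutely_integrable_continuous_real assms(2) continuous_on_subset by blast
  have "(f' has_integral f b - f a) {a..b}"
    by (rule fundamental_theorem_of_calculus[OF ab(3)])
       (use assms(1) has_vector_derivative_at_within in blast)
  then show "f b - f a = integral {a..b} f'" by (simp add: integral_unique)
qed

lemma loc_AC_exp: "loc_AC I (\<lambda>x. exp (k * complex_of_real x)) (\<lambda>x. k * exp (k * complex_of_real x))"
proof (rule loc_AC_deriv)
  fix x :: real
  have "((\<lambda>z. exp (k * z)) has_field_derivative k * exp (k * of_real x)) (at (of_real x))"
    by (auto intro!: derivative_eq_intros)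
  from has_vector_derivative_real_field[OF this]
  show "((\<lambda>x. exp (k * complex_of_real x)) has_vector_derivative k * exp (k * of_real x)) (at x)" .
qed (intro continuous_intros)

lemma loc_AC_const: "loc_AC I (\<lambda>x. c) (\<lambda>x. 0)"
  by (rule loc_AC_deriv) (auto intro!: derivative_eq_intros)

text \<open>Under the integral only the almost everywhere class of a derivative matters. This allows
  the second derivative of a solution to be replaced by the explicit right-hand side of the
  equation.\<close>

lemma loc_AC_cong:
  assumes "loc_AC I f f'" "\<And>x. x \<in> I \<Longrightarrow> f x = g x"
    and "AE x in lebesgue_on I. f' x = g' x" "is_interval I" "I \<in> sets lebesgue"
  shows "loc_AC I g g'"
proof -
  have "AE x in lebesgue. x \<in> I \<longrightarrow> f' x = g' x"
    using assms(3) by (subst (asm) AE_restrict_space_iff) (use assms(5) in auto)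
  then have "negligible {x. \<not> (x \<in> I \<longrightarrow> f' x = g' x)}"
    by (simp add: completion.AE_iff_null_sets negligible_iff_null_sets)
  then obtain N where N: "negligible N" "\<And>x. x \<in> I \<Longrightarrow> x \<notin> N \<Longrightarrow> f' x = g' x"
    by blast
  show ?thesis unfolding loc_AC_def
  proof (intro ballI impI conjI)
    fix a b assume ab: "a \<in> I" "b \<in> I" "a \<le> b"
    have eq: "g' x = f' x" if "x \<in> {a..b} - N" for x
      using that assms(4) ab N(2)[of x] mem_is_interval_1_I[of I a b x] by auto
    show "g' absolutely_integrable_on {a..b}"
      using absolutely_integrable_spike[OF loc_AC_integrable(1)[OF assms(1) ab(1,2)] N(1) eq] .
    have "integral {a..b} f' = integral {a..b} g'"
      using integral_spike[OF N(1), of "{a..b}" f' g'] eq by metis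
    then show "g b - g a = integral {a..b} g'"
      using loc_AC_diff_eq[OF assms(1) ab] assms(2) ab by auto
  qed
qed

lemma loc_AC_cong_simple:
  assumes "loc_AC I f f'" "is_interval I" "\<And>x. x \<in> I \<Longrightarrow> f x = g x" "\<And>x. x \<in> I \<Longrightarrow> f' x = g' x"
  shows "loc_AC I g g'"
  unfolding loc_AC_def
proof (intro ballI impI conjI)
  fix a b assume ab: "a \<in> I" "b \<in> I" "a \<le> b"
  have eq: "g' x = f' x" if "x \<in> {a..b}" for x
    using that assms ab mem_is_interval_1_I[of I a b x] by auto
  show "g' absolutely_integrable_on {a..b}"
    using absolutely_integrable_spike[OF loc_AC_integrable(1)[OF assms(1) ab(1,2)], of "{}" g'] eq by auto
  show "g b - g a = integral {a..b} g'"
    using loc_AC_diff_eq[OF assms(1) ab] assms(3) ab Henstock_Kurzweil_Integration.integral_cong[of "{a..b}" g' f'] eq by auto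
qed

lemma loc_AC_reflect:
  assumes "loc_AC I f f'"
  shows "loc_AC (uminus ` I) (\<lambda>x. f (- x)) (\<lambda>x. - f' (- x))"
  unfolding loc_AC_def
proof (intro ballI impI conjI)
  fix a b assume "a \<in> uminus ` I" "b \<in> uminus ` I" and ab: "a \<le> b"
  then have I: "- b \<in> I" "- a \<in> I" by auto
  have "(\<lambda>x. f' (- x)) absolutely_integrable_on {a..b}"
    using loc_AC_integrable(1)[OF assms I] absolutely_integrable_reflect_real[where f=f' and b="-a" and a="-b"] by simp
  then show "(\<lambda>x. - f' (- x)) absolutely_integrable_on {a..b}"
    using set_integrable_mult_right[of "-1" lebesgue "{a..b}" "\<lambda>x. f' (- x)"] by simp
  have *: "integral {a..b} (\<lambda>x. f' (- x)) = integral {-b..-a} f'"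
    using Henstock_Kurzweil_Integration.integral_reflect_real[where f=f' and b="-a" and a="-b"] by simp
  have "f (- a) - f (- b) = integral {-b..-a} f'" using loc_AC_diff_eq[OF assms I] ab by simp
  then have "f (- b) - f (- a) = - integral {a..b} (\<lambda>x. f' (- x))" unfolding * by (metis minus_diff_eq)
  then show "f (- b) - f (- a) = integral {a..b} (\<lambda>x. - f' (- x))" by simp
qed

lemma loc_AC_Un:
  assumes "loc_AC {..c} f f'" "loc_AC {c..} f f'"
  shows "loc_AC UNIV f f'"
  unfolding loc_AC_def
proof (intro ballI impI conjI)
  fix a b :: real assume ab: "a \<le> b"
  show "f' absolutely_integrable_on {a..b}"
  proof (cases "a \<le> c \<and> c \<le> b")
    case True
    then show ?thesis using loc_AC_integrable(1)[OF assms(1), of a c] loc_AC_integrable(1)[OF assms(2), of c b]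
      by (intro absolutely_integrable_on_combine[where a=a and c=c and b=b]) auto
  next
    case False
    then show ?thesis using loc_AC_integrable(1)[OF assms(1), of a b] loc_AC_integrable(1)[OF assms(2), of a b] ab by fastforce
  qed
  show "f b - f a = integral {a..b} f'"
  proof (cases "a \<le> c \<and> c \<le> b")
    case True
    have "integral {a..c} f' + integral {c..b} f' = integral {a..b} f'"
      using \<open>f' absolutely_integrable_on {a..b}\<close> True by (intro Henstock_Kurzweil_Integration.integral_combine) (auto simp: absolutely_integrable_on_def)
    then show ?thesis using loc_AC_diff_eq[OF assms(1), of a c] loc_AC_diff_eq[OF assms(2), of c b] True by (simp add: algebra_simps)
  next
    case False
    then show ?thesis using loc_AC_diff_eq[OF assms(1), of a b] loc_AC_diff_eq[OF assms(2), of a b] ab by fastforce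
  qed
qed

lemma loc_AC_atLeastI:
  assumes "\<And>b. b \<ge> c \<Longrightarrow> f' absolutely_integrable_on {c..b}" "\<And>b. b \<ge> c \<Longrightarrow> f b = f c + integral {c..b} f'"
  shows "loc_AC {c..} f f'"
  unfolding loc_AC_def
proof (intro ballI impI conjI)
  fix a b assume ab: "a \<in> {c..}" "b \<in> {c..}" "a \<le> b"
  show "f' absolutely_integrable_on {a..b}"
    using assms(1)[of b] ab by (auto intro: absolutely_integrable_on_subinterval)
  have "integral {c..a} f' + integral {a..b} f' = integral {c..b} f'"
    using assms(1)[of b] ab by (intro Henstock_Kurzweil_Integration.integral_combine) (auto simp: absolutely_integrable_on_def)
  then show "f b - f a = integral {a..b} f'" using assms(2)[of a] assms(2)[of b] ab by (simp add: algebra_simps)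
qed

text \<open>The Gronwall type inequalities are checked on short intervals and propagated by additivity, which avoids
  differentiating indefinite integrals; the constant 2 in the exponent pays for \<open>1 / (1 - \<epsilon>) \<le> exp (2 \<epsilon>)\<close>.\<close>

lemma inverse_one_minus_le_exp:
  fixes e :: real assumes "0 \<le> e" "e \<le> 1/2" shows "1 \<le> (1 - e) * exp (2 * e)"
proof -
  have "1 \<le> (1 - e) * (1 + 2 * e)" using assms mult_nonneg_nonneg[of e "1 - 2 * e"] by (simp add: algebra_simps)
  also have "\<dots> \<le> (1 - e) * exp (2 * e)" using assms exp_ge_add_one_self[of "2*e"] by (intro mult_left_mono) auto
  finally show ?thesis .
qed

lemma small_integral_uniform:
  fixes w :: "real \<Rightarrow> real"
  assumes "w integrable_on {a..b}" "e > 0"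
  obtains d where "d > 0" "\<And>s t. a \<le> s \<Longrightarrow> s \<le> t \<Longrightarrow> t \<le> b \<Longrightarrow> t - s < d \<Longrightarrow> \<bar>integral {s..t} w\<bar> < e"
proof -
  obtain d where d: "d > 0" "\<And>s t. s \<in> {a..b} \<Longrightarrow> t \<in> {a..b} \<Longrightarrow> \<bar>t - s\<bar> < d \<Longrightarrow> dist (integral {a..s} w) (integral {a..t} w) < e"
    using uniformly_continuous_pos[OF indefinite_integral_continuous_1[OF assms(1)] assms(2)] by blast
  have "\<bar>integral {s..t} w\<bar> < e" if "a \<le> s" "s \<le> t" "t \<le> b" "t - s < d" for s t
  proof -
    have "integral {a..s} w + integral {s..t} w = integral {a..t} w"
      using that integrable_on_subinterval[OF assms(1), of a t] by (intro Henstock_Kurzweil_Integration.integral_combine) auto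
    then show ?thesis using d(2)[of s t] that by (simp add: dist_real_def abs_minus_commute)
  qed
  with d(1) that show thesis by blast
qed

lemma gronwall:
  fixes u w :: "real \<Rightarrow> real"
  assumes ab: "a \<le> b" and u: "continuous_on {a..b} u" and w: "w absolutely_integrable_on {a..b}"
    and w0: "\<And>x. x \<in> {a..b} \<Longrightarrow> w x \<ge> 0" and u0: "\<And>x. x \<in> {a..b} \<Longrightarrow> u x \<ge> 0" and C: "C \<ge> 0"
    and le: "\<And>x. x \<in> {a..b} \<Longrightarrow> u x \<le> C + integral {a..x} (\<lambda>t. w t * u t)"
  shows "u b \<le> C * exp (2 * integral {a..b} w)"
proof -
  let ?U = "\<lambda>x. C + integral {a..x} (\<lambda>t. w t * u t)"
  have wi: "w integrable_on {a..b}" using w by (simp add: absolutely_integrable_on_def)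
  have wu: "(\<lambda>t. w t * u t) integrable_on {a..b}"
    using absolutely_integrable_mult_continuous_real[OF w u] by (simp add: absolutely_integrable_on_def)
  have comb: "integral {a..s} F + integral {s..t} F = integral {a..t} F" if "a \<le> s" "s \<le> t" "t \<le> b" "F integrable_on {a..b}" for s t and F :: "real \<Rightarrow> real"
    using that integrable_on_subinterval[OF that(4), of a t] by (intro Henstock_Kurzweil_Integration.integral_combine) auto
  have comb': "integral {r..s} w + integral {s..t} w = integral {r..t} w" if "a \<le> r" "r \<le> s" "s \<le> t" "t \<le> b" for r s t
    using that integrable_on_subinterval[OF wi, of r t] by (intro Henstock_Kurzweil_Integration.integral_combine) auto
  have U0: "?U x \<ge> 0" if "x \<in> {a..b}" for x using le[OF that] u0[OF that] by linarith
  obtain d where d: "d > 0" "\<And>s t. a \<le> s \<Longrightarrow> s \<le> t \<Longrightarrow> t \<le> b \<Longrightarrow> t - s < d \<Longrightarrow> \<bar>integral {s..t} w\<bar> < 1/2"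
    using small_integral_uniform[OF wi, of "1/2"] by auto
  \<comment> \<open>The majorant \<open>?U\<close> is propagated instead of \<open>u\<close>: it is
    monotone, so on a short interval the integrand is at most \<open>w r * ?U t\<close>, and its
    inequality composes multiplicatively.\<close>
  have "?U b \<le> ?U a * exp (2 * integral {a..b} w)"
  proof (rule interval_induct_uniform[where P = "\<lambda>s t. ?U t \<le> ?U s * exp (2 * integral {s..t} w)", OF ab _ d(1)])
    fix r s t assume *: "a \<le> r" "r \<le> s" "s \<le> t" "t \<le> b" "?U s \<le> ?U r * exp (2 * integral {r..s} w)" "?U t \<le> ?U s * exp (2 * integral {s..t} w)"
    have "?U t \<le> ?U s * exp (2 * integral {s..t} w)" by fact
    also have "\<dots> \<le> (?U r * exp (2 * integral {r..s} w)) * exp (2 * integral {s..t} w)" using * by (intro mult_right_mono) auto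
    also have "\<dots> = ?U r * exp (2 * integral {r..t} w)" using comb'[OF *(1-4)] by (simp add: mult.assoc distrib_left flip: exp_add)
    finally show "?U t \<le> ?U r * exp (2 * integral {r..t} w)" .
  next
    fix s t assume st: "a \<le> s" "s \<le> t" "t \<le> b" "t - s < d"
    let ?e = "integral {s..t} w"
    have e: "0 \<le> ?e" using st w0 by (intro integral_nonneg integrable_on_subinterval[OF wi]) auto
    have e2: "?e \<le> 1/2" using d(2)[OF st] by auto
    have mono: "?U r \<le> ?U t" if "r \<in> {s..t}" for r
    proof -
      have "0 \<le> integral {r..t} (\<lambda>t. w t * u t)"
        using that st w0 u0 by (intro integral_nonneg integrable_on_subinterval[OF wu]) auto
      then show ?thesis using comb[OF _ _ _ wu, of r t] that st by auto
    qed
    have "?U t - ?U s = integral {s..t} (\<lambda>t. w t * u t)" using comb[OF _ _ _ wu, of s t] st by simp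
    also have "\<dots> \<le> integral {s..t} (\<lambda>r. w r * ?U t)"
    proof (rule integral_le)
      show "(\<lambda>t. w t * u t) integrable_on {s..t}" using st by (intro integrable_on_subinterval[OF wu]) auto
      show "(\<lambda>r. w r * ?U t) integrable_on {s..t}" using st by (intro integrable_on_mult_left integrable_on_subinterval[OF wi]) auto
      show "w r * u r \<le> w r * ?U t" if "r \<in> {s..t}" for r
        using le[of r] mono[OF that] w0[of r] that st by (intro mult_left_mono) auto
    qed
    also have "\<dots> = ?e * ?U t" by simp
    finally have "?U t * (1 - ?e) \<le> ?U s" by (simp add: algebra_simps)
    have "?U t \<le> ?U t * ((1 - ?e) * exp (2 * ?e))"
      using mult_left_mono[OF inverse_one_minus_le_exp[OF e e2], of "?U t"] U0[of t] st by simp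
    also have "\<dots> \<le> ?U s * exp (2 * ?e)"
      using mult_right_mono[OF \<open>?U t * (1 - ?e) \<le> ?U s\<close>, of "exp (2 * ?e)"] by (simp only: mult.assoc exp_ge_zero)
    finally show "?U t \<le> ?U s * exp (2 * integral {s..t} w)" .
  qed
  then show ?thesis using le[of b] ab by auto
qed

lemma gronwall_backward:
  fixes u w :: "real \<Rightarrow> real"
  assumes ab: "a \<le> b" and u: "continuous_on {a..b} u" and w: "w absolutely_integrable_on {a..b}"
    and w0: "\<And>x. x \<in> {a..b} \<Longrightarrow> w x \<ge> 0" and u0: "\<And>x. x \<in> {a..b} \<Longrightarrow> u x \<ge> 0" and C: "C \<ge> 0"
    and le: "\<And>x. x \<in> {a..b} \<Longrightarrow> u x \<le> C + integral {x..b} (\<lambda>t. w t * u t)"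
  shows "u a \<le> C * exp (2 * integral {a..b} w)"
proof -
  have "u (- (- a)) \<le> C * exp (2 * integral {-b..-a} (\<lambda>x. w (- x)))"
  proof (rule gronwall)
    show "continuous_on {- b..- a} (\<lambda>x. u (- x))"
      by (rule continuous_on_compose2[OF u]) (auto intro!: continuous_intros)
    fix x assume x: "x \<in> {- b..- a}"
    have "integral {-b..x} (\<lambda>t. w (- t) * u (- t)) = integral {-x..b} (\<lambda>t. w t * u t)"
      using Henstock_Kurzweil_Integration.integral_reflect_real[of b "-x" "\<lambda>t. w t * u t"] by simp
    then show "u (- x) \<le> C + integral {- b..x} (\<lambda>t. w (- t) * u (- t))" using le[of "-x"] x by auto
  qed (use assms in auto)
  then show ?thesis by simp
qed

text \<open>In the norm weighted by \<open>exp (4 * integral {a..t} w)\<close>, integration against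
  \<open>w\<close> gains a factor 1/2; this contraction makes the Picard series geometric. The exact
  integral would be a quarter of the increment of the exponential; the factor 2 given away pays for
  freezing the weight on short intervals.\<close>

lemma integral_exp_weight_le:
  fixes w :: "real \<Rightarrow> real"
  assumes ab: "a \<le> b" and w: "w absolutely_integrable_on {a..b}"
    and w0: "\<And>x. x \<in> {a..b} \<Longrightarrow> w x \<ge> 0"
  shows "integral {a..b} (\<lambda>t. w t * exp (4 * integral {a..t} w)) \<le> exp (4 * integral {a..b} w) / 2"
proof -
  let ?W = "\<lambda>x. integral {a..x} w"
  have wi: "w integrable_on {a..b}" using w by (simp add: absolutely_integrable_on_def)
  have we: "(\<lambda>t. w t * exp (4 * ?W t)) integrable_on {a..b}"
    by (intro absolutely_integrable_mult_continuous_real[OF w, THEN absolutely_integrable_on_def[THEN iffD1, THEN conjunct1]]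
        continuous_intros indefinite_integral_continuous_1 wi)
  have comb: "?W s + integral {s..t} w = ?W t" if "a \<le> s" "s \<le> t" "t \<le> b" for s t
    using that integrable_on_subinterval[OF wi, of a t] by (intro Henstock_Kurzweil_Integration.integral_combine) auto
  have nn: "0 \<le> integral {s..t} w" if "a \<le> s" "t \<le> b" for s t
    using that w0 by (intro integral_nonneg integrable_on_subinterval[OF wi]) auto
  \<comment> \<open>With 1/8 the exponent varies by at most 1/2 on a short interval, and
    \<open>exp (1/2) \<le> 2\<close>.\<close>
  obtain d where d: "d > 0" "\<And>s t. a \<le> s \<Longrightarrow> s \<le> t \<Longrightarrow> t \<le> b \<Longrightarrow> t - s < d \<Longrightarrow> \<bar>integral {s..t} w\<bar> < 1/8"
    using small_integral_uniform[OF wi, of "1/8"] by auto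
  have "integral {a..b} (\<lambda>t. w t * exp (4 * ?W t)) \<le> (exp (4 * ?W b) - exp (4 * ?W a)) / 2"
  proof (rule interval_induct_uniform[where P = "\<lambda>s t. integral {s..t} (\<lambda>t. w t * exp (4 * ?W t)) \<le> (exp (4 * ?W t) - exp (4 * ?W s)) / 2",
        OF ab _ d(1)])
    fix r s t assume *: "a \<le> r" "r \<le> s" "s \<le> t" "t \<le> b"
      "integral {r..s} (\<lambda>t. w t * exp (4 * ?W t)) \<le> (exp (4 * ?W s) - exp (4 * ?W r)) / 2"
      "integral {s..t} (\<lambda>t. w t * exp (4 * ?W t)) \<le> (exp (4 * ?W t) - exp (4 * ?W s)) / 2"
    have "integral {r..s} (\<lambda>t. w t * exp (4 * ?W t)) + integral {s..t} (\<lambda>t. w t * exp (4 * ?W t)) = integral {r..t} (\<lambda>t. w t * exp (4 * ?W t))"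
      using * integrable_on_subinterval[OF we, of r t] by (intro Henstock_Kurzweil_Integration.integral_combine) auto
    then show "integral {r..t} (\<lambda>t. w t * exp (4 * ?W t)) \<le> (exp (4 * ?W t) - exp (4 * ?W r)) / 2" using * by argo
  next
    fix s t assume st: "a \<le> s" "s \<le> t" "t \<le> b" "t - s < d"
    let ?e = "integral {s..t} w"
    have e: "0 \<le> ?e" "?e \<le> 1/8" using nn[of s t] d(2)[OF st] st by auto
    have "integral {s..t} (\<lambda>r. w r * exp (4 * ?W r)) \<le> integral {s..t} (\<lambda>r. w r * (2 * exp (4 * ?W s)))"
    proof (rule integral_le)
      show "(\<lambda>t. w t * exp (4 * ?W t)) integrable_on {s..t}" using st by (intro integrable_on_subinterval[OF we]) auto
      show "(\<lambda>r. w r * (2 * exp (4 * ?W s))) integrable_on {s..t}" using st by (intro integrable_on_mult_left integrable_on_subinterval[OF wi]) auto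
      fix r assume r: "r \<in> {s..t}"
      have "?W r \<le> ?W s + 1/8" using comb[of s r] r st e d(2)[of s r] by auto
      then have "exp (4 * ?W r) \<le> exp (1/2 + 4 * ?W s)" by simp
      also have "\<dots> \<le> 2 * exp (4 * ?W s)" 
      proof -
        have "exp (1/2::real) \<le> 2" using exp_bound_half[of "1/2::real"] by simp
        then show ?thesis unfolding exp_add by (intro mult_right_mono) auto
      qed
      finally show "w r * exp (4 * ?W r) \<le> w r * (2 * exp (4 * ?W s))" using w0[of r] r st by (intro mult_left_mono) auto
    qed
    also have "\<dots> = 4 * ?e * exp (4 * ?W s) / 2" by simp
    also have "\<dots> \<le> (exp (4 * ?e) - 1) * exp (4 * ?W s) / 2"
    proof (intro divide_right_mono mult_right_mono)
      show "4 * ?e \<le> exp (4 * ?e) - 1" using exp_ge_add_one_self[of "4 * ?e"] by linarith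
    qed auto
    also have "\<dots> = (exp (4 * ?W t) - exp (4 * ?W s)) / 2"
      using comb[of s t] st by (simp add: left_diff_distrib flip: exp_add)
    finally show "integral {s..t} (\<lambda>t. w t * exp (4 * ?W t)) \<le> (exp (4 * ?W t) - exp (4 * ?W s)) / 2" .
  qed
  then show ?thesis by (smt (verit) divide_right_mono exp_ge_zero)
qed

section \<open>The initial value problem on the half-line\<close>

text \<open>\<open>v\<close> is the derivative of \<open>y\<close>, and \<open>s\<close> is minus
  the spectral parameter: for \<open>s = k\<^sup>2\<close> the free solutions are
  \<open>exp (- k x)\<close> and \<open>exp (k x)\<close>, and the eigenvalue candidate is
  \<open>- (k\<^sup>2)\<close>. Prescribing the derivative of \<open>v\<close> by a formula removes
  the almost everywhere clause.\<close>

definition sol :: "(real \<Rightarrow> real) \<Rightarrow> complex \<Rightarrow> (real \<Rightarrow> complex) \<Rightarrow> (real \<Rightarrow> complex) \<Rightarrow> bool" where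
  "sol q s y v \<longleftrightarrow> loc_AC {0..} y v \<and> loc_AC {0..} v (\<lambda>x. (complex_of_real (q x) + s) * y x)"

lemma sol_lincomb:
  assumes "sol q s y v" "sol q s z w"
  shows "sol q s (\<lambda>x. a * y x + b * z x) (\<lambda>x. a * v x + b * w x)"
proof -
  have "loc_AC {0..} (\<lambda>x. a * y x + b * z x) (\<lambda>x. a * v x + b * w x)"
    by (intro loc_AC_add loc_AC_cmult) (use assms in \<open>auto simp: sol_def\<close>)
  moreover have "loc_AC {0..} (\<lambda>x. a * v x + b * w x) (\<lambda>x. a * ((complex_of_real (q x) + s) * y x) + b * ((complex_of_real (q x) + s) * z x))"
    by (intro loc_AC_add loc_AC_cmult) (use assms in \<open>auto simp: sol_def\<close>)
  ultimately show ?thesis by (simp add: sol_def algebra_simps)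
qed

lemma sol_cnj:
  assumes "sol q s y v" shows "sol q (cnj s) (\<lambda>x. cnj (y x)) (\<lambda>x. cnj (v x))"
  using assms loc_AC_cnj[of "{0..}" y v] loc_AC_cnj[of "{0..}" v "\<lambda>x. (complex_of_real (q x) + s) * y x"]
  by (simp add: sol_def)

lemma sol_continuous:
  assumes "sol q s y v" "0 \<le> a"
  shows "continuous_on {a..b} y" "continuous_on {a..b} v"
  using assms loc_AC_continuous[of "{0..}"] by (auto simp: sol_def)

lemma loc_AC_zero_deriv:
  assumes "loc_AC {0..} f (\<lambda>x. 0)" "0 \<le> x" shows "f x = f 0"
  using loc_AC_diff_eq[OF assms(1), of 0 x] assms(2) by simp

lemma sol_wronskian:
  assumes y: "sol q s y v" and z: "sol q s z w" and "0 \<le> x"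
  shows "y x * w x - v x * z x = y 0 * w 0 - v 0 * z 0"
proof -
  have "loc_AC {0..} (\<lambda>x. y x * w x - v x * z x)
    (\<lambda>x. (v x * w x + y x * ((complex_of_real (q x) + s) * z x)) - (((complex_of_real (q x) + s) * y x) * z x + v x * w x))"
    by (intro loc_AC_diff loc_AC_mult is_interval_ci) (use y z in \<open>auto simp: sol_def\<close>)
  then have "loc_AC {0..} (\<lambda>x. y x * w x - v x * z x) (\<lambda>x. 0)" by (simp add: algebra_simps)
  from loc_AC_zero_deriv[OF this \<open>0 \<le> x\<close>] show ?thesis .
qed

section \<open>Existence by a Neumann series\<close>

text \<open>These are the terms of the Neumann series of the first-order system, that is, the
  differences of consecutive Picard iterates and not the iterates; the solution is their
  sum.\<close>

primrec picard :: "(real \<Rightarrow> real) \<Rightarrow> complex \<Rightarrow> complex \<Rightarrow> complex \<Rightarrow> nat \<Rightarrow> real \<Rightarrow> complex \<times> complex" where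
  "picard q \<alpha> \<beta> s 0 = (\<lambda>x. (\<alpha>, \<beta>))"
| "picard q \<alpha> \<beta> s (Suc n) = (\<lambda>x. (integral {0..x} (\<lambda>t. snd (picard q \<alpha> \<beta> s n t)),
     integral {0..x} (\<lambda>t. (complex_of_real (q t) + s) * fst (picard q \<alpha> \<beta> s n t))))"

definition ivp :: "(real \<Rightarrow> real) \<Rightarrow> complex \<Rightarrow> complex \<Rightarrow> complex \<Rightarrow> real \<Rightarrow> complex" where
  "ivp q \<alpha> \<beta> s x = (\<Sum>n. fst (picard q \<alpha> \<beta> s n x))"

definition ivp' :: "(real \<Rightarrow> real) \<Rightarrow> complex \<Rightarrow> complex \<Rightarrow> complex \<Rightarrow> real \<Rightarrow> complex" where
  "ivp' q \<alpha> \<beta> s x = (\<Sum>n. snd (picard q \<alpha> \<beta> s n x))"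

locale half_line =
  fixes q :: "real \<Rightarrow> real"
  assumes q_integrable: "q absolutely_integrable_on {0..}"
begin

lemma q_Icc: "0 \<le> a \<Longrightarrow> q absolutely_integrable_on {a..b}"
  using q_integrable by (rule absolutely_integrable_on_subinterval) auto

lemma abs_q_Icc: "0 \<le> a \<Longrightarrow> (\<lambda>x. \<bar>q x\<bar>) absolutely_integrable_on {a..b}"
  using absolutely_integrable_norm[OF q_Icc[of a b]] by (simp add: o_def)

lemma qs_Icc: "0 \<le> a \<Longrightarrow> (\<lambda>x. complex_of_real (q x) + s) absolutely_integrable_on {a..b}"
  by (intro set_integral_add absolutely_integrable_of_real q_Icc absolutely_integrable_continuous_real continuous_intros)

lemma qs_mult_Icc: "0 \<le> a \<Longrightarrow> continuous_on {a..b} y \<Longrightarrow> (\<lambda>x. (complex_of_real (q x) + s) * y x) absolutely_integrable_on {a..b}"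
  by (intro absolutely_integrable_mult_continuous qs_Icc)

text \<open>One weight for both components of the system: 1 bounds the coefficient in
  \<open>y' = v\<close>, and \<open>\<bar>q t\<bar> + r\<close> the one in
  \<open>v' = (q + s) y\<close> for all \<open>norm s \<le> r\<close>.\<close>

definition wt :: "real \<Rightarrow> real \<Rightarrow> real" where "wt r t = 1 + \<bar>q t\<bar> + r"
definition Wt :: "real \<Rightarrow> real \<Rightarrow> real" where "Wt r x = integral {0..x} (wt r)"

lemma wt_Icc: "0 \<le> a \<Longrightarrow> wt r absolutely_integrable_on {a..b}"
  unfolding wt_def by (intro set_integral_add absolutely_integrable_continuous_real continuous_intros abs_q_Icc)

lemma wt_nonneg: "r \<ge> 0 \<Longrightarrow> wt r t \<ge> 0" by (simp add: wt_def)

lemma norm_qs_le: "norm s \<le> r \<Longrightarrow> norm (complex_of_real (q t) + s) \<le> wt r t"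
  using norm_triangle_ineq[of "complex_of_real (q t)" s] by (simp add: wt_def)

lemma Wt_mono: "0 \<le> r \<Longrightarrow> 0 \<le> x \<Longrightarrow> x \<le> y \<Longrightarrow> Wt r x \<le> Wt r y"
  unfolding Wt_def
  by (rule integral_subset_le) (auto intro: wt_nonneg wt_Icc[THEN absolutely_integrable_on_def[THEN iffD1, THEN conjunct1]])

lemma continuous_Wt: "continuous_on {0..b} (Wt r)"
  unfolding Wt_def
  by (intro indefinite_integral_continuous_1 wt_Icc[THEN absolutely_integrable_on_def[THEN iffD1, THEN conjunct1]]) auto

lemma picard_continuous:
  "continuous_on {0..b} (\<lambda>x. fst (picard q \<alpha> \<beta> s n x))" "continuous_on {0..b} (\<lambda>x. snd (picard q \<alpha> \<beta> s n x))"
proof (induction n)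
  case (Suc n)
  { case 1 
    show ?case using Suc by (auto intro!: indefinite_integral_continuous_1 integrable_continuous_real)
  next
    case 2
    show ?case using qs_mult_Icc[OF _ Suc(1), of s]
      by (auto intro!: indefinite_integral_continuous_1 simp: absolutely_integrable_on_def) }
qed auto

text \<open>Each integration against \<open>wt r\<close> gains 1/2 in the weighted norm, by
  \<open>integral_exp_weight_le\<close>. The bound depends on \<open>s\<close> only through
  \<open>r\<close>, which later gives local uniformity in \<open>s\<close>.\<close>

lemma picard_bound:
  assumes "norm s \<le> r" "0 \<le> x"
  shows "norm (fst (picard q \<alpha> \<beta> s n x)) \<le> (norm \<alpha> + norm \<beta>) * (1/2) ^ n * exp (4 * Wt r x)"
    and "norm (snd (picard q \<alpha> \<beta> s n x)) \<le> (norm \<alpha> + norm \<beta>) * (1/2) ^ n * exp (4 * Wt r x)"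
proof -
  let ?C = "norm \<alpha> + norm \<beta>"
  have r: "r \<ge> 0" using assms norm_ge_zero order_trans by blast
  have "\<forall>x\<ge>0. norm (fst (picard q \<alpha> \<beta> s n x)) \<le> ?C * (1/2) ^ n * exp (4 * Wt r x) \<and>
     norm (snd (picard q \<alpha> \<beta> s n x)) \<le> ?C * (1/2) ^ n * exp (4 * Wt r x)"
  proof (induction n)
    case 0
    have "1 \<le> exp (4 * Wt r x)" if "x \<ge> 0" for x
      using Wt_mono[OF r _ that] r by (simp add: Wt_def)
    then have *: "?C * 1 \<le> ?C * exp (4 * Wt r x)" if "x \<ge> 0" for x
      using that by (intro mult_left_mono) auto
    have "norm \<alpha> \<le> ?C * exp (4 * Wt r x)" "norm \<beta> \<le> ?C * exp (4 * Wt r x)" if "x \<ge> 0" for x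
      using order_trans[OF _ *[OF that]] by simp_all
    then show ?case by simp
  next
    case (Suc n)
    have main: "norm (integral {0..x} F) \<le> ?C * (1/2) ^ Suc n * exp (4 * Wt r x)"
      if x: "x \<ge> 0" and F: "F integrable_on {0..x}" 
        and le: "\<And>t. t \<in> {0..x} \<Longrightarrow> norm (F t) \<le> wt r t * (?C * (1/2) ^ n * exp (4 * Wt r t))" for x and F :: "real \<Rightarrow> complex"
    proof -
      have int: "(\<lambda>t. wt r t * exp (4 * Wt r t)) integrable_on {0..x}"
        by (intro set_lebesgue_integral_eq_integral(1) absolutely_integrable_mult_continuous_real wt_Icc continuous_intros continuous_Wt) simp
      have "norm (integral {0..x} F) \<le> integral {0..x} (\<lambda>t. ?C * (1/2) ^ n * (wt r t * exp (4 * Wt r t)))"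
        using le by (intro integral_norm_bound_integral F integrable_on_mult_right int) (auto simp: algebra_simps)
      also have "\<dots> = ?C * (1/2) ^ n * integral {0..x} (\<lambda>t. wt r t * exp (4 * Wt r t))" by simp
      also have "\<dots> \<le> ?C * (1/2) ^ n * (exp (4 * Wt r x) / 2)"
        using integral_exp_weight_le[OF x wt_Icc wt_nonneg, of r, folded Wt_def] r by (intro mult_left_mono) auto
      finally show ?thesis by simp
    qed
    show ?case
    proof (intro allI impI conjI)
      fix x :: real assume x: "x \<ge> 0"
      show "norm (fst (picard q \<alpha> \<beta> s (Suc n) x)) \<le> ?C * (1/2) ^ Suc n * exp (4 * Wt r x)"
        unfolding picard.simps fst_conv
      proof (rule main[OF x])
        show "(\<lambda>t. snd (picard q \<alpha> \<beta> s n t)) integrable_on {0..x}" by (intro integrable_continuous_real picard_continuous)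
        fix t assume t: "t \<in> {0..x}"
        have "norm (snd (picard q \<alpha> \<beta> s n t)) \<le> 1 * (?C * (1/2) ^ n * exp (4 * Wt r t))" using Suc t by simp
        also have "\<dots> \<le> wt r t * (?C * (1/2) ^ n * exp (4 * Wt r t))" using r by (intro mult_right_mono) (auto simp: wt_def)
        finally show "norm (snd (picard q \<alpha> \<beta> s n t)) \<le> wt r t * (?C * (1/2) ^ n * exp (4 * Wt r t))" .
      qed
      show "norm (snd (picard q \<alpha> \<beta> s (Suc n) x)) \<le> ?C * (1/2) ^ Suc n * exp (4 * Wt r x)"
        unfolding picard.simps snd_conv
      proof (rule main[OF x])
        show "(\<lambda>t. (complex_of_real (q t) + s) * fst (picard q \<alpha> \<beta> s n t)) integrable_on {0..x}"
          using qs_mult_Icc[OF _ picard_continuous(1)] by (simp add: absolutely_integrable_on_def)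
        fix t assume t: "t \<in> {0..x}"
        show "norm ((complex_of_real (q t) + s) * fst (picard q \<alpha> \<beta> s n t)) \<le> wt r t * (?C * (1/2) ^ n * exp (4 * Wt r t))"
          unfolding norm_mult using Suc t r norm_qs_le[OF assms(1)] by (intro mult_mono wt_nonneg) auto
      qed
    qed
  qed
  then show "norm (fst (picard q \<alpha> \<beta> s n x)) \<le> ?C * (1/2) ^ n * exp (4 * Wt r x)"
    and "norm (snd (picard q \<alpha> \<beta> s n x)) \<le> ?C * (1/2) ^ n * exp (4 * Wt r x)" using assms by auto
qed

lemma picard_summable:
  assumes "0 \<le> x" 
  shows "summable (\<lambda>n. fst (picard q \<alpha> \<beta> s n x))" "summable (\<lambda>n. snd (picard q \<alpha> \<beta> s n x))"
proof -
  have g: "summable (\<lambda>n. (norm \<alpha> + norm \<beta>) * (1/2) ^ n * exp (4 * Wt (norm s) x))"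
    by (intro summable_mult summable_mult2 summable_geometric) auto
  show "summable (\<lambda>n. fst (picard q \<alpha> \<beta> s n x))"
    by (rule summable_comparison_test'[OF g]) (use picard_bound[OF order_refl assms] in auto)
  show "summable (\<lambda>n. snd (picard q \<alpha> \<beta> s n x))"
    by (rule summable_comparison_test'[OF g]) (use picard_bound[OF order_refl assms] in auto)
qed

lemma picard_partial_bound:
  assumes "0 \<le> x" "x \<le> b"
  shows "norm (\<Sum>n<k. fst (picard q \<alpha> \<beta> s n x)) \<le> 2 * (norm \<alpha> + norm \<beta>) * exp (4 * Wt (norm s) b)"
    and "norm (\<Sum>n<k. snd (picard q \<alpha> \<beta> s n x)) \<le> 2 * (norm \<alpha> + norm \<beta>) * exp (4 * Wt (norm s) b)"
proof -
  let ?C = "norm \<alpha> + norm \<beta>"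
  have sb: "norm (\<Sum>n<k. f n) \<le> 2 * ?C * exp (4 * Wt (norm s) b)"
    if f: "\<And>n. norm (f n) \<le> ?C * (1/2) ^ n * exp (4 * Wt (norm s) x)" for f :: "nat \<Rightarrow> complex"
  proof -
    have "norm (\<Sum>n<k. f n) \<le> (\<Sum>n<k. ?C * (1/2) ^ n * exp (4 * Wt (norm s) x))"
      by (rule order_trans[OF norm_sum sum_mono]) (rule f)
    also have "\<dots> = ?C * exp (4 * Wt (norm s) x) * (\<Sum>n<k. (1/2) ^ n)"
      unfolding sum_distrib_left by (intro sum.cong) (simp_all add: mult_ac)
    also have "\<dots> \<le> ?C * exp (4 * Wt (norm s) b) * 2"
    proof (intro mult_mono)
      show "exp (4 * Wt (norm s) x) \<le> exp (4 * Wt (norm s) b)" using Wt_mono[of "norm s" x b] assms by simp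
      show "(\<Sum>n<k. (1/2::real) ^ n) \<le> 2" by (subst sum_gp_strict) auto
    qed (auto intro!: sum_nonneg)
    finally show ?thesis by argo
  qed
  show "norm (\<Sum>n<k. fst (picard q \<alpha> \<beta> s n x)) \<le> 2 * ?C * exp (4 * Wt (norm s) b)"
    and "norm (\<Sum>n<k. snd (picard q \<alpha> \<beta> s n x)) \<le> 2 * ?C * exp (4 * Wt (norm s) b)"
    by (rule sb, rule picard_bound[OF order_refl \<open>0 \<le> x\<close>])+
qed

lemma ivp_0: "ivp q \<alpha> \<beta> s 0 = \<alpha>" "ivp' q \<alpha> \<beta> s 0 = \<beta>"
proof -
  have "fst (picard q \<alpha> \<beta> s n 0) = (if n = 0 then \<alpha> else 0)" "snd (picard q \<alpha> \<beta> s n 0) = (if n = 0 then \<beta> else 0)" for n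
    by (cases n; simp)+
  then show "ivp q \<alpha> \<beta> s 0 = \<alpha>" "ivp' q \<alpha> \<beta> s 0 = \<beta>"
    using suminf_finite[of "{0::nat}" "\<lambda>n. if n = 0 then \<alpha> else 0"] suminf_finite[of "{0::nat}" "\<lambda>n. if n = 0 then \<beta> else 0"]
    by (simp_all add: ivp_def ivp'_def)
qed

lemma sol_ivp: "sol q s (ivp q \<alpha> \<beta> s) (ivp' q \<alpha> \<beta> s)"
proof -
  let ?u = "\<lambda>k t. \<Sum>n<k. fst (picard q \<alpha> \<beta> s n t)" and ?v = "\<lambda>k t. \<Sum>n<k. snd (picard q \<alpha> \<beta> s n t)"
  have cu: "continuous_on {0..b} (?u k)" and cv: "continuous_on {0..b} (?v k)" for b k
    by (intro continuous_intros picard_continuous)+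
  have limu: "(\<lambda>k. ?u k t) \<longlonglongrightarrow> ivp q \<alpha> \<beta> s t" and limv: "(\<lambda>k. ?v k t) \<longlonglongrightarrow> ivp' q \<alpha> \<beta> s t" if "t \<ge> 0" for t
    using picard_summable[OF that, of \<alpha> \<beta> s, THEN summable_LIMSEQ] by (simp_all add: ivp_def ivp'_def)
  have *: "ivp' q \<alpha> \<beta> s absolutely_integrable_on {0..b} \<and> ivp q \<alpha> \<beta> s b = ivp q \<alpha> \<beta> s 0 + integral {0..b} (ivp' q \<alpha> \<beta> s)"
    if b: "b \<ge> 0" for b
  proof
    let ?B = "\<lambda>_. 2 * (norm \<alpha> + norm \<beta>) * exp (4 * Wt (norm s) b)"
    have int: "(\<lambda>k. integral {0..b} (?v k)) \<longlonglongrightarrow> integral {0..b} (ivp' q \<alpha> \<beta> s)"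
      by (rule dominated_convergence(2)[where h = ?B])
         (use limv picard_partial_bound[of _ b] in \<open>auto intro!: integrable_continuous_real cv\<close>)
    show "ivp' q \<alpha> \<beta> s absolutely_integrable_on {0..b}"
    proof (rule dominated_convergence_absolutely_integrable[where h = ?B and f = ?v])
      fix x assume x: "x \<in> {0..b}"
      show "norm (ivp' q \<alpha> \<beta> s x) \<le> ?B x"
        by (rule tendsto_upperbound[OF tendsto_norm[OF limv[of x]]]) (use x picard_partial_bound(2)[of x b] in auto)
    qed (use limv in \<open>auto intro!: absolutely_integrable_continuous_real cv\<close>)
    \<comment> \<open>The term of index 0 is the initial value and the term of index
      \<open>Suc n\<close> integrates that of index \<open>n\<close>; so the partial sums satisfy
      the integral equation up to a shift by one.\<close>
    have "\<alpha> + integral {0..b} (?v k) = ?u (Suc k) b" for k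
      unfolding sum.lessThan_Suc_shift
      by (simp add: integral_sum integrable_continuous_real picard_continuous)
    then have "(\<lambda>k. ?u (Suc k) b) \<longlonglongrightarrow> \<alpha> + integral {0..b} (ivp' q \<alpha> \<beta> s)"
      using tendsto_add[OF tendsto_const[of \<alpha>] int] by simp
    then show "ivp q \<alpha> \<beta> s b = ivp q \<alpha> \<beta> s 0 + integral {0..b} (ivp' q \<alpha> \<beta> s)"
      using LIMSEQ_unique[OF LIMSEQ_Suc[OF limu[OF b]]] by (simp add: ivp_0)
  qed
  have **: "(\<lambda>t. (complex_of_real (q t) + s) * ivp q \<alpha> \<beta> s t) absolutely_integrable_on {0..b} \<and> 
      ivp' q \<alpha> \<beta> s b = ivp' q \<alpha> \<beta> s 0 + integral {0..b} (\<lambda>t. (complex_of_real (q t) + s) * ivp q \<alpha> \<beta> s t)"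
    if b: "b \<ge> 0" for b
  proof
    let ?K = "2 * (norm \<alpha> + norm \<beta>) * exp (4 * Wt (norm s) b)"
    let ?B = "\<lambda>t. wt (norm s) t * ?K" and ?w = "\<lambda>t. complex_of_real (q t) + s"
    have B: "?B integrable_on {0..b}"
      by (rule integrable_on_mult_left) (rule set_lebesgue_integral_eq_integral(1)[OF wt_Icc], simp)
    have le: "norm (?w t * z) \<le> ?B t" if "norm z \<le> ?K" for t z
      unfolding norm_mult using that norm_qs_le[OF order_refl] by (intro mult_mono wt_nonneg) auto
    have wu: "(\<lambda>t. ?w t * ?u k t) absolutely_integrable_on {0..b}" for k by (intro qs_mult_Icc cu) auto
    have int: "(\<lambda>k. integral {0..b} (\<lambda>t. ?w t * ?u k t)) \<longlonglongrightarrow> integral {0..b} (\<lambda>t. ?w t * ivp q \<alpha> \<beta> s t)"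
    proof (rule dominated_convergence(2)[where h = ?B])
      show "(\<lambda>t. ?w t * ?u k t) integrable_on {0..b}" for k using wu by (simp add: absolutely_integrable_on_def)
      show "norm (?w x * ?u k x) \<le> ?B x" if "x \<in> {0..b}" for k x
        using that by (intro le picard_partial_bound) auto
    qed (use limu B in \<open>auto intro!: tendsto_intros\<close>)
    show "(\<lambda>t. ?w t * ivp q \<alpha> \<beta> s t) absolutely_integrable_on {0..b}"
    proof (rule dominated_convergence_absolutely_integrable[where h = ?B and f = "\<lambda>k t. ?w t * ?u k t"])
      fix x assume x: "x \<in> {0..b}"
      show "norm (?w x * ivp q \<alpha> \<beta> s x) \<le> ?B x"
        by (rule le, rule tendsto_upperbound[OF tendsto_norm[OF limu[of x]]]) (use x picard_partial_bound(1)[of x b] in auto)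
    qed (use limu B wu in \<open>auto intro!: tendsto_intros\<close>)
    have "\<beta> + integral {0..b} (\<lambda>t. ?w t * ?u k t) = ?v (Suc k) b" for k
    proof -
      have "(\<lambda>t. ?w t * fst (picard q \<alpha> \<beta> s n t)) integrable_on {0..b}" for n
        using qs_mult_Icc[OF _ picard_continuous(1)] by (simp add: absolutely_integrable_on_def)
      then show ?thesis unfolding sum.lessThan_Suc_shift sum_distrib_left
        by (subst integral_sum) auto
    qed
    then have "(\<lambda>k. ?v (Suc k) b) \<longlonglongrightarrow> \<beta> + integral {0..b} (\<lambda>t. ?w t * ivp q \<alpha> \<beta> s t)"
      using tendsto_add[OF tendsto_const[of \<beta>] int] by simp
    then show "ivp' q \<alpha> \<beta> s b = ivp' q \<alpha> \<beta> s 0 + integral {0..b} (\<lambda>t. ?w t * ivp q \<alpha> \<beta> s t)"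
      using LIMSEQ_unique[OF LIMSEQ_Suc[OF limv[OF b]]] by (simp add: ivp_0)
  qed
  show ?thesis unfolding sol_def using * ** by (auto intro!: loc_AC_atLeastI)
qed

section \<open>Uniqueness and dependence on the spectral parameter\<close>

lemma sol_unique_0:
  assumes y: "sol q s y v" and 0: "y 0 = 0" "v 0 = 0" and "0 \<le> x"
  shows "y x = 0 \<and> v x = 0"
proof -
  let ?u = "\<lambda>x. norm (y x) + norm (v x)"
  have cont: "continuous_on {0..x} y" "continuous_on {0..x} v" using sol_continuous[OF y] by auto
  have "?u x \<le> 0 * exp (2 * integral {0..x} (wt (norm s)))"
  proof (rule gronwall[OF \<open>0 \<le> x\<close> _ wt_Icc])
    show "continuous_on {0..x} ?u" by (intro continuous_intros cont)
    fix t assume t: "t \<in> {0..x}"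
    have ct: "continuous_on {0..t} y" "continuous_on {0..t} v" using sol_continuous[OF y] by auto
    have i: "(\<lambda>t. wt (norm s) t * ?u t) integrable_on {0..t}"
      using absolutely_integrable_mult_continuous_real[OF wt_Icc, of 0 t ?u] ct by (simp add: absolutely_integrable_on_def continuous_intros)
    have "y t = integral {0..t} v" "v t = integral {0..t} (\<lambda>x. (complex_of_real (q x) + s) * y x)"
      using y t 0 loc_AC_diff_eq[of "{0..}" y v 0 t] loc_AC_diff_eq[of "{0..}" v _ 0 t] by (auto simp: sol_def)
    moreover have "norm (integral {0..t} v) \<le> integral {0..t} (\<lambda>t. norm (v t))"
      by (intro integral_norm_bound_integral integrable_continuous_real continuous_intros ct) auto
    moreover have "norm (integral {0..t} (\<lambda>x. (complex_of_real (q x) + s) * y x)) \<le> integral {0..t} (\<lambda>x. norm ((complex_of_real (q x) + s) * y x))"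
      using qs_mult_Icc[OF _ ct(1), of s] by (intro integral_norm_bound_integral) (auto simp: absolutely_integrable_on_def)
    ultimately have "?u t \<le> integral {0..t} (\<lambda>x. norm ((complex_of_real (q x) + s) * y x)) + integral {0..t} (\<lambda>t. norm (v t))" by simp
    also have "\<dots> = integral {0..t} (\<lambda>x. norm ((complex_of_real (q x) + s) * y x) + norm (v x))"
      using qs_mult_Icc[OF _ ct(1), of s]
      by (intro integral_add[symmetric] integrable_continuous_real[where f = "\<lambda>x. norm (v x)"] continuous_intros ct)
        (auto simp: absolutely_integrable_on_def)
    also have "\<dots> \<le> integral {0..t} (\<lambda>t. wt (norm s) t * ?u t)"
    proof (rule integral_le[OF _ i])
      show "(\<lambda>x. norm ((complex_of_real (q x) + s) * y x) + norm (v x)) integrable_on {0..t}"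
        using qs_mult_Icc[OF _ ct(1), of s] 
        by (intro integrable_add integrable_continuous_real[where f = "\<lambda>x. norm (v x)"] continuous_intros ct) (auto simp: absolutely_integrable_on_def)
      fix x
      have "norm ((complex_of_real (q x) + s) * y x) \<le> wt (norm s) x * norm (y x)"
        unfolding norm_mult using norm_qs_le[OF order_refl] by (intro mult_right_mono) auto
      moreover have "1 * norm (v x) \<le> wt (norm s) x * norm (v x)" by (intro mult_right_mono) (auto simp: wt_def)
      ultimately show "norm ((complex_of_real (q x) + s) * y x) + norm (v x) \<le> wt (norm s) x * ?u x" by (simp add: distrib_left)
    qed
    finally show "?u t \<le> 0 + integral {0..t} (\<lambda>t. wt (norm s) t * ?u t)" by simp
  qed (auto simp: wt_nonneg)
  then have "norm (y x) + norm (v x) \<le> 0" by simp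
  then show ?thesis by (smt (verit) norm_ge_zero norm_eq_zero)
qed

lemma sol_unique:
  assumes "sol q s y v" "sol q s z w" "y 0 = z 0" "v 0 = w 0" "0 \<le> x"
  shows "y x = z x" "v x = w x"
  using sol_unique_0[OF sol_lincomb[OF assms(1,2), of 1 "-1"]] assms(3-5) by auto

text \<open>Holomorphy of the terms in \<open>s\<close> comes from here, without differentiation
  under the integral. The coefficients are tracked as continuous functions because the induction
  integrates them in \<open>x\<close>; that they vanish beyond degree \<open>n\<close> allows the
  sums to be extended by one index.\<close>

lemma picard_polynomial:
  "\<exists>c d. (\<forall>j b. continuous_on {0..b} (c j)) \<and> (\<forall>j b. continuous_on {0..b} (d j)) \<and> (\<forall>j>n. c j = (\<lambda>x. 0)) \<and> (\<forall>j>n. d j = (\<lambda>x. 0)) \<and>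
     (\<forall>s. \<forall>x\<ge>0. fst (picard q \<alpha> \<beta> s n x) = (\<Sum>j\<le>n. c j x * s ^ j) \<and> snd (picard q \<alpha> \<beta> s n x) = (\<Sum>j\<le>n. d j x * s ^ j))"
proof (induction n)
  case 0
  show ?case
    by (rule exI[of _ "\<lambda>j x. if j = 0 then \<alpha> else 0"], rule exI[of _ "\<lambda>j x. if j = 0 then \<beta> else 0"]) auto
next
  case (Suc n)
  from Suc.IH obtain c d where "(\<forall>j b. continuous_on {0..b} (c j)) \<and> (\<forall>j b. continuous_on {0..b} (d j)) \<and> (\<forall>j>n. c j = (\<lambda>x. 0)) \<and> (\<forall>j>n. d j = (\<lambda>x. 0)) \<and>
     (\<forall>s. \<forall>x\<ge>0. fst (picard q \<alpha> \<beta> s n x) = (\<Sum>j\<le>n. c j x * s ^ j) \<and> snd (picard q \<alpha> \<beta> s n x) = (\<Sum>j\<le>n. d j x * s ^ j))"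
    by (elim exE)
  then have c: "\<And>j b. continuous_on {0..b} (c j)" and d: "\<And>j b. continuous_on {0..b} (d j)"
    and c0: "\<And>j. j > n \<Longrightarrow> c j = (\<lambda>x. 0)" and d0: "\<And>j. j > n \<Longrightarrow> d j = (\<lambda>x. 0)"
    and P: "\<And>s x. x \<ge> 0 \<Longrightarrow> fst (picard q \<alpha> \<beta> s n x) = (\<Sum>j\<le>n. c j x * s ^ j)"
     "\<And>s x. x \<ge> 0 \<Longrightarrow> snd (picard q \<alpha> \<beta> s n x) = (\<Sum>j\<le>n. d j x * s ^ j)"
    by blast+
  \<comment> \<open>Multiplication by \<open>s\<close> shifts the coefficients by one index.\<close>
  define c' where "c' j = (case j of 0 \<Rightarrow> (\<lambda>x. 0) | Suc i \<Rightarrow> c i)" for j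
  have c': "continuous_on {0..b} (c' j)" for b j by (cases j) (auto simp: c'_def c)
  define C where "C = (\<lambda>j x. integral {0..x} (d j))"
  define D where "D = (\<lambda>j x. integral {0..x} (\<lambda>t. complex_of_real (q t) * c j t + c' j t))"
  have iD: "(\<lambda>t. complex_of_real (q t) * c j t + c' j t) integrable_on {0..b}" for j b
  proof (rule integrable_add)
    show "(\<lambda>t. complex_of_real (q t) * c j t) integrable_on {0..b}"
      by (intro set_lebesgue_integral_eq_integral(1) absolutely_integrable_mult_continuous absolutely_integrable_of_real q_Icc c) simp
    show "c' j integrable_on {0..b}" by (intro integrable_continuous_real c')
  qed
  show ?case
  proof (rule exI[of _ C], rule exI[of _ D], intro conjI allI impI)
    show "continuous_on {0..b} (C j)" for j b
      unfolding C_def by (intro indefinite_integral_continuous_1 integrable_continuous_real d)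
    show "continuous_on {0..b} (D j)" for j b
      unfolding D_def by (intro indefinite_integral_continuous_1 iD)
    show "C j = (\<lambda>x. 0)" if "j > Suc n" for j using d0 that by (auto simp: C_def)
    show "D j = (\<lambda>x. 0)" if "j > Suc n" for j using c0 that by (cases j) (auto simp: D_def c'_def)
    fix s :: complex and x :: real assume x: "x \<ge> 0"
    have "fst (picard q \<alpha> \<beta> s (Suc n) x) = integral {0..x} (\<lambda>t. \<Sum>j\<le>n. d j t * s ^ j)"
      unfolding picard.simps fst_conv by (rule Henstock_Kurzweil_Integration.integral_cong) (use P in auto)
    also have "\<dots> = (\<Sum>j\<le>n. C j x * s ^ j)"
      by (subst integral_sum) (auto simp: C_def intro!: integrable_continuous_real continuous_intros d)
    also have "\<dots> = (\<Sum>j\<le>Suc n. C j x * s ^ j)" using d0[of "Suc n"] by (simp add: C_def)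
    finally show "fst (picard q \<alpha> \<beta> s (Suc n) x) = (\<Sum>j\<le>Suc n. C j x * s ^ j)" .
    have eq: "(complex_of_real (q t) + s) * (\<Sum>j\<le>n. c j t * s ^ j) = (\<Sum>j\<le>Suc n. (complex_of_real (q t) * c j t + c' j t) * s ^ j)" for t
    proof -
      have "(\<Sum>j\<le>Suc n. (complex_of_real (q t) * c j t + c' j t) * s ^ j) = (\<Sum>j\<le>Suc n. complex_of_real (q t) * c j t * s ^ j) + (\<Sum>j\<le>Suc n. c' j t * s ^ j)"
        by (simp add: distrib_right sum.distrib)
      moreover have "(\<Sum>j\<le>Suc n. c' j t * s ^ j) = s * (\<Sum>j\<le>n. c j t * s ^ j)"
        by (simp only: sum.atMost_Suc_shift) (simp add: c'_def sum_distrib_left mult_ac)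
      moreover have "(\<Sum>j\<le>Suc n. complex_of_real (q t) * c j t * s ^ j) = complex_of_real (q t) * (\<Sum>j\<le>n. c j t * s ^ j)"
        using c0[of "Suc n"] by (simp add: sum_distrib_left mult_ac)
      ultimately show ?thesis by (simp only: distrib_right[of "complex_of_real (q t)" s])
    qed
    have "snd (picard q \<alpha> \<beta> s (Suc n) x) = integral {0..x} (\<lambda>t. \<Sum>j\<le>Suc n. (complex_of_real (q t) * c j t + c' j t) * s ^ j)"
      unfolding picard.simps snd_conv eq[symmetric] by (rule Henstock_Kurzweil_Integration.integral_cong) (use P in auto)
    also have "\<dots> = (\<Sum>j\<le>Suc n. D j x * s ^ j)"
      by (subst integral_sum) (auto simp: D_def intro!: integrable_on_mult_left iD)
    finally show "snd (picard q \<alpha> \<beta> s (Suc n) x) = (\<Sum>j\<le>Suc n. D j x * s ^ j)" .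
  qed
qed

lemma picard_holomorphic:
  assumes "0 \<le> x"
  shows "(\<lambda>s. fst (picard q \<alpha> \<beta> s n x)) holomorphic_on A" "(\<lambda>s. snd (picard q \<alpha> \<beta> s n x)) holomorphic_on A"
proof -
  obtain c d where P: "\<And>s. fst (picard q \<alpha> \<beta> s n x) = (\<Sum>j\<le>n. c j x * s ^ j)" "\<And>s. snd (picard q \<alpha> \<beta> s n x) = (\<Sum>j\<le>n. d j x * s ^ j)"
    using picard_polynomial[of n \<alpha> \<beta>] assms by blast
  show "(\<lambda>s. fst (picard q \<alpha> \<beta> s n x)) holomorphic_on A" "(\<lambda>s. snd (picard q \<alpha> \<beta> s n x)) holomorphic_on A"
    unfolding P by (intro holomorphic_intros)+
qed

lemma picard_uniform:
  assumes "0 \<le> x"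
  shows "uniform_limit (cball z 1) (\<lambda>k s. \<Sum>n<k. fst (picard q \<alpha> \<beta> s n x)) (\<lambda>s. ivp q \<alpha> \<beta> s x) sequentially"
   "uniform_limit (cball z 1) (\<lambda>k s. \<Sum>n<k. snd (picard q \<alpha> \<beta> s n x)) (\<lambda>s. ivp' q \<alpha> \<beta> s x) sequentially"
proof -
  let ?r = "norm z + 1"
  have g: "summable (\<lambda>n. (norm \<alpha> + norm \<beta>) * (1/2) ^ n * exp (4 * Wt ?r x))"
    by (intro summable_mult summable_mult2 summable_geometric) auto
  have r: "norm s \<le> ?r" if "s \<in> cball z 1" for s
    using that norm_triangle_ineq2[of s z] by (auto simp: dist_norm norm_minus_commute)
  show "uniform_limit (cball z 1) (\<lambda>k s. \<Sum>n<k. fst (picard q \<alpha> \<beta> s n x)) (\<lambda>s. ivp q \<alpha> \<beta> s x) sequentially"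
    unfolding ivp_def by (rule Weierstrass_m_test[OF _ g]) (rule picard_bound[OF r assms])
  show "uniform_limit (cball z 1) (\<lambda>k s. \<Sum>n<k. snd (picard q \<alpha> \<beta> s n x)) (\<lambda>s. ivp' q \<alpha> \<beta> s x) sequentially"
    unfolding ivp'_def by (rule Weierstrass_m_test[OF _ g]) (rule picard_bound[OF r assms])
qed

lemma ivp_holomorphic:
  assumes "0 \<le> x"
  shows "(\<lambda>s. ivp q \<alpha> \<beta> s x) holomorphic_on UNIV" "(\<lambda>s. ivp' q \<alpha> \<beta> s x) holomorphic_on UNIV"
proof -
  show "(\<lambda>s. ivp q \<alpha> \<beta> s x) holomorphic_on UNIV"
    by (rule holomorphic_uniform_sequence[OF open_UNIV, where f = "\<lambda>k s. \<Sum>n<k. fst (picard q \<alpha> \<beta> s n x)"])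
      (auto intro!: holomorphic_intros picard_holomorphic assms picard_uniform exI[of _ 1])
  show "(\<lambda>s. ivp' q \<alpha> \<beta> s x) holomorphic_on UNIV"
    by (rule holomorphic_uniform_sequence[OF open_UNIV, where f = "\<lambda>k s. \<Sum>n<k. snd (picard q \<alpha> \<beta> s n x)"])
      (auto intro!: holomorphic_intros picard_holomorphic assms picard_uniform exI[of _ 1])
qed

lemma ivp_cnj:
  assumes "0 \<le> x"
  shows "cnj (ivp q \<alpha> \<beta> s x) = ivp q (cnj \<alpha>) (cnj \<beta>) (cnj s) x" "cnj (ivp' q \<alpha> \<beta> s x) = ivp' q (cnj \<alpha>) (cnj \<beta>) (cnj s) x"
  using sol_unique[OF sol_cnj[OF sol_ivp] sol_ivp _ _ assms] by (auto simp: ivp_0)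

lemma sol_eq_ivp:
  assumes "sol q s y v" "0 \<le> x"
  shows "y x = ivp q (y 0) (v 0) s x" "v x = ivp' q (y 0) (v 0) s x"
  using sol_unique[OF assms(1) sol_ivp _ _ assms(2)] by (auto simp: ivp_0)

lemma ivp_lincomb:
  assumes "0 \<le> x"
  shows "ivp q \<alpha> \<beta> s x = \<alpha> * ivp q 1 0 s x + \<beta> * ivp q 0 1 s x" "ivp' q \<alpha> \<beta> s x = \<alpha> * ivp' q 1 0 s x + \<beta> * ivp' q 0 1 s x"
  using sol_unique[OF sol_ivp[of s \<alpha> \<beta>] sol_lincomb[OF sol_ivp[of s 1 0] sol_ivp[of s 0 1], where a = \<alpha> and b = \<beta>] _ _ assms]
  by (auto simp: ivp_0)

end

section \<open>Jost solutions on the half-line\<close>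

lemma continuous_on_atLeastI:
  fixes f :: "real \<Rightarrow> 'a::topological_space"
  assumes "\<And>b. continuous_on {a..b} f" shows "continuous_on {a..} f"
  unfolding continuous_on_eq_continuous_within
proof
  fix x assume x: "x \<in> {a..}"
  have "at x within {a..} = at x within {a..x+1}"
    by (rule at_within_nhd[of x "{..<x+1}"]) auto
  then show "continuous (at x within {a..}) f"
    using assms[of "x+1"] x unfolding continuous_on_eq_continuous_within by force
qed

lemma sol_exp:
  assumes "sol q (k\<^sup>2) y v"
  shows "loc_AC {0..} (\<lambda>x. exp (k * complex_of_real x) * (v x - k * y x)) (\<lambda>x. (exp (k * complex_of_real x) * y x) * complex_of_real (q x))"
proof -
  have "loc_AC {0..} (\<lambda>x. exp (k * complex_of_real x) * (v x - k * y x))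
     (\<lambda>x. k * exp (k * complex_of_real x) * (v x - k * y x) + exp (k * complex_of_real x) * ((complex_of_real (q x) + k\<^sup>2) * y x - k * v x))"
    by (intro loc_AC_mult loc_AC_exp loc_AC_diff loc_AC_cmult is_interval_ci) (use assms in \<open>auto simp: sol_def\<close>)
  moreover have "k * exp (k * complex_of_real x) * (v x - k * y x) + exp (k * complex_of_real x) * ((complex_of_real (q x) + k\<^sup>2) * y x - k * v x)
     = (exp (k * complex_of_real x) * y x) * complex_of_real (q x)" for x
    by (simp add: algebra_simps power2_eq_square)
  ultimately show ?thesis by simp
qed

context half_line
begin

section \<open>Tail integrals of the potential\<close>

definition tail :: "real \<Rightarrow> real" where "tail x = integral {x..} (\<lambda>t. \<bar>q t\<bar>)"

lemma abs_q_atLeast: "0 \<le> a \<Longrightarrow> (\<lambda>t. \<bar>q t\<bar>) absolutely_integrable_on {a..}"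
  using set_integrable_subset[OF set_integrable_abs[OF q_integrable], of "{a..}"] by auto

lemma tail_combine:
  assumes "0 \<le> a" "a \<le> b" shows "tail a = integral {a..b} (\<lambda>t. \<bar>q t\<bar>) + tail b"
proof -
  have "integral ({a..b} \<union> {b..}) (\<lambda>t. \<bar>q t\<bar>) = integral {a..b} (\<lambda>t. \<bar>q t\<bar>) + integral {b..} (\<lambda>t. \<bar>q t\<bar>)"
    by (rule Henstock_Kurzweil_Integration.integral_Un)
       (use assms abs_q_Icc[of a b] abs_q_atLeast[of b] in \<open>auto simp: set_lebesgue_integral_eq_integral(1) ivl_disj_un_two_touch\<close>)
  moreover have "{a..b} \<union> {b..} = {a..}" using assms by auto
  ultimately show ?thesis by (simp add: tail_def)
qed

lemma tail_nonneg: "0 \<le> a \<Longrightarrow> 0 \<le> tail a"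
  unfolding tail_def by (intro integral_nonneg set_lebesgue_integral_eq_integral(1) abs_q_atLeast) auto

lemma integral_abs_q_le: "0 \<le> a \<Longrightarrow> a \<le> b \<Longrightarrow> integral {a..b} (\<lambda>t. \<bar>q t\<bar>) \<le> tail a"
  using tail_combine[of a b] tail_nonneg[of b] by simp

lemma tail_antimono: "0 \<le> a \<Longrightarrow> a \<le> b \<Longrightarrow> tail b \<le> tail a"
  using tail_combine[of a b] integral_nonneg[of "\<lambda>t. \<bar>q t\<bar>" "{a..b}"] abs_q_Icc[of a b]
  by (simp add: set_lebesgue_integral_eq_integral(1))

lemma tail_tendsto: "(tail \<longlongrightarrow> 0) at_top"
proof -
  have "((\<lambda>b. LINT x:{0..b}|lebesgue. \<bar>q x\<bar>) \<longlongrightarrow> (LINT x:{0..}|lebesgue. \<bar>q x\<bar>)) at_top"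
    by (rule tendsto_set_lebesgue_integral_at_top) (use abs_q_atLeast[of 0] in auto)
  then have "((\<lambda>b. integral {0..b} (\<lambda>x. \<bar>q x\<bar>)) \<longlongrightarrow> tail 0) at_top"
    using abs_q_atLeast[of 0] abs_q_Icc[of 0]
    by (simp add: set_lebesgue_integral_eq_integral(2) tail_def)
  then have "((\<lambda>b. tail 0 - integral {0..b} (\<lambda>x. \<bar>q x\<bar>)) \<longlongrightarrow> tail 0 - tail 0) at_top"
    by (intro tendsto_intros)
  moreover have "eventually (\<lambda>b. tail 0 - integral {0..b} (\<lambda>x. \<bar>q x\<bar>) = tail b) at_top"
    using eventually_ge_at_top[of 0] by eventually_elim (simp add: tail_combine[of 0])
  ultimately show ?thesis by (simp add: tendsto_cong)
qed

lemma q_mult_atLeast: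
  fixes f :: "real \<Rightarrow> complex"
  assumes f: "continuous_on {0..} f" and bound: "\<And>t. t \<ge> 0 \<Longrightarrow> norm (f t) \<le> C" and a: "0 \<le> a"
  shows "(\<lambda>t. f t * complex_of_real (q t)) absolutely_integrable_on {a..}"
    and "norm (integral {a..} (\<lambda>t. f t * complex_of_real (q t))) \<le> C * tail a"
proof -
  have fm: "f \<in> borel_measurable (lebesgue_on {a..})"
    using continuous_on_subset[OF f, of "{a..}"] a by (intro continuous_imp_measurable_on_sets_lebesgue) auto
  have bd: "bounded (f ` {a..})" using bound a unfolding bounded_iff by (intro exI[of _ C]) auto
  have qi: "(\<lambda>t. complex_of_real (q t)) absolutely_integrable_on {a..}"
    using set_integrable_subset[OF q_integrable, of "{a..}"] a by (intro absolutely_integrable_of_real) auto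
  show i: "(\<lambda>t. f t * complex_of_real (q t)) absolutely_integrable_on {a..}"
    using absolutely_integrable_bounded_measurable_product[OF bilinear_times fm _ bd qi] by auto
  have "norm (integral {a..} (\<lambda>t. f t * complex_of_real (q t))) \<le> integral {a..} (\<lambda>t. C * \<bar>q t\<bar>)"
    using bound a
    by (intro integral_norm_bound_integral set_lebesgue_integral_eq_integral(1)[OF i] integrable_on_mult_right
       set_lebesgue_integral_eq_integral(1)[OF abs_q_atLeast]) (auto simp: norm_mult intro!: mult_right_mono)
  also have "\<dots> = C * tail a" by (simp add: tail_def)
  finally show "norm (integral {a..} (\<lambda>t. f t * complex_of_real (q t))) \<le> C * tail a" .
qed

lemma q_mult_bound_Icc:
  fixes F :: "real \<Rightarrow> complex"
  assumes ab: "0 \<le> a" "a \<le> b" and F: "continuous_on {a..b} F" and u: "continuous_on {a..b} u"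
    and le: "\<And>t. t \<in> {a..b} \<Longrightarrow> norm (F t) \<le> u t"
  shows "norm (integral {a..b} (\<lambda>t. F t * complex_of_real (q t))) \<le> integral {a..b} (\<lambda>t. \<bar>q t\<bar> * u t)"
proof (rule integral_norm_bound_integral)
  show "(\<lambda>t. F t * complex_of_real (q t)) integrable_on {a..b}"
    using ab by (intro set_lebesgue_integral_eq_integral(1) absolutely_integrable_mult_continuous absolutely_integrable_of_real q_Icc F)
  show "(\<lambda>t. \<bar>q t\<bar> * u t) integrable_on {a..b}"
    using ab by (intro set_lebesgue_integral_eq_integral(1) absolutely_integrable_mult_continuous_real abs_q_Icc u)
  show "norm (F x * complex_of_real (q x)) \<le> \<bar>q x\<bar> * u x" if "x \<in> {a..b}" for x
    using mult_left_mono[OF le[OF that], of "\<bar>q x\<bar>"] by (simp add: norm_mult mult.commute)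
qed

lemma integral_q_u_le:
  assumes ab: "0 \<le> a" "a \<le> b" and u: "continuous_on {a..b} u" and le: "\<And>t. t \<in> {a..b} \<Longrightarrow> u t \<le> C" and C: "0 \<le> C"
  shows "integral {a..b} (\<lambda>t. \<bar>q t\<bar> * u t) \<le> C * tail a"
proof -
  have "integral {a..b} (\<lambda>t. \<bar>q t\<bar> * u t) \<le> integral {a..b} (\<lambda>t. \<bar>q t\<bar> * C)"
    using ab le by (intro integral_le integrable_on_mult_left set_lebesgue_integral_eq_integral(1) 
      absolutely_integrable_mult_continuous_real abs_q_Icc u mult_left_mono) auto
  also have "\<dots> = C * integral {a..b} (\<lambda>t. \<bar>q t\<bar>)" by simp
  also have "\<dots> \<le> C * tail a" using ab C by (intro mult_left_mono integral_abs_q_le)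
  finally show ?thesis .
qed

text \<open>The two first-order factors of \<open>d\<^sup>2/dx\<^sup>2 - k\<^sup>2\<close>, conjugated by exponentials, have derivative
  \<open>exp (\<plusminus> k x) q y\<close>; they replace the variation of constants formula.\<close>

lemma exp_factors:
  assumes s: "sol q (k\<^sup>2) y v" and ab: "0 \<le> a" "a \<le> b"
  shows "exp (k * b) * (v b - k * y b) - exp (k * a) * (v a - k * y a) = integral {a..b} (\<lambda>t. (exp (k * t) * y t) * complex_of_real (q t))"
    and "exp (- k * b) * (v b + k * y b) - exp (- k * a) * (v a + k * y a) = integral {a..b} (\<lambda>t. (exp (- k * t) * y t) * complex_of_real (q t))"
proof -
  show "exp (k * b) * (v b - k * y b) - exp (k * a) * (v a - k * y a) = integral {a..b} (\<lambda>t. (exp (k * t) * y t) * complex_of_real (q t))"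
    using loc_AC_diff_eq[OF sol_exp[OF s], of a b] ab by simp
  have "sol q ((- k)\<^sup>2) y v" using s by simp
  from loc_AC_diff_eq[OF sol_exp[OF this], of a b] ab
  show "exp (- k * b) * (v b + k * y b) - exp (- k * a) * (v a + k * y a) = integral {a..b} (\<lambda>t. (exp (- k * t) * y t) * complex_of_real (q t))"
    by simp
qed

lemma sol_exp_continuous:
  assumes "sol q s y v" "0 \<le> a"
  shows "continuous_on {a..b} (\<lambda>t. exp (k * complex_of_real t) * y t)"
  using sol_continuous(1)[OF assms, of b] by (intro continuous_intros)

lemma norm_exp_mult_le: "0 \<le> Re k \<Longrightarrow> x \<le> 0 \<Longrightarrow> norm (exp (k * complex_of_real x)) \<le> 1"
  by (simp add: mult_nonneg_nonpos)

section \<open>Growth bounds in the closed right half-plane\<close>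

text \<open>The first factor changes by the integral of \<open>exp (- k t) q y\<close>. For the
  other one the integral of \<open>exp (k t) q y\<close> is multiplied by
  \<open>exp (- 2 k x)\<close>; relative to the first integrand this is the kernel
  \<open>exp (2 k (t - x))\<close>, of modulus at most 1 for \<open>t \<le> x\<close>. So the same
  integral bounds both.\<close>

lemma sol_forward_integral_bounds:
  assumes s: "sol q (k\<^sup>2) y v" and x: "0 \<le> x" and k: "Re k \<ge> 0"
  shows "norm (exp (- k * x) * (v x + k * y x) - (v 0 + k * y 0)) \<le> integral {0..x} (\<lambda>t. \<bar>q t\<bar> * norm (exp (- k * t) * y t))"
    and "norm (exp (- k * x) * (v x - k * y x) - exp (- 2 * k * x) * (v 0 - k * y 0)) \<le> integral {0..x} (\<lambda>t. \<bar>q t\<bar> * norm (exp (- k * t) * y t))"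
proof -
  have c: "continuous_on {0..x} (\<lambda>t. norm (exp (- k * complex_of_real t) * y t))"
    by (intro continuous_intros sol_continuous(1)[OF s]) auto
  show "norm (exp (- k * x) * (v x + k * y x) - (v 0 + k * y 0)) \<le> integral {0..x} (\<lambda>t. \<bar>q t\<bar> * norm (exp (- k * t) * y t))"
    using q_mult_bound_Icc[OF _ x sol_exp_continuous[OF s, of 0 x "-k"] c] exp_factors(2)[OF s _ x] by simp
  have "exp (- k * x) * (v x - k * y x) - exp (- 2 * k * x) * (v 0 - k * y 0)
     = exp (- 2 * k * x) * (exp (k * x) * (v x - k * y x) - exp (k * complex_of_real 0) * (v 0 - k * y 0))"
    by (simp add: right_diff_distrib flip: exp_add mult.assoc)
  also have "\<dots> = integral {0..x} (\<lambda>t. exp (- 2 * k * x) * ((exp (k * t) * y t) * complex_of_real (q t)))"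
    using exp_factors(1)[OF s _ x] by simp
  also have "\<dots> = integral {0..x} (\<lambda>t. (exp (- 2 * k * x) * (exp (k * t) * y t)) * complex_of_real (q t))"
    by (simp only: mult.assoc)
  also have "norm \<dots> \<le> integral {0..x} (\<lambda>t. \<bar>q t\<bar> * norm (exp (- k * t) * y t))"
  proof (rule q_mult_bound_Icc[OF _ x _ c])
    show "continuous_on {0..x} (\<lambda>t. exp (- 2 * k * complex_of_real x) * (exp (k * complex_of_real t) * y t))"
      by (intro continuous_intros sol_continuous(1)[OF s]) auto
    fix t assume t: "t \<in> {0..x}"
    have "exp (- 2 * k * x) * (exp (k * t) * y t) = exp (2 * k * complex_of_real (t - x)) * (exp (- k * t) * y t)"
      unfolding mult.assoc[symmetric] exp_add[symmetric] by (simp add: algebra_simps)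
    then show "norm (exp (- 2 * k * x) * (exp (k * t) * y t)) \<le> norm (exp (- k * t) * y t)"
      unfolding norm_mult[of "exp (2 * k * complex_of_real (t - x))"]
      using norm_exp_mult_le[of "2 * k" "t - x"] k t
      by (simp only: norm_mult[of "exp (2 * k * complex_of_real (t - x))"]) (intro mult_left_le_one_le, auto)
  qed simp
  finally show "norm (exp (- k * x) * (v x - k * y x) - exp (- 2 * k * x) * (v 0 - k * y 0)) \<le> integral {0..x} (\<lambda>t. \<bar>q t\<bar> * norm (exp (- k * t) * y t))" .
qed

text \<open>The Gronwall bound for the weight \<open>\<bar>q t\<bar> / norm k\<close>, with
  \<open>norm k\<close> replaced by a lower bound \<open>r\<close>. Uniformity over
  \<open>norm k \<ge> r\<close> makes the limits below locally uniform; it is lost at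
  \<open>k = 0\<close>.\<close>

definition growth :: "real \<Rightarrow> complex \<Rightarrow> complex \<Rightarrow> real" where
  "growth r \<alpha> \<beta> = (norm \<beta> / r + norm \<alpha>) * exp (2 * tail 0 / r)"

text \<open>The two first-order factors differ by \<open>2 k exp (- k x) y\<close>. Their bounds
  therefore close into an integral inequality for the norm of \<open>exp (- k x) y\<close>, and
  division by \<open>norm k\<close> produces the weight for Gronwall.\<close>

lemma sol_growth:
  assumes s: "sol q (k\<^sup>2) y v" and x: "0 \<le> x" and k: "Re k \<ge> 0" and r: "0 < r" "r \<le> norm k"
  shows "norm (exp (- k * x) * y x) \<le> growth r (y 0) (v 0)"
proof -
  have nk: "0 < norm k" using r by linarith
  let ?u = "\<lambda>t. norm (exp (- k * complex_of_real t) * y t)"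
  let ?C = "norm (v 0) / norm k + norm (y 0)"
  have c: "continuous_on {0..b} ?u" for b
    by (intro continuous_intros sol_continuous(1)[OF s]) auto
  have "?u x \<le> ?C * exp (2 * integral {0..x} (\<lambda>t. \<bar>q t\<bar> / norm k))"
  proof (rule gronwall[OF x c])
    show "(\<lambda>t. \<bar>q t\<bar> / norm k) absolutely_integrable_on {0..x}" by (intro set_integrable_divide abs_q_Icc) auto
    fix z assume z: "z \<in> {0..x}"
    let ?I = "integral {0..z} (\<lambda>t. \<bar>q t\<bar> * ?u t)"
    let ?B = "exp (- k * z) * (v z + k * y z)" and ?A = "exp (- k * z) * (v z - k * y z)"
    have "norm (?B - (v 0 + k * y 0)) \<le> ?I" "norm (?A - exp (- 2 * k * z) * (v 0 - k * y 0)) \<le> ?I"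
      using sol_forward_integral_bounds[OF s _ k, of z] z by auto
    moreover have "norm (exp (- 2 * k * z) * (v 0 - k * y 0)) \<le> norm (v 0 - k * y 0)"
      using norm_exp_mult_le[of "2 * k" "- z"] k z by (simp add: norm_mult mult_left_le_one_le)
    moreover have "norm (v 0 + k * y 0) \<le> norm (v 0) + norm k * norm (y 0)" "norm (v 0 - k * y 0) \<le> norm (v 0) + norm k * norm (y 0)"
      using norm_triangle_ineq[of "v 0" "k * y 0"] norm_triangle_ineq4[of "v 0" "k * y 0"] by (auto simp: norm_mult)
    ultimately have "norm ?B \<le> norm (v 0) + norm k * norm (y 0) + ?I" "norm ?A \<le> norm (v 0) + norm k * norm (y 0) + ?I"
      using norm_triangle_sub[of ?B "v 0 + k * y 0"] norm_triangle_sub[of ?A "exp (- 2 * k * z) * (v 0 - k * y 0)"] by linarith+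
    moreover have "norm (?B - ?A) \<le> norm ?B + norm ?A" by (rule norm_triangle_ineq4)
    moreover have "?B - ?A = 2 * k * (exp (- k * z) * y z)" by (simp add: algebra_simps)
    ultimately have "norm k * ?u z \<le> norm (v 0) + norm k * norm (y 0) + ?I" by (simp add: norm_mult)
    then have "?u z \<le> (norm (v 0) + norm k * norm (y 0) + ?I) / norm k"
      using nk by (simp add: pos_le_divide_eq mult.commute)
    also have "\<dots> = ?C + ?I / norm k" using nk by (simp add: add_divide_distrib)
    also have "?I / norm k = integral {0..z} (\<lambda>t. \<bar>q t\<bar> / norm k * ?u t)" by simp
    finally show "?u z \<le> ?C + integral {0..z} (\<lambda>t. \<bar>q t\<bar> / norm k * ?u t)" .
  qed auto
  also have "\<dots> = ?C * exp (2 * integral {0..x} (\<lambda>t. \<bar>q t\<bar>) / norm k)" by simp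
  also have "\<dots> \<le> growth r (y 0) (v 0)"
    unfolding growth_def
  proof (intro mult_mono)
    show "?C \<le> norm (v 0) / r + norm (y 0)" using r by (intro add_mono frac_le) auto
    have "2 * integral {0..x} (\<lambda>t. \<bar>q t\<bar>) / norm k \<le> 2 * tail 0 / r"
      using r integral_abs_q_le[OF _ x] tail_nonneg[of 0] by (intro frac_le) auto
    then show "exp (2 * integral {0..x} (\<lambda>t. \<bar>q t\<bar>) / norm k) \<le> exp (2 * tail 0 / r)" by simp
  qed (use r in auto)
  finally show ?thesis .
qed

text \<open>\<open>Llim \<alpha> \<beta> k\<close> is the limit at infinity of \<open>exp (- k x) (y' + k y)\<close>, up to the factor \<open>2 k\<close> the coefficient of
  the growing exponential in the solution \<open>y\<close> with data \<open>\<alpha>, \<beta>\<close> at 0. Its values \<open>J\<close>, \<open>J1\<close> at the fundamental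
  solutions are the Cauchy data \<open>e(0, k)\<close>, \<open>e'(0, k)\<close> of the Jost solution.\<close>

definition Bpart :: "complex \<Rightarrow> complex \<Rightarrow> real \<Rightarrow> complex \<Rightarrow> complex" where
  "Bpart \<alpha> \<beta> b k = exp (- k * complex_of_real b) * (ivp' q \<alpha> \<beta> (k\<^sup>2) b + k * ivp q \<alpha> \<beta> (k\<^sup>2) b)"

definition Llim :: "complex \<Rightarrow> complex \<Rightarrow> complex \<Rightarrow> complex" where
  "Llim \<alpha> \<beta> k = (\<beta> + k * \<alpha>) + integral {0..} (\<lambda>t. (exp (- k * t) * ivp q \<alpha> \<beta> (k\<^sup>2) t) * complex_of_real (q t))"

lemma ivp_growth:
  assumes "0 \<le> x" "Re k \<ge> 0" "0 < r" "r \<le> norm k"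
  shows "norm (exp (- k * x) * ivp q \<alpha> \<beta> (k\<^sup>2) x) \<le> growth r \<alpha> \<beta>"
  using sol_growth[OF sol_ivp[of "k\<^sup>2" \<alpha> \<beta>] assms] by (simp add: ivp_0)

lemma Bpart_limit:
  assumes k: "Re k \<ge> 0" and r: "0 < r" "r \<le> norm k" and b: "0 \<le> b"
  shows "norm (Bpart \<alpha> \<beta> b k - Llim \<alpha> \<beta> k) \<le> growth r \<alpha> \<beta> * tail b"
proof -
  let ?f = "\<lambda>t. exp (- k * complex_of_real t) * ivp q \<alpha> \<beta> (k\<^sup>2) t"
  let ?g = "\<lambda>t. ?f t * complex_of_real (q t)"
  have c: "continuous_on {0..} ?f"
    by (intro continuous_on_atLeastI sol_exp_continuous[OF sol_ivp]) auto
  have bd: "norm (?f t) \<le> growth r \<alpha> \<beta>" if "t \<ge> 0" for t using ivp_growth[OF that k r] .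
  have i: "?g integrable_on {0..}" "?g integrable_on {b..}"
    using q_mult_atLeast(1)[OF c bd] b set_lebesgue_integral_eq_integral(1) by auto
  have ib: "?g integrable_on {0..b}" by (rule integrable_on_subinterval[OF i(1)]) auto
  have "{0..b} \<union> {b..} = {0..}" using b by auto
  then have "integral {0..} ?g = integral {0..b} ?g + integral {b..} ?g"
    using Henstock_Kurzweil_Integration.integral_Un[OF ib i(2)] b by (simp add: ivl_disj_int_two)
  moreover have "Bpart \<alpha> \<beta> b k = (\<beta> + k * \<alpha>) + integral {0..b} ?g"
    using exp_factors(2)[OF sol_ivp[of "k\<^sup>2" \<alpha> \<beta>] order_refl b] by (simp add: Bpart_def ivp_0 algebra_simps)
  ultimately have "Bpart \<alpha> \<beta> b k - Llim \<alpha> \<beta> k = - integral {b..} ?g" by (simp add: Llim_def)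
  then show ?thesis using q_mult_atLeast(2)[OF c bd b] by simp
qed

lemma Bpart_tendsto:
  assumes "Re k \<ge> 0" "k \<noteq> 0"
  shows "((\<lambda>b. Bpart \<alpha> \<beta> b k) \<longlongrightarrow> Llim \<alpha> \<beta> k) at_top"
proof (rule Lim_transform_bound[where g = "\<lambda>b. growth (norm k) \<alpha> \<beta> * tail b", THEN LIM_zero_cancel])
  show "\<forall>\<^sub>F b in at_top. norm (Bpart \<alpha> \<beta> b k - Llim \<alpha> \<beta> k) \<le> norm (growth (norm k) \<alpha> \<beta> * tail b)"
    using eventually_ge_at_top[of 0]
  proof eventually_elim
    case (elim b)
    then show ?case using Bpart_limit[OF assms(1), of "norm k" b \<alpha> \<beta>] assms(2) by (auto intro: order_trans abs_ge_self)
  qed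
  show "((\<lambda>b. growth (norm k) \<alpha> \<beta> * tail b) \<longlongrightarrow> 0) at_top"
    using tendsto_mult[OF tendsto_const tail_tendsto] by force
qed

text \<open>The finite stages \<open>Bpart\<close> are entire in \<open>k\<close>, so this
  convergence makes the limit holomorphic for \<open>Re k > 0\<close> and continuous up to the
  imaginary axis without 0.\<close>

lemma Bpart_uniform:
  assumes r: "0 < r" and K: "\<And>k. k \<in> K \<Longrightarrow> Re k \<ge> 0 \<and> r \<le> norm k"
  shows "uniform_limit K (\<lambda>n. Bpart \<alpha> \<beta> (real n)) (Llim \<alpha> \<beta>) sequentially"
proof (rule uniform_limitI)
  fix e :: real assume "e > 0"
  have "((\<lambda>n. growth r \<alpha> \<beta> * tail (real n)) \<longlongrightarrow> growth r \<alpha> \<beta> * 0) sequentially"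
    by (intro tendsto_intros filterlim_compose[OF tail_tendsto] filterlim_real_sequentially)
  then have "\<forall>\<^sub>F n in sequentially. growth r \<alpha> \<beta> * tail (real n) < e"
    using \<open>e > 0\<close> by (auto dest: order_tendstoD)
  then show "\<forall>\<^sub>F n in sequentially. \<forall>k\<in>K. dist (Bpart \<alpha> \<beta> (real n) k) (Llim \<alpha> \<beta> k) < e"
  proof eventually_elim
    case (elim n)
    show ?case
    proof
      fix k assume "k \<in> K"
      then have "norm (Bpart \<alpha> \<beta> (real n) k - Llim \<alpha> \<beta> k) \<le> growth r \<alpha> \<beta> * tail (real n)"
        using K by (intro Bpart_limit r) auto
      then show "dist (Bpart \<alpha> \<beta> (real n) k) (Llim \<alpha> \<beta> k) < e" using elim by (simp add: dist_norm)
    qed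
  qed
qed

lemma Bpart_holomorphic: "0 \<le> b \<Longrightarrow> Bpart \<alpha> \<beta> b holomorphic_on A"
proof -
  assume b: "0 \<le> b"
  have "(\<lambda>k::complex. k\<^sup>2) holomorphic_on A" by (intro holomorphic_intros)
  then have "(\<lambda>k. ivp q \<alpha> \<beta> (k\<^sup>2) b) holomorphic_on A" "(\<lambda>k. ivp' q \<alpha> \<beta> (k\<^sup>2) b) holomorphic_on A"
    using holomorphic_on_compose[of "\<lambda>k. k\<^sup>2" A, OF _ holomorphic_on_subset[OF ivp_holomorphic(1)[OF b]]]
      holomorphic_on_compose[of "\<lambda>k. k\<^sup>2" A, OF _ holomorphic_on_subset[OF ivp_holomorphic(2)[OF b]]]
    by (auto simp: o_def)
  then show ?thesis unfolding Bpart_def by (intro holomorphic_intros)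
qed

lemma Llim_holomorphic: "Llim \<alpha> \<beta> holomorphic_on {k. Re k > 0}"
proof (rule holomorphic_uniform_sequence[OF open_halfspace_Re_gt, where f = "\<lambda>n. Bpart \<alpha> \<beta> (real n)"])
  fix k assume "k \<in> {k. 0 < Re k}"
  then have k: "Re k > 0" by simp
  let ?d = "Re k / 2"
  have "Re z \<ge> ?d" if "z \<in> cball k ?d" for z
    using that abs_Re_le_cmod[of "k - z"] by (auto simp: dist_norm)
  moreover have "Re z \<le> norm z" for z using abs_Re_le_cmod[of z] by linarith
  ultimately have *: "Re z \<ge> ?d \<and> ?d \<le> norm z" if "z \<in> cball k ?d" for z using that order_trans by blast
  show "\<exists>d>0. cball k d \<subseteq> {k. 0 < Re k} \<and> uniform_limit (cball k d) (\<lambda>n. Bpart \<alpha> \<beta> (real n)) (Llim \<alpha> \<beta>) sequentially"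
    using k * by (intro exI[of _ ?d] conjI Bpart_uniform[of ?d]) force+
qed (auto intro: Bpart_holomorphic)

lemma Llim_continuous: "continuous_on {k. Re k \<ge> 0 \<and> k \<noteq> 0} (Llim \<alpha> \<beta>)"
  unfolding continuous_on_eq_continuous_within
proof
  let ?S = "{k. Re k \<ge> 0 \<and> k \<noteq> 0}"
  fix k assume k: "k \<in> ?S"
  let ?r = "norm k / 2"
  let ?U = "{k. ?r < norm k}"
  have op: "open ?U" by (intro open_Collect_less continuous_intros)
  have "continuous_on (?S \<inter> ?U) (Llim \<alpha> \<beta>)"
  proof (rule uniform_limit_theorem[OF _ Bpart_uniform])
    show "\<forall>\<^sub>F n in sequentially. continuous_on (?S \<inter> ?U) (Bpart \<alpha> \<beta> (real n))"
      by (intro always_eventually allI holomorphic_on_imp_continuous_on Bpart_holomorphic) auto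
    show "0 < ?r" using k by auto
  qed auto
  then have "continuous (at k within ?S \<inter> ?U) (Llim \<alpha> \<beta>)"
    unfolding continuous_on_eq_continuous_within using k by auto
  moreover have "at k within ?S = at k within (?S \<inter> ?U)"
    by (rule at_within_nhd[OF _ op]) (use k in auto)
  ultimately show "continuous (at k within ?S) (Llim \<alpha> \<beta>)" by simp
qed

section \<open>Jost functions and Jost solutions\<close>

definition J where "J k = Llim 0 1 k"
definition J1 where "J1 k = - Llim 1 0 k"

lemma J_holomorphic: "J holomorphic_on {k. Re k > 0}" "J1 holomorphic_on {k. Re k > 0}"
  unfolding J_def[abs_def] J1_def[abs_def] by (intro holomorphic_intros Llim_holomorphic)+

lemma J_continuous: "continuous_on {k. Re k \<ge> 0 \<and> k \<noteq> 0} J" "continuous_on {k. Re k \<ge> 0 \<and> k \<noteq> 0} J1"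
  unfolding J_def[abs_def] J1_def[abs_def] by (intro continuous_intros Llim_continuous)+

lemma Bpart_lincomb: "0 \<le> b \<Longrightarrow> Bpart \<alpha> \<beta> b k = \<alpha> * Bpart 1 0 b k + \<beta> * Bpart 0 1 b k"
  using ivp_lincomb[of b \<alpha> \<beta> "k\<^sup>2"] by (simp add: Bpart_def algebra_simps)

text \<open>By linearity in the data. The right-hand side is the Wronskian at 0 of the Jost solution
  and the solution with data \<open>\<alpha>, \<beta>\<close>; it vanishes exactly when the two are
  proportional.\<close>

lemma Llim_eq:
  assumes "Re k \<ge> 0" "k \<noteq> 0" shows "Llim \<alpha> \<beta> k = \<beta> * J k - \<alpha> * J1 k"
proof -
  have "((\<lambda>b. \<alpha> * Bpart 1 0 b k + \<beta> * Bpart 0 1 b k) \<longlongrightarrow> \<alpha> * Llim 1 0 k + \<beta> * Llim 0 1 k) at_top"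
    by (intro tendsto_intros Bpart_tendsto assms)
  moreover have "((\<lambda>b. \<alpha> * Bpart 1 0 b k + \<beta> * Bpart 0 1 b k) \<longlongrightarrow> Llim \<alpha> \<beta> k) at_top"
  proof (rule Lim_transform_eventually[OF Bpart_tendsto[OF assms]])
    show "\<forall>\<^sub>F b in at_top. Bpart \<alpha> \<beta> b k = \<alpha> * Bpart 1 0 b k + \<beta> * Bpart 0 1 b k"
      using eventually_ge_at_top[of 0] by eventually_elim (rule Bpart_lincomb)
  qed
  ultimately have "\<alpha> * Llim 1 0 k + \<beta> * Llim 0 1 k = Llim \<alpha> \<beta> k"
    by (rule tendsto_unique[rotated]) auto
  then show ?thesis by (simp add: J_def J1_def add.commute)
qed

lemma J_cnj:
  assumes "Re k \<ge> 0" "k \<noteq> 0"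
  shows "cnj (J k) = J (cnj k)" "cnj (J1 k) = J1 (cnj k)"
proof -
  have "cnj (Llim \<alpha> \<beta> k) = Llim (cnj \<alpha>) (cnj \<beta>) (cnj k)" for \<alpha> \<beta>
  proof (rule tendsto_unique[OF trivial_limit_at_top_linorder])
    show "((\<lambda>b. cnj (Bpart \<alpha> \<beta> b k)) \<longlongrightarrow> cnj (Llim \<alpha> \<beta> k)) at_top"
      by (intro tendsto_intros Bpart_tendsto assms)
    have "cnj (Bpart \<alpha> \<beta> b k) = Bpart (cnj \<alpha>) (cnj \<beta>) b (cnj k)" if "b \<ge> 0" for b
      using that by (simp add: Bpart_def ivp_cnj exp_cnj)
    then have "\<forall>\<^sub>F b in at_top. Bpart (cnj \<alpha>) (cnj \<beta>) b (cnj k) = cnj (Bpart \<alpha> \<beta> b k)"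
      by (intro eventually_mono[OF eventually_ge_at_top[of "0::real"]]) simp
    then show "((\<lambda>b. cnj (Bpart \<alpha> \<beta> b k)) \<longlongrightarrow> Llim (cnj \<alpha>) (cnj \<beta>) (cnj k)) at_top"
      by (rule Lim_transform_eventually[OF Bpart_tendsto, rotated 2]) (use assms in auto)
  qed
  then show "cnj (J k) = J (cnj k)" "cnj (J1 k) = J1 (cnj k)" by (simp_all add: J_def J1_def)
qed

definition jost where "jost k = ivp q (J k) (J1 k) (k\<^sup>2)"
definition jost' where "jost' k = ivp' q (J k) (J1 k) (k\<^sup>2)"

lemma sol_jost: "sol q (k\<^sup>2) (jost k) (jost' k)" unfolding jost_def jost'_def by (rule sol_ivp)

lemma jost_0: "jost k 0 = J k" "jost' k 0 = J1 k" by (simp_all add: jost_def jost'_def ivp_0)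

text \<open>The Jost solution is the limit, as \<open>b\<close> tends to infinity, of the solutions that agree with
  \<open>exp (- k x)\<close> to first order at \<open>b\<close>.\<close>

lemma truncated_jost_bounds:
  assumes s: "sol q (k\<^sup>2) y v" and yb: "y b = exp (- k * b)" and vb: "v b = - k * exp (- k * b)"
    and x: "0 \<le> x" "x \<le> b" and k: "Re k \<ge> 0" "k \<noteq> 0"
  shows "norm (exp (k * x) * y x - 1) \<le> tail x / norm k * exp (2 * tail x / norm k)"
    and "norm (exp (k * x) * v x + k) \<le> tail x * exp (2 * tail x / norm k)"
proof -
  have nk: "norm k > 0" using k by simp
  let ?u = "\<lambda>t. norm (exp (k * complex_of_real t) * y t)"
  let ?A = "\<lambda>z. exp (k * complex_of_real z) * (v z - k * y z)" and ?B = "\<lambda>z. exp (k * complex_of_real z) * (v z + k * y z)"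
  have c: "continuous_on {z..b} ?u" if "z \<ge> 0" for z
    by (intro continuous_intros sol_continuous(1)[OF s]) (use that in auto)
  \<comment> \<open>Matching at \<open>b\<close> gives \<open>?A b = - 2 * k\<close> and
    \<open>?B b = 0\<close>, so integration back from \<open>b\<close> leaves only integrals against
    \<open>q\<close>. For \<open>?B\<close> the kernel is \<open>exp (2 k (z - t))\<close>, bounded
    because \<open>t \<ge> z\<close>.\<close>
  have AB: "norm (?A z + 2 * k) \<le> integral {z..b} (\<lambda>t. \<bar>q t\<bar> * ?u t)" "norm (?B z) \<le> integral {z..b} (\<lambda>t. \<bar>q t\<bar> * ?u t)"
    if z: "0 \<le> z" "z \<le> b" for z
  proof -
    have gen: "c + 2 * k = - i" if "d = - 2 * k" "d - c = i" for c d i :: complex using that by algebra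
    have "?A b = - 2 * k" by (simp add: yb vb algebra_simps flip: exp_add)
    from gen[OF this exp_factors(1)[OF s z]]
    have "?A z + 2 * k = - integral {z..b} (\<lambda>t. (exp (k * t) * y t) * complex_of_real (q t))" .
    then show "norm (?A z + 2 * k) \<le> integral {z..b} (\<lambda>t. \<bar>q t\<bar> * ?u t)"
      using q_mult_bound_Icc[OF z sol_exp_continuous[OF s z(1), of b k] c[OF z(1)]] by simp
    have "exp (- k * b) * (v b + k * y b) = 0" by (simp add: yb vb)
    then have "exp (- k * z) * (v z + k * y z) = - integral {z..b} (\<lambda>t. (exp (- k * t) * y t) * complex_of_real (q t))"
      using exp_factors(2)[OF s z] by (metis add.inverse_inverse diff_0)
    moreover have "?B z = exp (2 * k * z) * (exp (- k * z) * (v z + k * y z))"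
      by (simp flip: mult.assoc exp_add)
    ultimately have "?B z = - integral {z..b} (\<lambda>t. exp (2 * k * z) * ((exp (- k * t) * y t) * complex_of_real (q t)))" by simp
    also have "norm \<dots> = norm (integral {z..b} (\<lambda>t. (exp (2 * k * z) * (exp (- k * t) * y t)) * complex_of_real (q t)))"
      by (simp only: mult.assoc norm_minus_cancel)
    also have "\<dots> \<le> integral {z..b} (\<lambda>t. \<bar>q t\<bar> * ?u t)"
    proof (rule q_mult_bound_Icc[OF z _ c[OF z(1)]])
      show "continuous_on {z..b} (\<lambda>t. exp (2 * k * complex_of_real z) * (exp (- k * complex_of_real t) * y t))"
        by (intro continuous_intros sol_continuous(1)[OF s] z)
      fix t assume t: "t \<in> {z..b}"
      have "exp (2 * k * z) * (exp (- k * t) * y t) = exp (2 * k * complex_of_real (z - t)) * (exp (k * t) * y t)"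
        unfolding mult.assoc[symmetric] exp_add[symmetric] by (simp add: algebra_simps)
      then show "norm (exp (2 * k * z) * (exp (- k * t) * y t)) \<le> ?u t"
        using norm_exp_mult_le[of "2 * k" "z - t"] k t
        by (simp only: norm_mult[of "exp (2 * k * complex_of_real (z - t))"]) (intro mult_left_le_one_le, auto)
    qed
    finally show "norm (?B z) \<le> integral {z..b} (\<lambda>t. \<bar>q t\<bar> * ?u t)" .
  qed
  have dif: "exp (k * complex_of_real z) * y z - 1 = (?B z - (?A z + 2 * k)) / (2 * k)" for z
    using k by (simp add: field_simps)
  have dle: "norm (exp (k * complex_of_real z) * y z - 1) \<le> integral {z..b} (\<lambda>t. \<bar>q t\<bar> * ?u t) / norm k"
    if z: "0 \<le> z" "z \<le> b" for z
  proof -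
    have "norm (?B z - (?A z + 2 * k)) \<le> 2 * integral {z..b} (\<lambda>t. \<bar>q t\<bar> * ?u t)"
      using norm_triangle_ineq4[of "?B z" "?A z + 2 * k"] AB[OF z] by linarith
    then show ?thesis unfolding dif norm_divide using nk by (simp add: norm_mult field_simps)
  qed
  have ub: "?u z \<le> exp (2 * tail x / norm k)" if z: "x \<le> z" "z \<le> b" for z
  proof -
    have z0: "0 \<le> z" using x z by simp
    have "?u z \<le> 1 * exp (2 * integral {z..b} (\<lambda>t. \<bar>q t\<bar> / norm k))"
    proof (rule gronwall_backward[OF z(2) c[OF z0]])
      show "(\<lambda>t. \<bar>q t\<bar> / norm k) absolutely_integrable_on {z..b}" by (intro set_integrable_divide abs_q_Icc z0)
      fix t assume t: "t \<in> {z..b}"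
      have "?u t \<le> 1 + norm (exp (k * complex_of_real t) * y t - 1)"
        using norm_triangle_sub[of "exp (k * complex_of_real t) * y t" 1] by simp
      also have "\<dots> \<le> 1 + integral {t..b} (\<lambda>r. \<bar>q r\<bar> * ?u r) / norm k" using dle[of t] t z0 by simp
      also have "integral {t..b} (\<lambda>r. \<bar>q r\<bar> * ?u r) / norm k = integral {t..b} (\<lambda>r. \<bar>q r\<bar> / norm k * ?u r)" by simp
      finally show "?u t \<le> 1 + integral {t..b} (\<lambda>r. \<bar>q r\<bar> / norm k * ?u r)" .
    qed auto
    also have "\<dots> = exp (2 * integral {z..b} (\<lambda>t. \<bar>q t\<bar>) / norm k)" by simp
    also have "\<dots> \<le> exp (2 * tail x / norm k)"
      using integral_abs_q_le[OF z0 z(2)] tail_antimono[OF x(1) z(1)] nk by (simp add: divide_right_mono)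
    finally show ?thesis .
  qed
  have I: "integral {x..b} (\<lambda>t. \<bar>q t\<bar> * ?u t) \<le> exp (2 * tail x / norm k) * tail x"
    by (rule integral_q_u_le[OF x c[OF x(1)]]) (use ub in auto)
  then show "norm (exp (k * x) * y x - 1) \<le> tail x / norm k * exp (2 * tail x / norm k)"
    using dle[OF x] divide_right_mono[OF I, of "norm k"] by (simp add: mult.commute)
  have "exp (k * x) * v x + k = (?B x + (?A x + 2 * k)) / 2" by (simp add: algebra_simps)
  also have "norm \<dots> \<le> integral {x..b} (\<lambda>t. \<bar>q t\<bar> * ?u t)"
    using norm_triangle_ineq[of "?B x" "?A x + 2 * k"] AB[OF x] by (simp add: norm_divide)
  finally show "norm (exp (k * x) * v x + k) \<le> tail x * exp (2 * tail x / norm k)" using I by (simp add: mult.commute)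
qed

lemma jost_bounds:
  assumes x: "0 \<le> x" and k: "Re k \<ge> 0" "k \<noteq> 0"
  shows "norm (exp (k * x) * jost k x - 1) \<le> tail x / norm k * exp (2 * tail x / norm k)"
    and "norm (exp (k * x) * jost' k x + k) \<le> tail x * exp (2 * tail x / norm k)"
proof -
  \<comment> \<open>These are the Cauchy data at 0 of the solution matched to
    \<open>exp (- k x)\<close> at \<open>b\<close>: its Wronskians with the two fundamental
    solutions are constant, and computed at \<open>b\<close> they are the values of
    \<open>Bpart\<close>.\<close>
  let ?y = "\<lambda>b. ivp q (Bpart 0 1 b k) (- Bpart 1 0 b k) (k\<^sup>2)" and ?v = "\<lambda>b. ivp' q (Bpart 0 1 b k) (- Bpart 1 0 b k) (k\<^sup>2)"
  have lim: "((\<lambda>b. ?y b x) \<longlongrightarrow> jost k x) at_top" "((\<lambda>b. ?v b x) \<longlongrightarrow> jost' k x) at_top"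
    unfolding jost_def jost'_def ivp_lincomb[OF x, of "Bpart 0 1 _ k"] ivp_lincomb[OF x, of "J k"] 
    unfolding J_def J1_def by (intro tendsto_intros Bpart_tendsto k)+
  have ends: "?y b b = exp (- k * b)" "?v b b = - k * exp (- k * b)" if b: "b \<ge> 0" for b
  proof -
    have w: "ivp q 1 0 (k\<^sup>2) b * ivp' q 0 1 (k\<^sup>2) b - ivp' q 1 0 (k\<^sup>2) b * ivp q 0 1 (k\<^sup>2) b = 1"
      using sol_wronskian[OF sol_ivp[of "k\<^sup>2" 1 0] sol_ivp[of "k\<^sup>2" 0 1] b] by (simp add: ivp_0)
    have "?y b b = exp (- k * b) * (ivp q 1 0 (k\<^sup>2) b * ivp' q 0 1 (k\<^sup>2) b - ivp' q 1 0 (k\<^sup>2) b * ivp q 0 1 (k\<^sup>2) b)"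
      unfolding ivp_lincomb[OF b, of "Bpart 0 1 b k" "- Bpart 1 0 b k"] unfolding Bpart_def by (simp add: algebra_simps)
    then show "?y b b = exp (- k * b)" unfolding w by simp
    have "?v b b = - k * exp (- k * b) * (ivp q 1 0 (k\<^sup>2) b * ivp' q 0 1 (k\<^sup>2) b - ivp' q 1 0 (k\<^sup>2) b * ivp q 0 1 (k\<^sup>2) b)"
      unfolding ivp_lincomb[OF b, of "Bpart 0 1 b k" "- Bpart 1 0 b k"] unfolding Bpart_def by (simp add: algebra_simps)
    then show "?v b b = - k * exp (- k * b)" unfolding w by simp
  qed
  have ev: "\<forall>\<^sub>F b in at_top. norm (exp (k * x) * ?y b x - 1) \<le> tail x / norm k * exp (2 * tail x / norm k)"
      "\<forall>\<^sub>F b in at_top. norm (exp (k * x) * ?v b x + k) \<le> tail x * exp (2 * tail x / norm k)"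
    using eventually_ge_at_top[of x]
    by (eventually_elim; use truncated_jost_bounds[OF sol_ivp ends x _ k] x in auto)+
  have "((\<lambda>b. norm (exp (k * x) * ?y b x - 1)) \<longlongrightarrow> norm (exp (k * x) * jost k x - 1)) at_top"
    by (intro tendsto_intros lim)
  from tendsto_upperbound[OF this ev(1)]
  show "norm (exp (k * x) * jost k x - 1) \<le> tail x / norm k * exp (2 * tail x / norm k)" by simp
  have "((\<lambda>b. norm (exp (k * x) * ?v b x + k)) \<longlongrightarrow> norm (exp (k * x) * jost' k x + k)) at_top"
    by (intro tendsto_intros lim)
  from tendsto_upperbound[OF this ev(2)]
  show "norm (exp (k * x) * jost' k x + k) \<le> tail x * exp (2 * tail x / norm k)" by simp
qed

lemma jost_tendsto:
  assumes k: "Re k \<ge> 0" "k \<noteq> 0"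
  shows "((\<lambda>x. exp (k * complex_of_real x) * jost k x) \<longlongrightarrow> 1) at_top"
    and "((\<lambda>x. exp (k * complex_of_real x) * jost' k x) \<longlongrightarrow> - k) at_top"
proof -
  have "((\<lambda>x. exp (k * complex_of_real x) * jost k x - 1) \<longlongrightarrow> 0) at_top"
  proof (rule Lim_null_comparison)
    show "\<forall>\<^sub>F x in at_top. norm (exp (k * complex_of_real x) * jost k x - 1) \<le> tail x / norm k * exp (2 * tail x / norm k)"
      using eventually_ge_at_top[of 0] by eventually_elim (rule jost_bounds[OF _ k])
    have "((\<lambda>x. tail x / norm k * exp (2 * tail x / norm k)) \<longlongrightarrow> 0 / norm k * exp (2 * 0 / norm k)) at_top"
      by (intro tendsto_intros tail_tendsto) (use k in auto)
    then show "((\<lambda>x. tail x / norm k * exp (2 * tail x / norm k)) \<longlongrightarrow> 0) at_top" by simp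
  qed
  then show "((\<lambda>x. exp (k * complex_of_real x) * jost k x) \<longlongrightarrow> 1) at_top" by (rule LIM_zero_cancel)
  have "((\<lambda>x. exp (k * complex_of_real x) * jost' k x - (- k)) \<longlongrightarrow> 0) at_top"
  proof (rule Lim_null_comparison)
    show "\<forall>\<^sub>F x in at_top. norm (exp (k * complex_of_real x) * jost' k x - (- k)) \<le> tail x * exp (2 * tail x / norm k)"
      using eventually_ge_at_top[of 0] by eventually_elim (use jost_bounds[OF _ k] in auto)
    have "((\<lambda>x. tail x * exp (2 * tail x / norm k)) \<longlongrightarrow> 0 * exp (2 * 0 / norm k)) at_top"
      by (intro tendsto_intros tail_tendsto) (use k in auto)
    then show "((\<lambda>x. tail x * exp (2 * tail x / norm k)) \<longlongrightarrow> 0) at_top" by simp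
  qed
  then show "((\<lambda>x. exp (k * complex_of_real x) * jost' k x) \<longlongrightarrow> - k) at_top" by (rule LIM_zero_cancel)
qed

section \<open>Nonvanishing, sign and asymptotics of the Jost data\<close>

lemma J_nontrivial:
  assumes k: "Re k \<ge> 0" "k \<noteq> 0" shows "J k \<noteq> 0 \<or> J1 k \<noteq> 0"
proof (rule ccontr)
  assume "\<not> ?thesis"
  then have "jost k x = 0" if "x \<ge> 0" for x using sol_unique_0[OF sol_jost _ _ that, of k] by (auto simp: jost_0)
  then have lim0: "((\<lambda>x. exp (k * complex_of_real x) * jost k x) \<longlongrightarrow> 0) at_top"
    by (intro tendsto_eventually eventually_mono[OF eventually_ge_at_top[of 0]]) auto
  show False using tendsto_unique[OF _ lim0 jost_tendsto(1)[OF k]] by auto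
qed

lemma J_bounds:
  assumes k: "Re k \<ge> 0" "k \<noteq> 0"
  shows "norm (J k - 1) \<le> tail 0 / norm k * exp (2 * tail 0 / norm k)"
    "norm (J1 k + k) \<le> tail 0 * exp (2 * tail 0 / norm k)"
  using jost_bounds[OF order_refl k] by (simp_all add: jost_0)

text \<open>Along the half-line, \<open>Im (- e' * cnj e)\<close> has derivative
  \<open>- 2 Re k Im k (norm e)\<^sup>2\<close>, hence does not increase. Far out it is positive,
  since \<open>e\<close> behaves like \<open>exp (- k x)\<close>; so it is positive at 0. For
  \<open>Re k = 0\<close> it is constant, and the argument still covers the imaginary axis.\<close>

lemma J_herglotz:
  assumes k: "Re k \<ge> 0" "Im k > 0"
  shows "Im (- J1 k * cnj (J k)) > 0"
proof -
  let ?F = "\<lambda>x. - jost' k x * cnj (jost k x)"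
  have k0: "k \<noteq> 0" using k by auto
  have s: "loc_AC {0..} (jost k) (jost' k)" "loc_AC {0..} (jost' k) (\<lambda>x. (complex_of_real (q x) + k\<^sup>2) * jost k x)"
    using sol_jost[of k] by (auto simp: sol_def)
  let ?d = "\<lambda>x. (complex_of_real (q x) + k\<^sup>2) * jost k x * cnj (jost k x) + jost' k x * cnj (jost' k x)"
  have ac: "loc_AC {0..} (\<lambda>x. jost' k x * cnj (jost k x)) ?d"
    by (intro loc_AC_mult loc_AC_cnj is_interval_ci s)
  have dec: "Im (?F b) \<le> Im (?F 0)" if b: "b \<ge> 0" for b
  proof -
    have i: "?d integrable_on {0..b}" using loc_AC_integrable(2)[OF ac] b by auto
    have "Im (integral {0..b} ?d) = integral {0..b} (\<lambda>x. Im (?d x))"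
      using integral_linear[OF i bounded_linear_Im] by (simp add: o_def)
    moreover have "0 \<le> integral {0..b} (\<lambda>x. Im (?d x))"
    proof (rule integral_nonneg)
      show "(\<lambda>x. Im (?d x)) integrable_on {0..b}"
        using integrable_linear[OF i bounded_linear_Im] by (simp add: o_def)
      fix x
      have "?d x = complex_of_real (q x * (norm (jost k x))\<^sup>2 + (norm (jost' k x))\<^sup>2) + k\<^sup>2 * complex_of_real ((norm (jost k x))\<^sup>2)"
        unfolding of_real_add of_real_mult complex_norm_square by (simp add: algebra_simps)
      then have "Im (?d x) = 2 * Re k * Im k * (norm (jost k x))\<^sup>2" by (simp add: power2_eq_square)
      then show "0 \<le> Im (?d x)" using k by simp
    qed
    ultimately have "0 \<le> Im (integral {0..b} ?d)" by simp
    moreover have "?F b = ?F 0 - integral {0..b} ?d" using loc_AC_diff_eq[OF ac, of 0 b] b by (simp add: algebra_simps)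
    ultimately show ?thesis by simp
  qed
  have "((\<lambda>x. - (exp (k * complex_of_real x) * jost' k x) * cnj (exp (k * complex_of_real x) * jost k x)) \<longlongrightarrow> - (- k) * cnj 1) at_top"
    by (intro tendsto_intros jost_tendsto k k0)
  then have "((\<lambda>x. Im (- (exp (k * complex_of_real x) * jost' k x) * cnj (exp (k * complex_of_real x) * jost k x))) \<longlongrightarrow> Im k) at_top"
    using tendsto_Im by fastforce
  then have "\<forall>\<^sub>F x in at_top. 0 < Im (- (exp (k * complex_of_real x) * jost' k x) * cnj (exp (k * complex_of_real x) * jost k x))"
    using k by (auto dest: order_tendstoD)
  then obtain b where b: "b \<ge> 0" "0 < Im (- (exp (k * complex_of_real b) * jost' k b) * cnj (exp (k * complex_of_real b) * jost k b))"
    using eventually_happens[OF eventually_conj[OF _ eventually_ge_at_top[of 0]]] by fastforce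
  have "- (exp (k * complex_of_real b) * jost' k b) * cnj (exp (k * complex_of_real b) * jost k b) = complex_of_real ((norm (exp (k * complex_of_real b)))\<^sup>2) * ?F b"
    unfolding complex_norm_square by simp
  then have "0 < (norm (exp (k * complex_of_real b)))\<^sup>2 * Im (?F b)" using b(2) by (metis Im_complex_of_real Re_complex_of_real mult.commute mult_zero_left add_0 times_complex.simps(2) mult_zero_right add.right_neutral)
  then have "0 < Im (?F b)" by (simp add: zero_less_mult_iff)
  then show ?thesis using dec[OF b(1)] by (simp add: jost_0)
qed

text \<open>For \<open>q = 0\<close> the solution is \<open>sinh (k x) / k\<close>, and
  \<open>2 k exp (- k x)\<close> times it is \<open>1 - exp (- 2 k x)\<close>. The error counts the
  same integral twice, once for each first-order factor.\<close>

lemma phi_asymptotics: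
  assumes x: "0 \<le> x" and k: "Re k \<ge> 0" "k \<noteq> 0"
  shows "norm (2 * k * (exp (- k * x) * ivp q 0 1 (k\<^sup>2) x) - (1 - exp (- 2 * k * x))) \<le> 2 * (growth (norm k) 0 1 * tail 0)"
proof -
  let ?y = "ivp q 0 1 (k\<^sup>2)" and ?v = "ivp' q 0 1 (k\<^sup>2)"
  let ?I = "integral {0..x} (\<lambda>t. \<bar>q t\<bar> * norm (exp (- k * t) * ?y t))"
  have b: "norm (exp (- k * x) * (?v x + k * ?y x) - 1) \<le> ?I" "norm (exp (- k * x) * (?v x - k * ?y x) - exp (- 2 * k * x)) \<le> ?I"
    using sol_forward_integral_bounds[OF sol_ivp[of "k\<^sup>2" 0 1] x k(1)] by (simp_all add: ivp_0)
  have "?I \<le> growth (norm k) 0 1 * tail 0"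
  proof (rule integral_q_u_le[OF order_refl x])
    show "continuous_on {0..x} (\<lambda>t. norm (exp (- k * complex_of_real t) * ?y t))"
      by (intro continuous_intros sol_continuous(1)[OF sol_ivp]) auto
    show "norm (exp (- k * complex_of_real t) * ?y t) \<le> growth (norm k) 0 1" if "t \<in> {0..x}" for t
      using that k by (intro ivp_growth) auto
    show "0 \<le> growth (norm k) 0 1" by (simp add: growth_def)
  qed
  moreover have "2 * k * (exp (- k * x) * ?y x) - (1 - exp (- 2 * k * x)) = (exp (- k * x) * (?v x + k * ?y x) - 1) - (exp (- k * x) * (?v x - k * ?y x) - exp (- 2 * k * x))"
    by (simp add: algebra_simps)
  ultimately show ?thesis using norm_triangle_ineq4 b by (smt (verit))
qed

end

section \<open>The Borg--Marchenko theorem\<close>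

text \<open>Lebesgue differentiation: almost every value is a limit of averages over intervals to
  the right, and those averages vanish. The truncation \<open>g\<close> supplies integrability on
  every interval.\<close>

lemma AE_zero_if_integrals_zero:
  fixes f :: "real \<Rightarrow> complex"
  assumes f: "\<And>b. f integrable_on {0..b}" and zero: "\<And>b. 0 \<le> b \<Longrightarrow> integral {0..b} f = 0"
  obtains N where "negligible N" "\<And>x. x > 0 \<Longrightarrow> x \<notin> N \<Longrightarrow> f x = 0"
proof -
  define g where "g x = (if x \<in> {0..} then f x else 0)" for x
  have gi: "g integrable_on {a..b}" for a b
  proof -
    have "f integrable_on {0..} \<inter> {a..b}"
    proof -
      have "{0..} \<inter> {a..b} = {max 0 a..b}" by auto
      then show ?thesis using integrable_on_subinterval[OF f[of b], of "max 0 a" b] by auto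
    qed
    then show ?thesis unfolding g_def by (subst integrable_restrict_Int) (simp add: Int_commute)
  qed
  obtain N where N: "negligible N" and ex: "\<And>x e. x \<notin> N \<Longrightarrow> 0 < e \<Longrightarrow>
      \<exists>d>0. \<forall>h. 0 < h \<and> h < d \<longrightarrow> norm (integral {x..x+h} g /\<^sub>R h - g x) < e"
    using integrable_ccontinuous_explicit[of g] gi by auto
  show thesis
  proof (rule that[OF N])
    fix x :: real assume x: "x > 0" "x \<notin> N"
    have i0: "integral {x..x+h} g = 0" if h: "h > 0" for h
    proof -
      have "integral {x..x+h} g = integral {x..x+h} f"
        by (rule Henstock_Kurzweil_Integration.integral_cong) (use x in \<open>auto simp: g_def\<close>)
      also have "\<dots> = integral {0..x+h} f - integral {0..x} f"
        using Henstock_Kurzweil_Integration.integral_combine[of 0 x "x+h" f] f[of "x+h"] x h by (simp add: algebra_simps)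
      also have "\<dots> = 0" using zero x h by simp
      finally show ?thesis .
    qed
    have "norm (g x) \<le> 0 + e" if "e > 0" for e :: real
    proof -
      obtain d where "d > 0" and d: "\<And>h. 0 < h \<Longrightarrow> h < d \<Longrightarrow> norm (integral {x..x+h} g /\<^sub>R h - g x) < e"
        using ex[OF x(2) \<open>e > 0\<close>] by blast
      from d[of "d/2"] \<open>d > 0\<close> i0[of "d/2"] show ?thesis by simp
    qed
    then have "norm (g x) \<le> 0" by (rule field_le_epsilon)
    then show "f x = 0" using x by (simp add: g_def)
  qed
qed

lemma continuous_zero_if_integrals_zero:
  fixes f :: "real \<Rightarrow> complex"
  assumes f: "\<And>b. continuous_on {0..b} f" and zero: "\<And>b. 0 \<le> b \<Longrightarrow> integral {0..b} f = 0" and x: "0 \<le> x"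
  shows "f x = 0"
proof -
  have "((\<lambda>u. integral {0..u} f) has_vector_derivative f x) (at x within {0..x+1})"
    by (rule integral_has_vector_derivative[OF f]) (use x in auto)
  moreover have "((\<lambda>u. integral {0..u} f) has_vector_derivative 0) (at x within {0..x+1})"
    by (rule has_vector_derivative_transform[where f = "\<lambda>_. 0"]) (use x zero in auto)
  ultimately show ?thesis
    using vector_derivative_unique_within_closed_interval[of 0 "x+1" x] x by auto
qed

section \<open>Square-integrable solutions\<close>

lemma L2_decayI:
  assumes c: "continuous_on {0..} f" and k: "k > 0" and le: "\<And>x. x \<ge> 0 \<Longrightarrow> norm (f x) \<le> C * exp (- k * x)"
  shows "f \<in> L2 {0..}"
proof -
  have m: "f \<in> borel_measurable (lebesgue_on {0..})"
    by (rule continuous_imp_measurable_on_sets_lebesgue[OF c]) auto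
  moreover have "integrable (lebesgue_on {0..}) (\<lambda>x. (norm (f x))\<^sup>2)"
  proof (rule absolutely_integrable_imp_integrable[OF measurable_bounded_by_integrable_imp_absolutely_integrable])
    show "(\<lambda>x. C\<^sup>2 * exp (- (2 * k) * x)) integrable_on {0..}"
      using k by (intro integrable_on_mult_right integrable_on_exp_minus_to_infinity) auto
    show "norm ((norm (f x))\<^sup>2) \<le> C\<^sup>2 * exp (- (2 * k) * x)" if "x \<in> {0..}" for x
    proof -
      have "(norm (f x))\<^sup>2 \<le> (C * exp (- k * x))\<^sup>2" using le that by (intro power_mono) auto
      also have "\<dots> = C\<^sup>2 * exp (- (2 * k) * x)" by (simp add: power_mult_distrib power2_eq_square flip: exp_add)
      finally show ?thesis by simp
    qed
  qed (use m in auto)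
  ultimately show ?thesis by (simp add: L2_def)
qed

lemma not_L2_if_eventually_ge_1:
  assumes ev: "\<forall>\<^sub>F x in at_top. 1 \<le> norm (f x)" shows "f \<notin> L2 {0..}"
proof
  assume "f \<in> L2 {0..}"
  then have i: "(\<lambda>x. (norm (f x))\<^sup>2) integrable_on {0..}"
    unfolding L2_def by (auto intro: integrable_on_lebesgue_on)
  let ?I = "integral {0..} (\<lambda>x. (norm (f x))\<^sup>2)"
  obtain a where a: "a \<ge> 0" "\<And>x. x \<ge> a \<Longrightarrow> 1 \<le> norm (f x)"
    using ev unfolding eventually_at_top_linorder by (metis max.cobounded2 max.boundedE)
  define h where "h = \<bar>?I\<bar> + 1"
  have h: "h > 0" by (simp add: h_def)
  have ii: "(\<lambda>x. (norm (f x))\<^sup>2) integrable_on {a..a+h}" by (rule integrable_on_subinterval[OF i]) (use a in auto)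
  have "h = integral {a..a+h} (\<lambda>x. 1)" using h by simp
  also have "\<dots> \<le> integral {a..a+h} (\<lambda>x. (norm (f x))\<^sup>2)"
    by (rule integral_le[OF _ ii]) (use a in \<open>auto intro!: one_le_power\<close>)
  also have "\<dots> \<le> ?I" by (rule integral_subset_le[OF _ ii i]) (use a in auto)
  finally show False by (simp add: h_def)
qed

context half_line
begin

lemma jost_L2:
  assumes k: "k > 0"
  shows "jost (complex_of_real k) \<in> L2 {0..}"
proof (rule L2_decayI[OF _ k])
  let ?k = "complex_of_real k"
  show "continuous_on {0..} (jost ?k)"
    by (intro continuous_on_atLeastI sol_continuous(1)[OF sol_jost]) auto
  fix x :: real assume x: "x \<ge> 0"
  let ?C = "1 + tail 0 / k * exp (2 * tail 0 / k)"
  have "norm (exp (?k * x) * jost ?k x - 1) \<le> tail x / k * exp (2 * tail x / k)"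
    using jost_bounds(1)[OF x, of ?k] k by simp
  also have "\<dots> \<le> tail 0 / k * exp (2 * tail 0 / k)"
    using tail_antimono[OF order_refl x] tail_nonneg[of x] tail_nonneg[of 0] x k
    by (intro mult_mono divide_right_mono) (auto simp: divide_right_mono)
  finally have "norm (exp (?k * x) * jost ?k x) \<le> ?C"
    using norm_triangle_sub[of "exp (?k * x) * jost ?k x" 1] by simp
  then have "exp (k * x) * norm (jost ?k x) \<le> ?C" by (simp add: norm_mult)
  then show "norm (jost ?k x) \<le> ?C * exp (- k * x)"
    by (simp add: exp_minus field_simps)
qed

text \<open>If the equation fails, the coefficient \<open>L\<close> of the growing exponential is
  nonzero. Then the normalized \<open>exp (k x) y\<close> has derivative
  \<open>exp (2 k x) w\<close> with \<open>w\<close> tending to 1, so it is at least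
  \<open>exp (2 k x) / (4 k)\<close> up to a constant (1/2 being used as a lower bound for
  \<open>Re w\<close>), and \<open>y\<close> grows like \<open>exp (k x)\<close>.\<close>

lemma sol_L2_imp:
  assumes s: "sol q ((complex_of_real k)\<^sup>2) y v" and k: "k > 0" and L2: "y \<in> L2 {0..}"
  shows "v 0 * J (complex_of_real k) = y 0 * J1 (complex_of_real k)"
proof (rule ccontr)
  assume ne: "\<not> ?thesis"
  let ?k = "complex_of_real k"
  define L where "L = Llim (y 0) (v 0) ?k"
  have L: "L \<noteq> 0" using ne k by (simp add: L_def Llim_eq)
  have lim: "((\<lambda>b. Bpart (y 0) (v 0) b ?k) \<longlongrightarrow> L) at_top" unfolding L_def by (rule Bpart_tendsto) (use k in auto)
  define w where "w x = exp (- ?k * complex_of_real x) * (v x + ?k * y x) / L" for x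
  have "((\<lambda>b. Bpart (y 0) (v 0) b ?k / L) \<longlongrightarrow> L / L) at_top" by (intro tendsto_intros lim L)
  then have "((\<lambda>b. Re (Bpart (y 0) (v 0) b ?k / L)) \<longlongrightarrow> 1) at_top" using tendsto_Re L by fastforce
  then have "\<forall>\<^sub>F b in at_top. 1/2 < Re (Bpart (y 0) (v 0) b ?k / L)" by (rule order_tendstoD) simp
  then have "\<forall>\<^sub>F b in at_top. 1/2 < Re (w b)"
    using eventually_ge_at_top[of 0]
  proof eventually_elim
    case (elim b)
    then show ?case unfolding w_def Bpart_def sol_eq_ivp[OF s elim(2)] by simp
  qed
  then obtain a where a: "a \<ge> 0" "\<And>x. x \<ge> a \<Longrightarrow> 1/2 < Re (w x)"
    unfolding eventually_at_top_linorder by (metis max.cobounded2 max.boundedE)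
  define g where "g x = exp (?k * complex_of_real x) * y x / L" for x
  have "loc_AC {0..} (\<lambda>x. (1 / L) * (exp (?k * complex_of_real x) * y x)) (\<lambda>x. (1 / L) * (?k * exp (?k * complex_of_real x) * y x + exp (?k * complex_of_real x) * v x))"
    by (intro loc_AC_cmult loc_AC_mult loc_AC_exp is_interval_ci) (use s in \<open>auto simp: sol_def\<close>)
  then have ac: "loc_AC {0..} g (\<lambda>x. complex_of_real (exp (2 * k * x)) * w x)"
  proof (rule loc_AC_cong_simple[OF _ is_interval_ci])
    fix x
    have "exp (2 * k * x) = exp (k * x) * exp (k * x)" by (simp flip: exp_add)
    moreover have "complex_of_real (exp (k * x)) = exp (?k * x)" using exp_of_real[of "k * x", where 'a = complex] by simp
    ultimately have "complex_of_real (exp (2 * k * x)) = exp (?k * x) * exp (?k * x)" by simp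
    then have "complex_of_real (exp (2 * k * x)) * w x = (exp (?k * x) * exp (- ?k * x)) * (exp (?k * x) * (v x + ?k * y x) / L)"
      by (simp add: w_def)
    then show "(1 / L) * (?k * exp (?k * complex_of_real x) * y x + exp (?k * complex_of_real x) * v x) = complex_of_real (exp (2 * k * x)) * w x"
      by (simp add: algebra_simps add_divide_distrib flip: exp_add)
  qed (auto simp: g_def)
  have lower: "Re (g a) + (exp (2 * k * x) - exp (2 * k * a)) / (4 * k) \<le> norm (g x)" if x: "x \<ge> a" for x
  proof -
    have i: "(\<lambda>x. complex_of_real (exp (2 * k * x)) * w x) integrable_on {a..x}"
      using loc_AC_integrable(2)[OF ac] a x by auto
    have hi: "((\<lambda>t. exp (2 * k * t) / 2) has_integral exp (2 * k * x) / (4 * k) - exp (2 * k * a) / (4 * k)) {a..x}"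
      by (rule fundamental_theorem_of_calculus[OF x])
         (auto intro!: derivative_eq_intros simp flip: has_real_derivative_iff_has_vector_derivative, use k in \<open>auto simp: field_simps\<close>)
    have ie: "(\<lambda>t. exp (2 * k * t) / 2) integrable_on {a..x}" using hi by blast
    have "(exp (2 * k * x) - exp (2 * k * a)) / (4 * k) = integral {a..x} (\<lambda>t. exp (2 * k * t) / 2)"
      using integral_unique[OF hi] by (simp only: diff_divide_distrib)
    also have "integral {a..x} (\<lambda>t. exp (2 * k * t) / 2) \<le> integral {a..x} (\<lambda>t. Re (complex_of_real (exp (2 * k * t)) * w t))"
    proof (rule integral_le[OF ie])
      show "(\<lambda>t. Re (complex_of_real (exp (2 * k * t)) * w t)) integrable_on {a..x}"
        using integrable_linear[OF i bounded_linear_Re] by (simp add: o_def)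
      show "exp (2 * k * t) / 2 \<le> Re (complex_of_real (exp (2 * k * t)) * w t)" if "t \<in> {a..x}" for t
        using mult_left_mono[of "1/2" "Re (w t)" "exp (2 * k * t)"] a(2)[of t] that by (auto simp: Re_complex_of_real)
    qed
    also have "\<dots> = Re (integral {a..x} (\<lambda>t. complex_of_real (exp (2 * k * t)) * w t))"
      using integral_linear[OF i bounded_linear_Re] by (simp add: o_def)
    also have "\<dots> = Re (g x) - Re (g a)" using loc_AC_diff_eq[OF ac, of a x] a x by (metis atLeast_iff minus_complex.simps(1) order_trans)
    finally show ?thesis using complex_Re_le_cmod[of "g x"] by linarith
  qed
  have ny: "norm (y x) = norm L * (exp (- k * x) * norm (g x))" for x
    using L by (simp add: g_def norm_divide norm_mult exp_minus)
  let ?c = "Re (g a) - exp (2 * k * a) / (4 * k)"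
  have "\<forall>\<^sub>F x in at_top. 1 \<le> norm (y x)"
  proof -
    have e1: "filterlim (\<lambda>x. exp (k * x)) at_top at_top"
      by (intro filterlim_compose[OF exp_at_top] filterlim_tendsto_pos_mult_at_top[OF tendsto_const k filterlim_ident])
    then have e2: "((\<lambda>x. exp (- k * x)) \<longlongrightarrow> 0) at_top"
      using tendsto_inverse_0_at_top by (fastforce simp: exp_minus)
    have "((\<lambda>x. exp (- k * x) * ?c) \<longlongrightarrow> 0) at_top" using tendsto_mult_left_zero[OF e2] .
    moreover have "filterlim (\<lambda>x. exp (k * x) * (1 / (4 * k))) at_top at_top"
      by (rule filterlim_at_top_mult_tendsto_pos[OF tendsto_const _ e1]) (use k in auto)
    ultimately have "filterlim (\<lambda>x. exp (- k * x) * ?c + exp (k * x) * (1 / (4 * k))) at_top at_top"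
      by (rule filterlim_tendsto_add_at_top)
    then have "filterlim (\<lambda>x. norm L * (exp (- k * x) * ?c + exp (k * x) * (1 / (4 * k)))) at_top at_top"
      by (intro filterlim_tendsto_pos_mult_at_top[OF tendsto_const]) (use L in auto)
    then have "\<forall>\<^sub>F x in at_top. 1 \<le> norm L * (exp (- k * x) * ?c + exp (k * x) * (1 / (4 * k)))"
      by (simp add: filterlim_at_top)
    then show ?thesis using eventually_ge_at_top[of a]
    proof eventually_elim
      case (elim x)
      have "exp (- k * x) * ?c + exp (k * x) * (1 / (4 * k)) = exp (- k * x) * (Re (g a) + (exp (2 * k * x) - exp (2 * k * a)) / (4 * k))"
        by (simp add: field_simps flip: exp_add) (simp add: diff_divide_distrib)
      also have "\<dots> \<le> exp (- k * x) * norm (g x)" by (intro mult_left_mono lower elim) auto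
      finally have "norm L * (exp (- k * x) * ?c + exp (k * x) * (1 / (4 * k))) \<le> norm (y x)"
        unfolding ny by (intro mult_left_mono) auto
      then show ?case using elim by simp
    qed
  qed
  with not_L2_if_eventually_ge_1 L2 show False by blast
qed

text \<open>By \<open>phi_asymptotics\<close>, \<open>2 k exp (- k x)\<close> times the solution
  tends to 1 as \<open>k\<close> grows along the reals. Positivity later fixes a sign that squaring
  loses, and it gives for each \<open>x > 0\<close> parameters at which the solution does not
  vanish.\<close>

lemma phi_eventually_pos:
  assumes x: "x > 0"
  shows "\<forall>\<^sub>F k in at_top. Re (ivp q 0 1 ((complex_of_real k)\<^sup>2) x) > 0"
proof -
  have "((\<lambda>k. exp (- (2 * x) * k)) \<longlongrightarrow> 0) at_top"
  proof -
    have "filterlim (\<lambda>k. (2 * x) * k) at_top at_top"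
      by (rule filterlim_tendsto_pos_mult_at_top[OF tendsto_const _ filterlim_ident]) (use x in auto)
    from filterlim_compose[OF exp_at_top this] show ?thesis
      using tendsto_inverse_0_at_top by (fastforce simp: exp_minus)
  qed
  moreover have "((\<lambda>k. 2 * (growth k 0 1 * tail 0)) \<longlongrightarrow> 2 * ((0 + 0) * exp 0 * tail 0)) at_top"
    unfolding growth_def norm_one norm_zero
    by (intro tendsto_intros tendsto_divide_0[OF tendsto_const] filterlim_at_top_imp_at_infinity filterlim_ident)
  ultimately have "((\<lambda>k. exp (- (2 * x) * k) + 2 * (growth k 0 1 * tail 0)) \<longlongrightarrow> 0 + 2 * ((0 + 0) * exp 0 * tail 0)) at_top"
    by (intro tendsto_add)
  then have "\<forall>\<^sub>F k in at_top. exp (- (2 * x) * k) + 2 * (growth k 0 1 * tail 0) < 1"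
    by (intro order_tendstoD) auto
  then show ?thesis using eventually_gt_at_top[of 0]
  proof eventually_elim
    case (elim k)
    let ?p = "ivp q 0 1 ((complex_of_real k)\<^sup>2) x"
    have "norm (2 * complex_of_real k * (exp (- complex_of_real k * x) * ?p) - (1 - exp (- 2 * complex_of_real k * x))) \<le> 2 * (growth k 0 1 * tail 0)"
      using phi_asymptotics[of x "complex_of_real k"] x elim by simp
    moreover have "2 * complex_of_real k * (exp (- complex_of_real k * x) * ?p) - (1 - exp (- 2 * complex_of_real k * x))
       = complex_of_real (2 * k * exp (- k * x)) * ?p - complex_of_real (1 - exp (- (2 * x) * k))"
    proof -
      have "exp (- complex_of_real k * x) = complex_of_real (exp (- k * x))" "exp (- 2 * complex_of_real k * x) = complex_of_real (exp (- (2 * x) * k))"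
        using exp_of_real[of "- k * x", where 'a = complex] exp_of_real[of "- (2 * x) * k", where 'a = complex] by (simp_all add: mult_ac)
      then show ?thesis by simp
    qed
    ultimately have "norm (complex_of_real (2 * k * exp (- k * x)) * ?p - complex_of_real (1 - exp (- (2 * x) * k))) \<le> 2 * (growth k 0 1 * tail 0)"
      by metis
    then have "\<bar>Re (complex_of_real (2 * k * exp (- k * x)) * ?p - complex_of_real (1 - exp (- (2 * x) * k)))\<bar> \<le> 2 * (growth k 0 1 * tail 0)"
      using abs_Re_le_cmod order_trans by blast
    then have "\<bar>2 * k * exp (- k * x) * Re ?p - (1 - exp (- (2 * x) * k))\<bar> \<le> 2 * (growth k 0 1 * tail 0)" by simp
    then have "0 < 2 * k * exp (- k * x) * Re ?p" using elim by linarith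
    then show ?case using elim by (simp add: zero_less_mult_iff mult_less_0_iff)
  qed
qed

end

section \<open>Comparison of two potentials on the half-line\<close>

locale two_half_lines = Q: half_line q + P: half_line p for q p
begin

text \<open>The Weyl solution \<open>jost / J\<close> has Cauchy data \<open>1, J1 / J\<close>. If
  \<open>c\<close> is the difference of the two functions \<open>J1 / J\<close>, this is (Weyl
  solution of \<open>q\<close>) times (solution of \<open>p\<close> with data 0, 1) minus the same
  with \<open>q\<close> and \<open>p\<close> exchanged, rewritten so that the quotients disappear.
  In this form it is entire and even in \<open>k\<close>.\<close>

definition weyl_diff :: "complex \<Rightarrow> real \<Rightarrow> complex \<Rightarrow> complex" where
  "weyl_diff c x k = ivp q 1 0 (k\<^sup>2) x * ivp p 0 1 (k\<^sup>2) x - ivp q 0 1 (k\<^sup>2) x * ivp p 1 0 (k\<^sup>2) x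
     + c * (ivp q 0 1 (k\<^sup>2) x * ivp p 0 1 (k\<^sup>2) x)"

lemma weyl_diff_eq:
  assumes "x \<ge> 0" "Q.J k \<noteq> 0" "P.J k \<noteq> 0" "Q.J1 k * P.J k - P.J1 k * Q.J k = c * (Q.J k * P.J k)"
  shows "weyl_diff c x k = Q.jost k x * ivp p 0 1 (k\<^sup>2) x / Q.J k - ivp q 0 1 (k\<^sup>2) x * P.jost k x / P.J k"
proof -
  have 1: "Q.jost k x = Q.J k * ivp q 1 0 (k\<^sup>2) x + Q.J1 k * ivp q 0 1 (k\<^sup>2) x"
     "P.jost k x = P.J k * ivp p 1 0 (k\<^sup>2) x + P.J1 k * ivp p 0 1 (k\<^sup>2) x"
    unfolding Q.jost_def P.jost_def using Q.ivp_lincomb[OF assms(1)] P.ivp_lincomb[OF assms(1)] by blast+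
  have 2: "Q.J1 k / Q.J k - P.J1 k / P.J k = c" using assms by (simp add: field_simps)
  show ?thesis unfolding weyl_diff_def 1 2[symmetric] using assms(2,3)
    by (simp add: divide_simps) (simp add: algebra_simps)
qed

text \<open>In each product a solution of size \<open>exp (- k x)\<close> meets one of size
  \<open>exp (k x) / k\<close>, and \<open>J\<close> stays away from 0; the exponentials cancel and
  \<open>C / norm k\<close> remains.\<close>

lemma weyl_diff_bound:
  assumes x: "x \<ge> 0"
  obtains C r where "r > 0" "\<And>k. Re k \<ge> 0 \<Longrightarrow> norm k \<ge> r \<Longrightarrow> Q.J k \<noteq> 0 \<and> P.J k \<noteq> 0 \<and>
     norm (Q.jost k x * ivp p 0 1 (k\<^sup>2) x / Q.J k - ivp q 0 1 (k\<^sup>2) x * P.jost k x / P.J k) \<le> C / norm k"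
proof -
  have one: "\<exists>r\<ge>1. \<forall>k. Re k \<ge> 0 \<longrightarrow> norm k \<ge> r \<longrightarrow> 1/2 \<le> norm (half_line.J f k) \<and>
      norm (exp (k * x) * half_line.jost f k x) \<le> 1 + half_line.tail f 0 * exp (2 * half_line.tail f 0) \<and>
      norm (exp (- k * x) * ivp f 0 1 (k\<^sup>2) x) \<le> exp (2 * half_line.tail f 0) / norm k" if "half_line f" for f
  proof -
    interpret F: half_line f by fact
    let ?T = "F.tail 0"
    let ?E = "?T * exp (2 * ?T)"
    have T: "0 \<le> ?T" using F.tail_nonneg by simp
    show ?thesis
    \<comment> \<open>For \<open>norm k \<ge> 1 + 2 * ?E\<close> the error in \<open>J\<close> is at
      most \<open>?E / norm k \<le> 1/2\<close>.\<close>
    proof (intro exI[of _ "1 + 2 * ?E"] conjI allI impI)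
      show "1 \<le> 1 + 2 * ?E" using T by simp
      fix k assume k: "Re k \<ge> 0" "norm k \<ge> 1 + 2 * ?E"
      have k1: "norm k \<ge> 1" using k T by (smt (verit) mult_nonneg_nonneg exp_ge_zero)
      have k0: "k \<noteq> 0" using k1 by auto
      have dv: "z / norm k \<le> z" if "z \<ge> 0" for z using that k1 by (simp add: divide_le_eq mult_le_cancel_left1)
      have ex: "exp (2 * ?T / norm k) \<le> exp (2 * ?T)" using dv[of "2 * ?T"] T by simp
      have tx: "F.tail x \<le> ?T" "0 \<le> F.tail x" using F.tail_antimono[OF order_refl x] F.tail_nonneg[OF x] by auto
      have "norm (F.J k - 1) \<le> ?T / norm k * exp (2 * ?T / norm k)" by (rule F.J_bounds[OF k(1) k0])
      also have "\<dots> \<le> ?T / norm k * exp (2 * ?T)" using ex T by (intro mult_left_mono) auto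
      also have "\<dots> = ?E / norm k" by simp
      also have "\<dots> \<le> 1/2" using k(2) k1 by (simp add: divide_le_eq)
      finally show "1/2 \<le> norm (F.J k)" using norm_triangle_ineq2[of 1 "1 - F.J k"] by (simp add: norm_minus_commute)
      have "norm (exp (k * x) * F.jost k x - 1) \<le> F.tail x / norm k * exp (2 * F.tail x / norm k)"
        by (rule F.jost_bounds[OF x k(1) k0])
      also have "\<dots> \<le> ?T * exp (2 * ?T)"
      proof (intro mult_mono)
        show "F.tail x / norm k \<le> ?T" using dv[of "F.tail x"] tx by simp
        have "2 * F.tail x / norm k \<le> 2 * ?T" using dv[of "2 * F.tail x"] tx by simp
        then show "exp (2 * F.tail x / norm k) \<le> exp (2 * ?T)" by simp
      qed (use T in auto)
      finally show "norm (exp (k * x) * F.jost k x) \<le> 1 + ?E"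
        using norm_triangle_sub[of "exp (k * x) * F.jost k x" 1] by simp
      have "norm (exp (- k * x) * ivp f 0 1 (k\<^sup>2) x) \<le> F.growth (norm k) 0 1"
        using k0 by (intro F.ivp_growth x k(1)) auto
      also have "\<dots> \<le> exp (2 * ?T) / norm k" using ex by (simp add: F.growth_def divide_right_mono)
      finally show "norm (exp (- k * x) * ivp f 0 1 (k\<^sup>2) x) \<le> exp (2 * ?T) / norm k" .
    qed
  qed
  let ?A = "1 + Q.tail 0 * exp (2 * Q.tail 0)" and ?B = "1 + P.tail 0 * exp (2 * P.tail 0)"
  let ?a = "exp (2 * Q.tail 0)" and ?b = "exp (2 * P.tail 0)"
  obtain r1 where r1: "r1 \<ge> 1" "\<And>k. Re k \<ge> 0 \<Longrightarrow> norm k \<ge> r1 \<Longrightarrow> 1/2 \<le> norm (Q.J k) \<and>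
      norm (exp (k * x) * Q.jost k x) \<le> ?A \<and> norm (exp (- k * x) * ivp q 0 1 (k\<^sup>2) x) \<le> ?a / norm k"
    using one[OF Q.half_line_axioms] by blast
  obtain r2 where r2: "r2 \<ge> 1" "\<And>k. Re k \<ge> 0 \<Longrightarrow> norm k \<ge> r2 \<Longrightarrow> 1/2 \<le> norm (P.J k) \<and>
      norm (exp (k * x) * P.jost k x) \<le> ?B \<and> norm (exp (- k * x) * ivp p 0 1 (k\<^sup>2) x) \<le> ?b / norm k"
    using one[OF P.half_line_axioms] by blast
  show thesis
  proof (rule that[of "max r1 r2" "2 * (?A * ?b) + 2 * (?B * ?a)"])
    show "0 < max r1 r2" using r1 by auto
    fix k assume k: "Re k \<ge> 0" "norm k \<ge> max r1 r2"
    have h: "1/2 \<le> norm (Q.J k)" "norm (exp (k * x) * Q.jost k x) \<le> ?A" "norm (exp (- k * x) * ivp q 0 1 (k\<^sup>2) x) \<le> ?a / norm k"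
      "1/2 \<le> norm (P.J k)" "norm (exp (k * x) * P.jost k x) \<le> ?B" "norm (exp (- k * x) * ivp p 0 1 (k\<^sup>2) x) \<le> ?b / norm k"
      using r1(2)[OF k(1)] r2(2)[OF k(1)] k(2) by auto
    have pr: "norm (u * v / j) \<le> 2 * (U * V) / norm k"
      if "1/2 \<le> norm j" "norm (exp (k * x) * u) \<le> U" "norm (exp (- k * x) * v) \<le> V / norm k" for u v j U V
    proof -
      have "u * v = (exp (k * x) * u) * (exp (- k * x) * v)" by (simp flip: exp_add add: mult_ac)
      then have "norm (u * v) = norm (exp (k * x) * u) * norm (exp (- k * x) * v)" by (simp only: norm_mult)
      also have "\<dots> \<le> U * (V / norm k)" using that norm_ge_zero order_trans by (intro mult_mono) blast+
      finally have uv: "norm (u * v) \<le> U * V / norm k" by simp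
      have "norm (u * v) / norm j \<le> norm (u * v) / (1/2)" using that(1) by (intro divide_left_mono) (auto intro!: mult_pos_pos)
      then show ?thesis using uv by (simp add: norm_divide)
    qed
    have "norm (Q.jost k x * ivp p 0 1 (k\<^sup>2) x / Q.J k) \<le> 2 * (?A * ?b) / norm k" by (rule pr[OF h(1,2,6)])
    moreover have "norm (P.jost k x * ivp q 0 1 (k\<^sup>2) x / P.J k) \<le> 2 * (?B * ?a) / norm k" by (rule pr[OF h(4,5,3)])
    ultimately have "norm (Q.jost k x * ivp p 0 1 (k\<^sup>2) x / Q.J k - ivp q 0 1 (k\<^sup>2) x * P.jost k x / P.J k) \<le> (2 * (?A * ?b) + 2 * (?B * ?a)) / norm k"
      using norm_triangle_ineq4[of "Q.jost k x * ivp p 0 1 (k\<^sup>2) x / Q.J k" "P.jost k x * ivp q 0 1 (k\<^sup>2) x / P.J k"]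
      by (simp add: add_divide_distrib mult.commute[of "ivp q 0 1 (k\<^sup>2) x"])
    then show "Q.J k \<noteq> 0 \<and> P.J k \<noteq> 0 \<and> norm (Q.jost k x * ivp p 0 1 (k\<^sup>2) x / Q.J k - ivp q 0 1 (k\<^sup>2) x * P.jost k x / P.J k) \<le> (2 * (?A * ?b) + 2 * (?B * ?a)) / norm k"
      using h by auto
  qed
qed

text \<open>The hypothesis, and with it the expression by Weyl solutions, is available for
  \<open>Re k > 0\<close>. The resulting decay extends to the imaginary axis by continuity and to
  \<open>Re k < 0\<close> because only \<open>k\<^sup>2\<close> enters; Liouville's theorem
  concludes.\<close>

lemma weyl_diff_zero:
  assumes x: "x \<ge> 0" and rel: "\<And>k. Re k > 0 \<Longrightarrow> Q.J1 k * P.J k - P.J1 k * Q.J k = c * (Q.J k * P.J k)"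
  shows "weyl_diff c x k = 0"
proof (rule Liouville_weak_0[where f = "weyl_diff c x"])
  have "(\<lambda>k. ivp f \<alpha> \<beta> (k\<^sup>2) x) holomorphic_on UNIV" if "half_line f" for f \<alpha> \<beta>
  proof -
    have "(\<lambda>k::complex. k\<^sup>2) holomorphic_on UNIV" by (intro holomorphic_intros)
    from holomorphic_on_compose[OF this holomorphic_on_subset[OF half_line.ivp_holomorphic(1)[OF that x]]]
    show ?thesis by (simp add: o_def)
  qed
  note h = this[OF Q.half_line_axioms] this[OF P.half_line_axioms]
  show hol: "weyl_diff c x holomorphic_on UNIV" unfolding weyl_diff_def[abs_def] by (intro holomorphic_intros h)
  obtain C r where r: "r > 0" and C: "\<And>k. Re k \<ge> 0 \<Longrightarrow> norm k \<ge> r \<Longrightarrow> Q.J k \<noteq> 0 \<and> P.J k \<noteq> 0 \<and>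
     norm (Q.jost k x * ivp p 0 1 (k\<^sup>2) x / Q.J k - ivp q 0 1 (k\<^sup>2) x * P.jost k x / P.J k) \<le> C / norm k"
    using weyl_diff_bound[OF x] by blast
  have b1: "norm (weyl_diff c x k) \<le> C / norm k" if "Re k > 0" "norm k \<ge> r" for k
    using C[of k] weyl_diff_eq[OF x _ _ rel] that by auto
  have b2: "norm (weyl_diff c x k) \<le> C / norm k" if k: "Re k \<ge> 0" "norm k > r" for k
  proof (rule tendsto_le[OF trivial_limit_sequentially])
    have seq: "(\<lambda>n. k + of_real (1 / real (Suc n))) \<longlonglongrightarrow> k + of_real 0"
      by (rule tendsto_add[OF tendsto_const tendsto_of_real[OF LIMSEQ_Suc[OF lim_1_over_n]]])
    have "isCont (weyl_diff c x) k"
      using holomorphic_on_imp_continuous_on[OF hol] by (simp add: continuous_on_eq_continuous_at)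
    then show "(\<lambda>n. norm (weyl_diff c x (k + of_real (1 / real (Suc n))))) \<longlonglongrightarrow> norm (weyl_diff c x k)"
      by (intro tendsto_norm isCont_tendsto_compose[of k "weyl_diff c x"]) (use seq in simp_all)
    show "(\<lambda>n. C / norm (k + of_real (1 / real (Suc n)))) \<longlonglongrightarrow> C / norm k"
      by (rule tendsto_eq_rhs[OF tendsto_divide[OF tendsto_const tendsto_norm[OF seq]]]) (use k r in auto)
    have "\<forall>\<^sub>F n in sequentially. r < norm (k + of_real (1 / real (Suc n)))"
      using tendsto_norm[OF seq] k by (intro order_tendstoD) auto
    then show "\<forall>\<^sub>F n in sequentially. norm (weyl_diff c x (k + of_real (1 / real (Suc n)))) \<le> C / norm (k + of_real (1 / real (Suc n)))"
    proof eventually_elim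
      case (elim n)
      have "Re (k + of_real (1 / real (Suc n))) > 0" using k by (simp add: add_nonneg_pos del: of_nat_Suc)
      then show ?case using elim by (intro b1) auto
    qed
  qed
  have b3: "norm (weyl_diff c x k) \<le> C / norm k" if k: "norm k > r" for k
    using b2[of k] b2[of "-k"] k by (cases "Re k \<ge> 0") (auto simp: weyl_diff_def)
  show "(weyl_diff c x \<longlongrightarrow> 0) at_infinity"
  proof (rule Lim_null_comparison)
    show "\<forall>\<^sub>F k in at_infinity. norm (weyl_diff c x k) \<le> C / norm k"
      unfolding eventually_at_infinity by (rule exI[of _ "r + 1"]) (use b3 in force)
    show "((\<lambda>k. C / norm k) \<longlongrightarrow> 0) at_infinity"
      by (rule tendsto_divide_0[OF tendsto_const]) (rule filterlim_at_top_imp_at_infinity[OF filterlim_norm_at_top])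
  qed
qed

text \<open>Off the zeros, \<open>?H = 0\<close> reads \<open>?T / ?F + c = ?t / ?f\<close>;
  differentiation in \<open>x\<close> and the two Wronskians give
  \<open>1 / ?F\<^sup>2 = 1 / ?f\<^sup>2\<close>. Elimination from \<open>?H\<close>,
  \<open>?H'\<close> and the Wronskians does the same without division.\<close>

lemma phi_squared_eq:
  assumes rel: "\<And>k. Re k > 0 \<Longrightarrow> Q.J1 k * P.J k - P.J1 k * Q.J k = c * (Q.J k * P.J k)" and x: "x \<ge> 0"
  shows "(ivp q 0 1 (k\<^sup>2) x)\<^sup>2 = (ivp p 0 1 (k\<^sup>2) x)\<^sup>2"
proof -
  let ?s = "k\<^sup>2"
  let ?T = "ivp q 1 0 ?s" and ?T' = "ivp' q 1 0 ?s" and ?F = "ivp q 0 1 ?s" and ?F' = "ivp' q 0 1 ?s"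
  let ?t = "ivp p 1 0 ?s" and ?t' = "ivp' p 1 0 ?s" and ?f = "ivp p 0 1 ?s" and ?f' = "ivp' p 0 1 ?s"
  let ?H = "\<lambda>x. ?T x * ?f x - ?F x * ?t x + c * (?F x * ?f x)"
  let ?H' = "\<lambda>x. (?T' x * ?f x + ?T x * ?f' x) - (?F' x * ?t x + ?F x * ?t' x) + c * (?F' x * ?f x + ?F x * ?f' x)"
  have ac: "loc_AC {0..} ?H ?H'"
    by (intro loc_AC_add loc_AC_diff loc_AC_cmult loc_AC_mult is_interval_ci)
       (use Q.sol_ivp P.sol_ivp in \<open>auto simp: sol_def\<close>)
  have H0: "?H x = 0" if "x \<ge> 0" for x using weyl_diff_zero[OF that rel, of k] by (simp add: weyl_diff_def)
  have "?H' x = 0"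
  proof (rule continuous_zero_if_integrals_zero[OF _ _ x])
    show "continuous_on {0..b} ?H'" for b
      by (intro continuous_intros sol_continuous[OF Q.sol_ivp] sol_continuous[OF P.sol_ivp]) auto
    show "integral {0..b} ?H' = 0" if "0 \<le> b" for b
      using loc_AC_diff_eq[OF ac, of 0 b] H0[OF that] H0[of 0] that by simp
  qed
  moreover have "?H x = 0" by (rule H0[OF x])
  moreover have "?T x * ?F' x - ?T' x * ?F x = 1" "?t x * ?f' x - ?t' x * ?f x = 1"
    using sol_wronskian[OF Q.sol_ivp[of ?s 1 0] Q.sol_ivp[of ?s 0 1] x] sol_wronskian[OF P.sol_ivp[of ?s 1 0] P.sol_ivp[of ?s 0 1] x]
    by (simp_all add: Q.ivp_0 P.ivp_0)
  ultimately show ?thesis by algebra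
qed

text \<open>A constant discrepancy \<open>c\<close> between the Weyl functions is harmless, as it drops out of the Wronskian
  identity behind \<open>phi_squared_eq\<close>.\<close>

lemma borg_marchenko:
  assumes rel: "\<And>k. Re k > 0 \<Longrightarrow> Q.J1 k * P.J k - P.J1 k * Q.J k = c * (Q.J k * P.J k)"
  obtains N where "negligible N" "\<And>x. x > 0 \<Longrightarrow> x \<notin> N \<Longrightarrow> q x = p x"
proof -
  \<comment> \<open>The squares agree. For large real \<open>k\<close> both solutions have positive
    real part, so no sign is left open there, and the identity theorem in \<open>s\<close> extends
    the equality from an interval to the plane.\<close>
  have eq: "ivp q 0 1 s x = ivp p 0 1 s x" if x: "x > 0" for s x
  proof -
    have "\<forall>\<^sub>F k in at_top. Re (ivp q 0 1 ((complex_of_real k)\<^sup>2) x) > 0 \<and> Re (ivp p 0 1 ((complex_of_real k)\<^sup>2) x) > 0"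
      by (intro eventually_conj Q.phi_eventually_pos P.phi_eventually_pos x)
    then obtain k0 where k0: "\<And>k. k \<ge> k0 \<Longrightarrow> Re (ivp q 0 1 ((complex_of_real k)\<^sup>2) x) > 0 \<and> Re (ivp p 0 1 ((complex_of_real k)\<^sup>2) x) > 0"
      unfolding eventually_at_top_linorder by blast
    define m where "m = max k0 0"
    have e: "ivp q 0 1 ((complex_of_real k)\<^sup>2) x = ivp p 0 1 ((complex_of_real k)\<^sup>2) x" if "k \<ge> k0" for k
    proof -
      have "ivp q 0 1 ((complex_of_real k)\<^sup>2) x = ivp p 0 1 ((complex_of_real k)\<^sup>2) x \<or> ivp q 0 1 ((complex_of_real k)\<^sup>2) x = - ivp p 0 1 ((complex_of_real k)\<^sup>2) x"
        using phi_squared_eq[OF rel, of x "complex_of_real k"] x by (simp add: power2_eq_iff)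
      then show ?thesis using k0[OF that] by auto
    qed
    have "ivp q 0 1 s x - ivp p 0 1 s x = 0"
    proof (rule analytic_continuation[where f = "\<lambda>s. ivp q 0 1 s x - ivp p 0 1 s x" and S = UNIV and U = "complex_of_real ` {m\<^sup>2<..<m\<^sup>2+1}" and \<xi> = "complex_of_real (m\<^sup>2)"])
      show "(\<lambda>s. ivp q 0 1 s x - ivp p 0 1 s x) holomorphic_on UNIV"
        using x by (intro holomorphic_intros Q.ivp_holomorphic P.ivp_holomorphic) auto
      show "complex_of_real (m\<^sup>2) islimpt complex_of_real ` {m\<^sup>2<..<m\<^sup>2+1}"
      proof (rule islimptI)
        fix T assume T: "complex_of_real (m\<^sup>2) \<in> T" "open T"
        then obtain e where e: "e > 0" "ball (complex_of_real (m\<^sup>2)) e \<subseteq> T" using openE by blast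
        define d where "d = min (e/2) (1/2)"
        have d: "0 < d" "d < e" "d < 1" using e by (auto simp: d_def)
        have "complex_of_real (m\<^sup>2 + d) \<in> ball (complex_of_real (m\<^sup>2)) e"
          using d by (simp add: dist_norm)
        then show "\<exists>y\<in>complex_of_real ` {m\<^sup>2<..<m\<^sup>2+1}. y \<in> T \<and> y \<noteq> complex_of_real (m\<^sup>2)"
        proof (intro bexI conjI)
          show "complex_of_real (m\<^sup>2 + d) \<in> complex_of_real ` {m\<^sup>2<..<m\<^sup>2+1}" using d by (intro imageI) auto
          show "complex_of_real (m\<^sup>2 + d) \<in> T" using \<open>complex_of_real (m\<^sup>2 + d) \<in> ball _ e\<close> e by auto
          show "complex_of_real (m\<^sup>2 + d) \<noteq> complex_of_real (m\<^sup>2)" using d by simp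
        qed
      qed
      fix z assume "z \<in> complex_of_real ` {m\<^sup>2<..<m\<^sup>2+1}"
      then obtain t where t: "z = complex_of_real t" "t > m\<^sup>2" by auto
      have m: "m \<ge> 0" "m \<ge> k0" by (auto simp: m_def)
      have t0: "t \<ge> 0" using t(2) zero_le_power2[of m] by linarith
      have "sqrt t \<ge> m" using t m by (simp add: real_le_rsqrt)
      then have "ivp q 0 1 ((complex_of_real (sqrt t))\<^sup>2) x = ivp p 0 1 ((complex_of_real (sqrt t))\<^sup>2) x" using m by (intro e) simp
      then show "ivp q 0 1 z x - ivp p 0 1 z x = 0" using t t0 by (simp flip: of_real_power)
    qed auto
    then show ?thesis by simp
  qed
  have eq0: "ivp q 0 1 s x = ivp p 0 1 s x" if "x \<ge> 0" for s x
    using eq[of x s] that Q.ivp_0(1)[of 0 1 s] P.ivp_0(1)[of 0 1 s] by (cases "x = 0") auto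
  have "\<exists>N. negligible N \<and> (\<forall>x>0. x \<notin> N \<longrightarrow> (complex_of_real (q x) - complex_of_real (p x)) * ivp q 0 1 s x = 0)" for s
  proof -
    let ?F = "ivp q 0 1 s" and ?F' = "ivp' q 0 1 s" and ?f' = "ivp' p 0 1 s"
    have sq: "sol q s ?F ?F'" by (rule Q.sol_ivp)
    have sp: "sol p s (ivp p 0 1 s) ?f'" by (rule P.sol_ivp)
    have d: "?F' x - ?f' x = 0" if "x \<ge> 0" for x
    proof (rule continuous_zero_if_integrals_zero[OF _ _ that])
      show "continuous_on {0..b} (\<lambda>x. ?F' x - ?f' x)" for b
        by (intro continuous_intros sol_continuous[OF sq] sol_continuous[OF sp]) auto
      have ac: "loc_AC {0..} (\<lambda>x. ?F x - ivp p 0 1 s x) (\<lambda>x. ?F' x - ?f' x)"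
        using sq sp by (intro loc_AC_diff) (auto simp: sol_def)
      show "integral {0..b} (\<lambda>x. ?F' x - ?f' x) = 0" if "0 \<le> b" for b
        using loc_AC_diff_eq[OF ac, of 0 b] eq0[of b s] eq0[of 0 s] that by simp
    qed
    let ?g = "\<lambda>x. (complex_of_real (q x) + s) * ?F x - (complex_of_real (p x) + s) * ivp p 0 1 s x"
    have ac: "loc_AC {0..} (\<lambda>x. ?F' x - ?f' x) ?g" using sq sp by (intro loc_AC_diff) (auto simp: sol_def)
    have gi: "?g integrable_on {0..b}" for b
      using loc_AC_integrable(2)[OF ac, of 0 b] by (cases "0 \<le> b") auto
    have gz: "integral {0..b} ?g = 0" if "0 \<le> b" for b
      using loc_AC_diff_eq[OF ac, of 0 b] d[of b] d[of 0] that by simp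
    obtain N where "negligible N" "\<And>x. x > 0 \<Longrightarrow> x \<notin> N \<Longrightarrow> ?g x = 0"
      using AE_zero_if_integrals_zero[OF gi gz] by blast
    then show ?thesis
      by (intro exI[of _ N]) (auto simp: eq[symmetric] algebra_simps)
  qed
  then obtain N where N: "\<And>s. negligible (N s)" "\<And>s x. x > 0 \<Longrightarrow> x \<notin> N s \<Longrightarrow> (complex_of_real (q x) - complex_of_real (p x)) * ivp q 0 1 s x = 0"
    by metis
  show thesis
  \<comment> \<open>The exceptional set depends on \<open>s\<close>, while a parameter with
    nonvanishing solution depends on \<open>x\<close>. The squares of the natural numbers are
    countable and, by positivity for large \<open>k\<close>, contain such a parameter for every
    \<open>x > 0\<close>.\<close>
  proof (rule that[of "\<Union>n::nat. N ((complex_of_real (real n))\<^sup>2)"])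
    show "negligible (\<Union>n::nat. N ((complex_of_real (real n))\<^sup>2))" by (intro negligible_countable_Union) (auto simp: N(1))
    fix x :: real assume x: "x > 0" "x \<notin> (\<Union>n::nat. N ((complex_of_real (real n))\<^sup>2))"
    obtain k0 where "\<And>k. k \<ge> k0 \<Longrightarrow> Re (ivp q 0 1 ((complex_of_real k)\<^sup>2) x) > 0"
      using Q.phi_eventually_pos[OF x(1)] unfolding eventually_at_top_linorder by blast
    then have "ivp q 0 1 ((complex_of_real (real (nat \<lceil>k0\<rceil>)))\<^sup>2) x \<noteq> 0"
      by (metis less_irrefl real_nat_ceiling_ge zero_complex.simps(1))
    moreover have "(complex_of_real (q x) - complex_of_real (p x)) * ivp q 0 1 ((complex_of_real (real (nat \<lceil>k0\<rceil>)))\<^sup>2) x = 0"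
      using x by (intro N) auto
    ultimately show "q x = p x" by (simp flip: of_real_diff)
  qed
qed

end

section \<open>Herglotz functions and isolated singularities\<close>

lemma open_upper_half: "open {z. Im z > 0}" and open_nonreal: "open {z. Im z \<noteq> 0}"
  by (auto simp: open_halfspace_Im_gt intro!: open_Collect_neq continuous_intros)

text \<open>Along a ray \<open>\<xi> + r u\<close> into the upper half-plane, \<open>f\<close> behaves like \<open>r ^ n u ^ n g \<xi>\<close>. If \<open>n \<ge> 2\<close>, then
  rotating \<open>u\<close> by \<open>\<pi> / n\<close> flips the sign, so the imaginary part of the leading coefficient vanishes in
  too many directions.\<close>

lemma herglotz_zero_simple:
  assumes f: "f holomorphic_on S" and S: "open S" "Im \<xi> = 0" "\<xi> \<in> S" and 0: "f \<xi> = 0"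
    and pos: "\<And>z. z \<in> S \<Longrightarrow> Im z > 0 \<Longrightarrow> Im (f z) > 0"
  shows "deriv f \<xi> \<noteq> 0"
proof -
  obtain d where d: "d > 0" "ball \<xi> d \<subseteq> S" using S openE by blast
  let ?B = "ball \<xi> d"
  have fB: "f holomorphic_on ?B" using f d holomorphic_on_subset by blast
  have "\<xi> + of_real (d/2) * \<i> \<in> ?B" using d by (simp add: dist_norm norm_mult)
  moreover have "Im (f (\<xi> + of_real (d/2) * \<i>)) > 0" using calculation d S by (intro pos) auto
  ultimately have nc: "\<not> f constant_on ?B" using 0 d
    unfolding constant_on_def by (metis centre_in_ball less_irrefl zero_complex.simps(2))
  then obtain g r n where n: "0 < n" and r: "0 < r" "ball \<xi> r \<subseteq> ?B" and g: "g holomorphic_on ball \<xi> r"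
    and fg: "\<And>w. w \<in> ball \<xi> r \<Longrightarrow> f w = (w - \<xi>) ^ n * g w" and gnz: "\<And>w. w \<in> ball \<xi> r \<Longrightarrow> g w \<noteq> 0"
    using holomorphic_factor_zero_nonconstant[OF fB open_ball connected_ball _ 0 nc] d by (metis centre_in_ball)
  have cg: "isCont g \<xi>" using holomorphic_on_imp_continuous_on[OF g] r by (simp add: continuous_on_eq_continuous_at)
  have ray: "0 \<le> Im (u ^ n * g \<xi>)" if u: "Im u > 0" for u
  proof (rule tendsto_lowerbound)
    have "((\<lambda>t. u ^ n * g (\<xi> + of_real t * u)) \<longlongrightarrow> u ^ n * g (\<xi> + of_real 0 * u)) (at_right 0)"
      by (intro tendsto_intros isCont_tendsto_compose[of "\<xi> + of_real 0 * u" g]) (use cg in simp)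
    from tendsto_Im[OF this] show "((\<lambda>t. Im (u ^ n * g (\<xi> + of_real t * u))) \<longlongrightarrow> Im (u ^ n * g \<xi>)) (at_right 0)"
      by simp
    have u0: "norm u > 0" using u by auto
    show "\<forall>\<^sub>F t in at_right 0. 0 \<le> Im (u ^ n * g (\<xi> + of_real t * u))"
      unfolding eventually_at_right_field
    proof (intro exI[of _ "r / norm u"] conjI allI impI)
      show "0 < r / norm u" using r u0 by simp
      fix t assume t: "0 < t" "t < r / norm u"
      let ?w = "\<xi> + of_real t * u"
      have w: "?w \<in> ball \<xi> r" using t u0 by (simp add: dist_norm norm_mult field_simps)
      then have "Im (f ?w) > 0" using r d S t u by (intro pos) auto
      moreover have "f ?w = of_real (t ^ n) * (u ^ n * g ?w)"
        using fg[OF w] by (simp add: power_mult_distrib)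
      ultimately show "0 \<le> Im (u ^ n * g ?w)" using t by (simp add: zero_less_mult_iff)
    qed
  qed simp
  have "n = 1"
  proof (rule ccontr)
    assume "n \<noteq> 1"
    then have n2: "n \<ge> 2" using n by auto
    have zero: "Im (cis (real n * t) * g \<xi>) = 0" if t: "0 < t" "t < pi / 2" for t
    proof -
      have "pi / real n \<le> pi / 2" using n2 by (intro divide_left_mono) auto
      then have "t + pi / real n < pi" "0 < t + pi / real n" "t < pi" using t n2 by (linarith, auto intro!: add_pos_pos)
      then have "0 < sin t" "0 < sin (t + pi / real n)" using t by (auto intro!: sin_gt_zero)
      then have "0 \<le> Im (cis t ^ n * g \<xi>)" "0 \<le> Im (cis (t + pi / real n) ^ n * g \<xi>)"
        by (auto intro!: ray simp del: times_complex.simps)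
      moreover have "cis (t + pi / real n) ^ n = - (cis t ^ n)"
      proof -
        have "real n * (t + pi / real n) = real n * t + pi" using n by (simp add: field_simps)
        then have "cis (t + pi / real n) ^ n = cis (real n * t + pi)" by (metis Complex.DeMoivre)
        also have "\<dots> = - (cis t ^ n)" by (simp add: Complex.DeMoivre flip: cis_mult)
        finally show ?thesis .
      qed
      then have "Im (cis (t + pi / real n) ^ n * g \<xi>) = - Im (cis t ^ n * g \<xi>)" by (simp only:) simp
      ultimately have "Im (cis t ^ n * g \<xi>) = 0" by linarith
      then show ?thesis by (simp only: Complex.DeMoivre)
    qed
    \<comment> \<open>The \<open>n\<close>-th powers of these two directions have arguments
      \<open>pi / 2\<close> and \<open>pi / 4\<close>; the two real conditions are independent and
      force \<open>g \<xi> = 0\<close>.\<close>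
    have lt: "pi / (2 * real n) < pi / 2" "pi / (4 * real n) < pi / 2" using n2 by (simp_all add: field_simps)
    have "Im (cis (real n * (pi / (2 * real n))) * g \<xi>) = 0"
      by (rule zero[OF _ lt(1)]) (use n in simp)
    moreover have "Im (cis (real n * (pi / (4 * real n))) * g \<xi>) = 0"
      by (rule zero[OF _ lt(2)]) (use n in simp)
    moreover have "real n * (pi / (2 * real n)) = pi / 2" "real n * (pi / (4 * real n)) = pi / 4" using n by auto
    ultimately have "Im (cis (pi / 2) * g \<xi>) = 0" "Im (cis (pi / 4) * g \<xi>) = 0" by metis+
    then have "g \<xi> = 0" by (simp add: cos_45 sin_45 complex_eq_iff)
    then show False using gnz r by simp
  qed
  then have eq: "f w = (w - \<xi>) * g w" if "w \<in> ball \<xi> r" for w using fg[OF that] by simp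
  have "(g has_field_derivative deriv g \<xi>) (at \<xi>)" using g r by (intro holomorphic_derivI[of g "ball \<xi> r"]) auto
  then have "((\<lambda>w. (w - \<xi>) * g w) has_field_derivative g \<xi>) (at \<xi>)"
    by (auto intro!: derivative_eq_intros)
  then have "(f has_field_derivative g \<xi>) (at \<xi>)"
    by (rule has_field_derivative_transform_within_open[where S = "ball \<xi> r"]) (use r eq in auto)
  then show ?thesis using DERIV_imp_deriv gnz[of \<xi>] r by force
qed

text \<open>A Cayley map on the source taking 0 to \<open>\<i>\<close>, and one on the target taking
  \<open>f \<i>\<close> to 0, reduce this to the Schwarz lemma. With
  \<open>w = (z - \<i>) / (z + \<i>)\<close>, one factor 2 comes from solving for \<open>f\<close>,
  which gives \<open>norm (f z) * (1 - norm w) \<le> 2 * norm (f \<i>)\<close>, the other from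
  \<open>1 - norm w \<ge> Im z / 2\<close> for \<open>norm z \<le> 1\<close>.\<close>

lemma herglotz_growth:
  assumes f: "f holomorphic_on {z. Im z > 0}" and pos: "\<And>z. Im z > 0 \<Longrightarrow> Im (f z) > 0"
    and z: "Im z > 0" "norm z \<le> 1"
  shows "norm (f z) \<le> 4 * norm (f \<i>) / Im z"
proof -
  let ?a = "f \<i>"
  define p where "p w = \<i> * (1 + w) / (1 - w)" for w
  define g where "g w = (f (p w) - ?a) / (f (p w) - cnj ?a)" for w
  have Imp: "Im (p w) > 0" if "norm w < 1" for w
  proof -
    have w1: "1 - w \<noteq> 0" using that by auto
    have "p w = (\<i> * (1 + w) * cnj (1 - w)) / of_real ((norm (1 - w))\<^sup>2)"
      unfolding p_def complex_norm_square using w1 by (simp add: divide_simps)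
    then have "Im (p w) = Im (\<i> * (1 + w) * cnj (1 - w)) / (norm (1 - w))\<^sup>2" by simp
    also have "Im (\<i> * (1 + w) * cnj (1 - w)) = 1 - (norm w)\<^sup>2"
      by (simp add: cmod_power2 algebra_simps) (simp add: power2_eq_square)
    finally have e: "Im (p w) = (1 - (norm w)\<^sup>2) / (norm (1 - w))\<^sup>2" .
    have "(norm w)\<^sup>2 < 1" using that by (simp add: power_less_one_iff)
    then show ?thesis unfolding e using w1 by simp
  qed
  have ia: "Im ?a > 0" by (rule pos) simp
  have closer: "norm (b - ?a) < norm (b - cnj ?a)" if "Im b > 0" for b
  proof -
    have "\<bar>Im b - Im ?a\<bar> < Im b + Im ?a" using that ia by auto
    moreover have "0 < Im b * Im ?a" using that ia by simp
    ultimately have "(Im b - Im ?a)\<^sup>2 < (Im b + Im ?a)\<^sup>2" by (simp add: power2_eq_square algebra_simps)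
    then show ?thesis by (simp add: cmod_def)
  qed
  have nz: "f (p w) - cnj ?a \<noteq> 0" if "norm w < 1" for w
    using closer[OF pos[OF Imp[OF that]]] by auto
  let ?w = "(z - \<i>) / (z + \<i>)"
  have zi: "z + \<i> \<noteq> 0" using z by (auto simp: complex_eq_iff)
  have wsq: "(norm (z + \<i>))\<^sup>2 - (norm (z - \<i>))\<^sup>2 = 4 * Im z" unfolding cmod_power2 by (simp add: power2_eq_square algebra_simps)
  have nzi: "norm (z + \<i>) > 0" using zi by simp
  have "norm (z - \<i>) < norm (z + \<i>)"
  proof (rule power2_less_imp_less)
    show "(norm (z - \<i>))\<^sup>2 < (norm (z + \<i>))\<^sup>2" using wsq z by linarith
  qed simp
  then have w1: "norm ?w < 1" using nzi by (simp add: norm_divide)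
  have "norm (g ?w) \<le> norm ?w"
  proof (rule Schwarz_Lemma(1)[OF _ _ _ w1])
    have ph: "p holomorphic_on ball 0 1" unfolding p_def by (intro holomorphic_intros) auto
    have "f \<circ> p holomorphic_on ball 0 1"
      by (rule holomorphic_on_compose[OF ph holomorphic_on_subset[OF f]]) (use Imp in auto)
    then have "(\<lambda>w. f (p w)) holomorphic_on ball 0 1" by (simp add: o_def)
    then show "g holomorphic_on ball 0 1" unfolding g_def by (intro holomorphic_intros) (use nz in auto)
    show "g 0 = 0" by (simp add: g_def p_def)
    show "norm (g w) < 1" if "norm w < 1" for w
      using closer[OF pos[OF Imp[OF that]]] nz[OF that] by (simp add: g_def norm_divide)
  qed
  have pw: "p ?w = z"
  proof -
    have "1 - ?w = 2 * \<i> / (z + \<i>)" "1 + ?w = 2 * z / (z + \<i>)" using zi by (simp_all add: field_simps)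
    then show ?thesis unfolding p_def using zi by simp
  qed
  have "f z * (1 - g ?w) = ?a - g ?w * cnj ?a"
    using nz[OF w1] unfolding g_def pw by (simp add: field_simps)
  then have "norm (f z) * norm (1 - g ?w) \<le> norm ?a + norm (g ?w) * norm ?a"
    by (metis norm_mult norm_triangle_ineq4 complex_mod_cnj)
  also have "\<dots> \<le> 2 * norm ?a" using \<open>norm (g ?w) \<le> norm ?w\<close> w1 mult_right_mono[of "norm (g ?w)" 1 "norm ?a"] by simp
  finally have 1: "norm (f z) * norm (1 - g ?w) \<le> 2 * norm ?a" .
  have "1 - norm ?w \<le> norm (1 - g ?w)"
    using \<open>norm (g ?w) \<le> norm ?w\<close> norm_triangle_ineq2[of 1 "g ?w"] by simp
  moreover have "Im z / 2 \<le> 1 - norm ?w"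
  proof -
    have n2: "norm (z + \<i>) \<le> 2" using norm_triangle_ineq[of z \<i>] z by simp
    have "(norm (z + \<i>) - norm (z - \<i>)) * (norm (z + \<i>) + norm (z - \<i>)) = 4 * Im z"
      using wsq square_diff_square_factored[of "norm (z + \<i>)" "norm (z - \<i>)"] by (simp only: power2_eq_square mult.commute)
    moreover have "(norm (z + \<i>) - norm (z - \<i>)) * (norm (z + \<i>) + norm (z - \<i>)) \<le> (norm (z + \<i>) - norm (z - \<i>)) * 4"
      using \<open>norm (z - \<i>) < norm (z + \<i>)\<close> n2 by (intro mult_left_mono) auto
    ultimately have "Im z \<le> norm (z + \<i>) - norm (z - \<i>)" by simp
    moreover have "1 - norm ?w = (norm (z + \<i>) - norm (z - \<i>)) / norm (z + \<i>)" using nzi by (simp add: norm_divide field_simps)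
    moreover have "(norm (z + \<i>) - norm (z - \<i>)) / 2 \<le> (norm (z + \<i>) - norm (z - \<i>)) / norm (z + \<i>)"
      using n2 nzi \<open>norm (z - \<i>) < norm (z + \<i>)\<close> by (intro divide_left_mono) auto
    ultimately show ?thesis by simp
  qed
  ultimately have "norm (f z) * (Im z / 2) \<le> norm (f z) * norm (1 - g ?w)" by (intro mult_left_mono) auto
  then have "norm (f z) * (Im z / 2) \<le> 2 * norm ?a" using 1 by linarith
  then show ?thesis using z by (simp add: field_simps)
qed

text \<open>The square root maps the slit plane into the right half-plane, and a Cayley map sends
  that to the disc. The result is bounded near 0 whatever singularity \<open>G\<close> has there; so
  it extends to an entire function, which tends to 0 at infinity and hence vanishes.\<close>

lemma slit_valued_constant:
  assumes G: "G holomorphic_on - {0}" and slit: "\<And>z. z \<noteq> 0 \<Longrightarrow> G z \<notin> \<real>\<^sub>\<le>\<^sub>0" and lim: "(G \<longlongrightarrow> 1) at_infinity"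
    and z: "z \<noteq> 0"
  shows "G z = 1"
proof -
  define F where "F w = (csqrt (G w) - 1) / (csqrt (G w) + 1)" for w
  have re: "Re (csqrt (G w)) > 0" if "w \<noteq> 0" for w
  proof (rule ccontr)
    assume "\<not> ?thesis"
    then have "Re (csqrt (G w)) = 0" using csqrt_principal[of "G w"] by auto
    then have "Re ((csqrt (G w))\<^sup>2) \<le> 0" "Im ((csqrt (G w))\<^sup>2) = 0" by (simp_all only: Re_power2 Im_power2) auto
    then show False using slit[OF that] by (simp add: complex_nonpos_Reals_iff)
  qed
  have nz: "csqrt (G w) + 1 \<noteq> 0" if "w \<noteq> 0" for w
  proof
    assume "csqrt (G w) + 1 = 0"
    then have "csqrt (G w) = - 1" by (simp only: add_eq_0_iff2)
    then show False using re[OF that] by (simp only:) simp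
  qed
  have Fh: "F holomorphic_on UNIV - {0}" unfolding F_def
    by (intro holomorphic_intros) (use G slit nz in \<open>auto simp: Compl_eq_Diff_UNIV\<close>)
  have F1: "norm (F w) \<le> 1" if "w \<noteq> 0" for w
  proof -
    let ?s = "csqrt (G w)"
    have "(norm (?s - 1))\<^sup>2 \<le> (norm (?s + 1))\<^sup>2" using re[OF that] unfolding cmod_power2 by (simp add: power2_eq_square algebra_simps del: csqrt.sel csqrt.simps)
    then have "norm (?s - 1) \<le> norm (?s + 1)" by (rule power2_le_imp_le) simp
    then show ?thesis using nz[OF that] by (simp add: F_def norm_divide divide_le_eq_1)
  qed
  have "\<exists>B. \<forall>\<^sub>F w in at 0. norm (F w) \<le> B"
    by (rule exI[of _ 1]) (auto simp: eventually_at intro!: exI[of _ 1] F1)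
  then obtain H where H: "H holomorphic_on UNIV" "\<And>w. w \<noteq> 0 \<Longrightarrow> H w = F w"
    using holomorphic_on_extend_bounded[OF Fh] by auto
  have "isCont csqrt 1" by (rule continuous_at_csqrt) simp
  then have "((\<lambda>w. csqrt (G w)) \<longlongrightarrow> csqrt 1) at_infinity" using lim by (rule isCont_tendsto_compose)
  then have "(F \<longlongrightarrow> (csqrt 1 - 1) / (csqrt 1 + 1)) at_infinity"
    unfolding F_def by (intro tendsto_intros) auto
  then have "(F \<longlongrightarrow> 0) at_infinity" by simp
  moreover have "\<forall>\<^sub>F w in at_infinity. F w = H w"
    unfolding eventually_at_infinity
  proof (intro exI allI impI)
    fix w :: complex assume "1 \<le> norm w"
    then have "w \<noteq> 0" by auto
    then show "F w = H w" by (rule H(2)[symmetric])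
  qed
  ultimately have "(H \<longlongrightarrow> 0) at_infinity" by (rule Lim_transform_eventually)
  then have "H z = 0" by (rule Liouville_weak_0[OF H(1)])
  then have "csqrt (G z) = 1" using H(2)[OF z] nz[OF z] by (simp add: F_def)
  then show ?thesis by (metis power2_csqrt one_power2)
qed

text \<open>In the variable \<open>u = 1 / z\<close>, the estimate on \<open>\<bar>u\<bar> = r\<close> degenerates only at \<open>u = \<plusminus> r\<close>, where the factor
  \<open>u\<^sup>2 - r\<^sup>2\<close> compensates; so \<open>E (1 / u)\<close> extends to an entire function of linear growth.\<close>

lemma even_punctured_constant:
  assumes E: "E holomorphic_on - {0}" and even: "\<And>z. z \<noteq> 0 \<Longrightarrow> E (- z) = E z"
    and bd: "\<And>z. norm z \<ge> r0 \<Longrightarrow> norm (E z) \<le> B" and r0: "r0 > 0"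
    and gr: "\<And>z. norm z \<le> 1 \<Longrightarrow> Im z \<noteq> 0 \<Longrightarrow> norm (E z) \<le> C / \<bar>Im z\<bar>"
  obtains c where "\<And>z. z \<noteq> 0 \<Longrightarrow> E z = c"
proof -
  define h where "h u = E (inverse u)" for u
  have "inverse holomorphic_on (UNIV - {0::complex})" by (intro holomorphic_intros) auto
  from holomorphic_on_compose[OF this holomorphic_on_subset[OF E]]
  have hh: "h holomorphic_on UNIV - {0}" by (fastforce simp: o_def h_def[abs_def])
  have "\<exists>B. \<forall>\<^sub>F w in at 0. norm (h w) \<le> B"
  proof (rule exI[of _ B], unfold eventually_at, intro exI[of _ "1 / r0"] conjI ballI impI)
    show "0 < 1 / r0" using r0 by simp
    fix u :: complex assume u: "u \<noteq> 0 \<and> dist u 0 < 1 / r0"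
    then have "r0 < 1 / norm u" using r0 by (simp add: field_simps)
    then have "r0 \<le> norm (inverse u)" by (simp add: norm_divide inverse_eq_divide)
    then show "norm (h u) \<le> B" unfolding h_def by (rule bd)
  qed
  then obtain H where H: "H holomorphic_on UNIV" "\<And>u. u \<noteq> 0 \<Longrightarrow> H u = h u"
    using holomorphic_on_extend_bounded[OF hh] by auto
  have C: "C \<ge> 0" using gr[of "\<i>"] order_trans[OF norm_ge_zero] by fastforce
  \<comment> \<open>On the circle of radius \<open>r = 2 * norm u\<close> the product is at most
    \<open>2 * C * r ^ 3 = 16 * C * norm u ^ 3\<close>, and at \<open>u\<close> the auxiliary factor
    has modulus at least \<open>3 * (norm u)\<^sup>2\<close>; this is the origin of 16/3.\<close>
  have lin: "norm (H u) \<le> (16 * C / 3) * norm u ^ 1" if u: "1 \<le> norm u" for u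
  proof -
    define r where "r = 2 * norm u"
    have r: "r \<ge> 2" "r > 0" using u by (auto simp: r_def)
    have "norm (H u * (u\<^sup>2 - of_real (r\<^sup>2))) \<le> 2 * C * r ^ 3"
    proof (rule maximum_modulus_frontier[where f = "\<lambda>u. H u * (u\<^sup>2 - of_real (r\<^sup>2))" and S = "cball 0 r"])
      show "(\<lambda>u. H u * (u\<^sup>2 - of_real (r\<^sup>2))) holomorphic_on interior (cball 0 r)"
        by (intro holomorphic_intros holomorphic_on_subset[OF H(1)]) auto
      show "continuous_on (closure (cball 0 r)) (\<lambda>u. H u * (u\<^sup>2 - of_real (r\<^sup>2)))"
        by (intro continuous_intros holomorphic_on_imp_continuous_on holomorphic_on_subset[OF H(1)]) auto
      show "u \<in> cball 0 r" using u by (simp add: r_def)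
      fix v :: complex assume "v \<in> frontier (cball 0 r)"
      then have nv: "norm v = r" using r by (auto simp: frontier_cball)
      then have v0: "v \<noteq> 0" using r by auto
      show "norm (H v * (v\<^sup>2 - of_real (r\<^sup>2))) \<le> 2 * C * r ^ 3"
      proof (cases "Im v = 0")
        case True
        then have "v\<^sup>2 = of_real (r\<^sup>2)" using nv
          by (simp add: complex_eq_iff cmod_def power2_eq_square real_sqrt_mult_self flip: nv)
        then show ?thesis using C r by simp
      next
        case False
        have im: "\<bar>Im (inverse v)\<bar> = \<bar>Im v\<bar> / r\<^sup>2"
          using nv[symmetric] by (simp add: cmod_power2 abs_divide abs_minus_cancel)
        have "norm (H v) \<le> C / \<bar>Im (inverse v)\<bar>"
          unfolding H(2)[OF v0] h_def
        proof (rule gr)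
          show "norm (inverse v) \<le> 1" using nv r by (simp add: norm_inverse inverse_le_1_iff)
          show "Im (inverse v) \<noteq> 0" using False v0 by (simp add: divide_eq_0_iff)
        qed
        then have b1: "norm (H v) \<le> C * r\<^sup>2 / \<bar>Im v\<bar>" unfolding im by simp
        have "of_real (r\<^sup>2) = v * cnj v" using nv complex_norm_square by metis
        then have "v\<^sup>2 - of_real (r\<^sup>2) = v * (v - cnj v)" by (simp add: power2_eq_square algebra_simps)
        then have "norm (v\<^sup>2 - of_real (r\<^sup>2)) = r * (2 * \<bar>Im v\<bar>)"
          using nv by (simp add: norm_mult complex_diff_cnj)
        then have "norm (H v * (v\<^sup>2 - of_real (r\<^sup>2))) = norm (H v) * (r * (2 * \<bar>Im v\<bar>))" by (simp add: norm_mult)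
        also have "\<dots> \<le> C * r\<^sup>2 / \<bar>Im v\<bar> * (r * (2 * \<bar>Im v\<bar>))" using b1 r by (intro mult_right_mono) auto
        also have "\<dots> = 2 * C * r ^ 3" using False by (simp add: power2_eq_square power3_eq_cube)
        finally show ?thesis .
      qed
    qed simp
    moreover have lo: "3 * (norm u)\<^sup>2 \<le> norm (u\<^sup>2 - of_real (r\<^sup>2))"
      using norm_triangle_ineq2[of "of_real (r\<^sup>2) :: complex" "u\<^sup>2"]
      by (simp add: r_def norm_minus_commute norm_power power_mult_distrib norm_mult)
    ultimately have "norm (H u) * (3 * (norm u)\<^sup>2) \<le> 2 * C * r ^ 3"
      unfolding norm_mult using mult_left_mono[OF lo norm_ge_zero, of "H u"] by linarith
    then have "norm (H u) * (3 * (norm u)\<^sup>2) \<le> (16 * C * norm u) * (norm u)\<^sup>2"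
      by (simp add: r_def power_mult_distrib power3_eq_cube power2_eq_square mult_ac)
    then have "(norm (H u) * 3) * (norm u)\<^sup>2 \<le> (16 * C * norm u) * (norm u)\<^sup>2" by (simp add: mult_ac)
    moreover have "(norm u)\<^sup>2 > 0" using u by (intro zero_less_power) linarith
    ultimately have "norm (H u) * 3 \<le> 16 * C * norm u" by (rule mult_right_le_imp_le)
    then show ?thesis by simp
  qed
  have poly: "H u = H 0 + deriv H 0 * u" for u
    using Liouville_polynomial[OF H(1) lin, of 1 u] by simp
  have "H (- 1) = H 1" using H(2)[of 1] H(2)[of "-1"] even[of 1] by (simp add: h_def)
  then have "deriv H 0 = 0" using poly[of 1] poly[of "-1"] by simp
  then have "E z = H 0" if "z \<noteq> 0" for z
    using poly[of "inverse z"] H(2)[of "inverse z"] that by (simp add: h_def)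
  then show thesis using that by blast
qed

section \<open>Quotients of functions with the same simple zeros\<close>

definition simple_quotient :: "(complex \<Rightarrow> complex) \<Rightarrow> (complex \<Rightarrow> complex) \<Rightarrow> complex \<Rightarrow> complex" where
  "simple_quotient X Y z = (if Y z = 0 then deriv X z / deriv Y z else X z / Y z)"

text \<open>At a common simple zero \<open>z\<close>, both functions divided by \<open>w - z\<close>
  tend to their derivatives. So the prescribed value is the limit of the quotient, and the
  singularity is removable.\<close>

lemma simple_quotient:
  assumes X: "X holomorphic_on U" and Y: "Y holomorphic_on U" and U: "open U"
    and zeros: "\<And>z. z \<in> U \<Longrightarrow> X z = 0 \<longleftrightarrow> Y z = 0"
    and sX: "\<And>z. z \<in> U \<Longrightarrow> X z = 0 \<Longrightarrow> deriv X z \<noteq> 0" and sY: "\<And>z. z \<in> U \<Longrightarrow> Y z = 0 \<Longrightarrow> deriv Y z \<noteq> 0"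
  shows "simple_quotient X Y holomorphic_on U" "z \<in> U \<Longrightarrow> simple_quotient X Y z \<noteq> 0"
proof -
  let ?R = "simple_quotient X Y"
  show "z \<in> U \<Longrightarrow> ?R z \<noteq> 0" using zeros sX sY by (auto simp: simple_quotient_def)
  have "?R field_differentiable at z" if z: "z \<in> U" for z
  proof (cases "Y z = 0")
    case False
    define V where "V = U \<inter> Y -` (- {0})"
    have V: "open V" unfolding V_def
      by (rule continuous_open_preimage[OF holomorphic_on_imp_continuous_on[OF Y] U]) auto
    have "(\<lambda>z. X z / Y z) holomorphic_on V"
      by (intro holomorphic_intros holomorphic_on_subset[OF X] holomorphic_on_subset[OF Y]) (auto simp: V_def)
    then have "?R holomorphic_on V" by (rule holomorphic_transform) (auto simp: V_def simple_quotient_def)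
    then show ?thesis using V False z holomorphic_on_imp_differentiable_at[of ?R V z] by (auto simp: V_def)
  next
    case True
    then have X0: "X z = 0" using zeros z by auto
    have dX: "((\<lambda>w. X w / (w - z)) \<longlongrightarrow> deriv X z) (at z)" and dY: "((\<lambda>w. Y w / (w - z)) \<longlongrightarrow> deriv Y z) (at z)"
      using holomorphic_derivI[OF X U z] holomorphic_derivI[OF Y U z] X0 True by (simp_all add: has_field_derivative_iff)
    have "\<forall>\<^sub>F w in at z. Y w / (w - z) \<noteq> 0" using tendsto_imp_eventually_ne[OF dY sY[OF z True]] .
    then obtain d where d: "d > 0" "\<And>w. w \<noteq> z \<Longrightarrow> dist w z < d \<Longrightarrow> Y w \<noteq> 0"
      unfolding eventually_at by auto
    obtain e where e: "e > 0" "ball z e \<subseteq> U" using U z openE by blast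
    define V where "V = ball z (min d e)"
    have V: "open V" "z \<in> V" "V \<subseteq> U" "\<And>w. w \<in> V - {z} \<Longrightarrow> Y w \<noteq> 0"
      using d e by (auto simp: V_def dist_commute)
    have "?R holomorphic_on V"
    proof (rule no_isolated_singularity'[where K = "{z}"])
      have "(\<lambda>z. X z / Y z) holomorphic_on V - {z}"
        by (intro holomorphic_intros holomorphic_on_subset[OF X] holomorphic_on_subset[OF Y]) (use V in auto)
      then show "?R holomorphic_on V - {z}" by (rule holomorphic_transform) (use V in \<open>auto simp: simple_quotient_def\<close>)
      fix w assume w: "w \<in> {z}"
      have "((\<lambda>w. (X w / (w - z)) / (Y w / (w - z))) \<longlongrightarrow> deriv X z / deriv Y z) (at z)"
        by (intro tendsto_divide dX dY sY z True)
      moreover have "\<forall>\<^sub>F w in at z. (X w / (w - z)) / (Y w / (w - z)) = ?R w"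
        unfolding eventually_at using d by (intro exI[of _ d]) (auto simp: simple_quotient_def)
      ultimately have "(?R \<longlongrightarrow> deriv X z / deriv Y z) (at z)" by (rule Lim_transform_eventually)
      moreover have "?R z = deriv X z / deriv Y z" using True by (simp add: simple_quotient_def)
      ultimately have "(?R \<longlongrightarrow> ?R z) (at z)" by (simp only:)
      then have "(?R \<longlongrightarrow> ?R z) (at z within V)" by (rule tendsto_within_subset) simp
      then show "(?R \<longlongrightarrow> ?R w) (at w within V)" using w by (simp only: singleton_iff)
    qed (use V in auto)
    then show ?thesis using V holomorphic_on_imp_differentiable_at by blast
  qed
  then show "?R holomorphic_on U" by (simp add: holomorphic_on_def field_differentiable_at_within)
qed

section \<open>Pairs of Weyl functions\<close>

lemma Im_divide_cnj: "Im (x / y) = Im (x * cnj y) / (norm y)\<^sup>2"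
  by (subst complex_div_cnj) (simp add: Im_divide_of_real flip: of_real_power)

lemma deriv_mult_at_zero:
  assumes "p holomorphic_on S" "q holomorphic_on S" "open S" "t \<in> S" "p t = 0"
  shows "deriv (\<lambda>z. p z * q z) t = deriv p t * q t"
  by (rule DERIV_imp_deriv)
     (use assms holomorphic_derivI[of p S t] holomorphic_derivI[of q S t] in \<open>auto intro!: derivative_eq_intros\<close>)

lemma deriv_divide_at_zero:
  assumes "p holomorphic_on S" "q holomorphic_on S" "open S" "t \<in> S" "p t = 0" "q t \<noteq> 0"
  shows "deriv (\<lambda>z. p z / q z) t = deriv p t / q t"
  by (rule DERIV_imp_deriv)
     (use assms holomorphic_derivI[of p S t] holomorphic_derivI[of q S t] in \<open>auto intro!: derivative_eq_intros simp: field_simps\<close>)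

lemma open_nonzero_set:
  assumes "f holomorphic_on S" "open S" shows "open {z \<in> S. f z \<noteq> 0}"
proof -
  have "open (S \<inter> f -` (- {0}))"
    by (rule continuous_open_preimage[OF holomorphic_on_imp_continuous_on[OF assms(1)] assms(2)]) auto
  moreover have "S \<inter> f -` (- {0}) = {z \<in> S. f z \<noteq> 0}" by auto
  ultimately show ?thesis by simp
qed

lemma holomorphic_on_reflect:
  assumes "F holomorphic_on S" "\<And>z. z \<in> T \<Longrightarrow> - z \<in> S" shows "(\<lambda>z. F (- z)) holomorphic_on T"
proof -
  have "(\<lambda>z::complex. - z) holomorphic_on T" by (intro holomorphic_intros)
  from holomorphic_on_compose_gen[OF this assms(1)] show ?thesis using assms(2) by (auto simp: o_def)
qed

abbreviation "right_half \<equiv> {z::complex. Re z > 0}"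

lemma open_right_half: "open right_half" by (rule open_halfspace_Re_gt)

text \<open>\<open>P / P1\<close> has positive imaginary part above the real axis, because
  \<open>Im (P * cnj P1) = Im (- P1 * cnj P)\<close>; \<open>herglotz_zero_simple\<close> applies to
  it near \<open>t\<close>, and \<open>P1 t \<noteq> 0\<close> transfers the order to
  \<open>P\<close>.\<close>

lemma herglotz_pair_zero_simple:
  assumes P: "P holomorphic_on right_half" and P1: "P1 holomorphic_on right_half"
    and herg: "\<And>z. Re z \<ge> 0 \<Longrightarrow> Im z > 0 \<Longrightarrow> Im (- P1 z * cnj (P z)) > 0"
    and t: "Re t > 0" "Im t = 0" "P t = 0" and nontriv: "P1 t \<noteq> 0"
  shows "deriv P t \<noteq> 0"
proof -
  let ?S = "{z \<in> right_half. P1 z \<noteq> 0}"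
  have op: "open ?S" by (rule open_nonzero_set[OF P1 open_right_half])
  have h: "P holomorphic_on ?S" "P1 holomorphic_on ?S"
    using holomorphic_on_subset[OF P, of ?S] holomorphic_on_subset[OF P1, of ?S] by auto
  have "deriv (\<lambda>z. P z / P1 z) t \<noteq> 0"
  proof (rule herglotz_zero_simple[OF _ op t(2)])
    show "(\<lambda>z. P z / P1 z) holomorphic_on ?S" by (intro holomorphic_intros h) auto
    show "0 < Im (P z / P1 z)" if "z \<in> ?S" "0 < Im z" for z
      using herg[of z] that unfolding Im_divide_cnj by (intro divide_pos_pos) (auto simp: algebra_simps)
  qed (use t nontriv in auto)
  then show ?thesis using deriv_divide_at_zero[OF h op, of t] t nontriv by auto
qed

section \<open>The functions attached to one potential\<close>

text \<open>\<open>A\<close>, \<open>A1\<close> stand for the Jost data at 0 of the right half-line,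
  \<open>B\<close>, \<open>B1\<close> for those of the reflected potential, so \<open>M\<close> is
  \<open>- A1 / A\<close> and \<open>M\<^sup>-\<close> is \<open>- B1 / B\<close>. Numerators and
  denominators are kept apart because they are holomorphic where the quotients have poles.
  \<open>refl\<close> is what being reflectionless gives on the imaginary axis,
  \<open>generic_pair\<close> what being generic gives on the positive axis.\<close>

locale weyl_pair =
  fixes A A1 B B1 :: "complex \<Rightarrow> complex"
  assumes hol: "A holomorphic_on right_half" "A1 holomorphic_on right_half" "B holomorphic_on right_half" "B1 holomorphic_on right_half"
    and cont: "continuous_on {z. Re z \<ge> 0 \<and> z \<noteq> 0} A" "continuous_on {z. Re z \<ge> 0 \<and> z \<noteq> 0} A1"
        "continuous_on {z. Re z \<ge> 0 \<and> z \<noteq> 0} B" "continuous_on {z. Re z \<ge> 0 \<and> z \<noteq> 0} B1"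
    and herg: "\<And>z. Re z \<ge> 0 \<Longrightarrow> Im z > 0 \<Longrightarrow> Im (- A1 z * cnj (A z)) > 0" "\<And>z. Re z \<ge> 0 \<Longrightarrow> Im z > 0 \<Longrightarrow> Im (- B1 z * cnj (B z)) > 0"
    and cnj: "\<And>z. Re z \<ge> 0 \<Longrightarrow> z \<noteq> 0 \<Longrightarrow> A (cnj z) = cnj (A z)" "\<And>z. Re z \<ge> 0 \<Longrightarrow> z \<noteq> 0 \<Longrightarrow> A1 (cnj z) = cnj (A1 z)"
        "\<And>z. Re z \<ge> 0 \<Longrightarrow> z \<noteq> 0 \<Longrightarrow> B (cnj z) = cnj (B z)" "\<And>z. Re z \<ge> 0 \<Longrightarrow> z \<noteq> 0 \<Longrightarrow> B1 (cnj z) = cnj (B1 z)"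
    and nontriv: "\<And>z. Re z \<ge> 0 \<Longrightarrow> z \<noteq> 0 \<Longrightarrow> A z \<noteq> 0 \<or> A1 z \<noteq> 0" "\<And>z. Re z \<ge> 0 \<Longrightarrow> z \<noteq> 0 \<Longrightarrow> B z \<noteq> 0 \<or> B1 z \<noteq> 0"
    and asym: "\<exists>r>0. \<exists>C. \<forall>z. Re z \<ge> 0 \<longrightarrow> norm z \<ge> r \<longrightarrow> A z \<noteq> 0 \<and> B z \<noteq> 0 \<and> norm (- A1 z / A z - z) \<le> C \<and> norm (- B1 z / B z - z) \<le> C"
    and refl: "\<And>z. Re z = 0 \<Longrightarrow> z \<noteq> 0 \<Longrightarrow> B1 z * A (- z) + A1 (- z) * B z = 0"
    and generic_pair: "\<And>t. Re t > 0 \<Longrightarrow> Im t = 0 \<Longrightarrow> A1 t * B t + B1 t * A t = 0 \<Longrightarrow> A t \<noteq> 0 \<and> B t \<noteq> 0"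
begin

text \<open>Up to sign, the Wronskian at 0 of the right and the left Jost solution; the left one has
  data \<open>B, - B1\<close>.\<close>

definition W where "W z = - (A1 z * B z + B1 z * A z)"

text \<open>On the imaginary axis the two branches agree by \<open>refl\<close>. At a pole the value
  is the default 0 of division; holomorphy is asserted off the real axis only.\<close>

definition N where "N z = (if Re z \<le> 0 then A1 (- z) / A (- z) else - B1 z / B z)"

definition D where "D z = N z - N (- z)"

lemma nz: assumes "Re z \<ge> 0" "Im z \<noteq> 0" shows "A z \<noteq> 0" "B z \<noteq> 0"
proof -
  have up: "A z \<noteq> 0 \<and> B z \<noteq> 0" if "Re z \<ge> 0" "Im z > 0" for z using herg(1)[OF that] herg(2)[OF that] by auto
  have "z \<noteq> 0" using assms by auto
  show "A z \<noteq> 0" using up[of z] up[of "cnj z"] assms cnj(1)[OF assms(1) \<open>z \<noteq> 0\<close>] by (cases "Im z > 0") auto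
  show "B z \<noteq> 0" using up[of z] up[of "cnj z"] assms cnj(3)[OF assms(1) \<open>z \<noteq> 0\<close>] by (cases "Im z > 0") auto
qed

lemma N_pos: assumes "Im z > 0" shows "Im (N z) > 0"
proof (cases "Re z \<le> 0")
  case True
  let ?w = "- cnj z"
  have w: "Re ?w \<ge> 0" "Im ?w > 0" "?w \<noteq> 0" using assms True by auto
  have "N z = cnj (A1 ?w / A ?w)" using True cnj(1,2)[OF w(1,3)] by (simp add: N_def)
  then have "Im (N z) = Im (- A1 ?w * cnj (A ?w)) / (norm (A ?w))\<^sup>2" by (simp add: Im_divide_cnj flip: minus_divide_left)
  then show ?thesis using herg(1)[OF w(1,2)] nz[OF w(1)] w by simp
next
  case False
  then have "Im (N z) = Im (- B1 z * cnj (B z)) / (norm (B z))\<^sup>2" by (simp only: N_def Im_divide_cnj if_False)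
  then show ?thesis using herg(2)[of z] nz[of z] assms False by simp
qed

lemma N_cnj: assumes "z \<noteq> 0" shows "N (cnj z) = cnj (N z)"
  using assms cnj(1)[of "-z"] cnj(2)[of "-z"] cnj(3)[of z] cnj(4)[of z] by (auto simp: N_def)

lemma N_neg: "Im z < 0 \<Longrightarrow> Im (N z) < 0"
  using N_pos[of "cnj z"] N_cnj[of z] by (cases "z = 0") auto

text \<open>Two holomorphic branches that meet continuously along a line form one holomorphic
  function. The reflectionless condition enters as continuity across the imaginary axis.\<close>

lemma N_hol: "N holomorphic_on {z. Im z \<noteq> 0}"
proof (rule holomorphic_on_paste_across_line[where d = 1 and k = 0])
  let ?S = "{z. Im z \<noteq> 0}"
  show "open ?S" by (rule open_nonreal)
  have neg: "(\<lambda>z. F (- z)) holomorphic_on ?S \<inter> {z. 1 \<bullet> z < 0}" if "F holomorphic_on right_half" for F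
    by (rule holomorphic_on_reflect[OF that]) (simp add: inner_complex_def)
  have "(\<lambda>z. A1 (- z) / A (- z)) holomorphic_on ?S \<inter> {z. 1 \<bullet> z < 0}"
    by (intro holomorphic_intros neg hol) (auto simp: inner_complex_def nz)
  then show "N holomorphic_on ?S \<inter> {z. 1 \<bullet> z < 0}"
    by (rule holomorphic_transform) (auto simp: N_def inner_complex_def)
  have "(\<lambda>z. - B1 z / B z) holomorphic_on ?S \<inter> {z. 0 < 1 \<bullet> z}"
    by (intro holomorphic_intros holomorphic_on_subset[OF hol(3)] holomorphic_on_subset[OF hol(4)]) (auto simp: inner_complex_def nz)
  then show "N holomorphic_on ?S \<inter> {z. 0 < 1 \<bullet> z}"
    by (rule holomorphic_transform) (auto simp: N_def inner_complex_def)
  have negc: "continuous_on {z \<in> ?S. Re z \<le> 0} (\<lambda>z. F (- z))" if "continuous_on {z. Re z \<ge> 0 \<and> z \<noteq> 0} F" for F :: "complex \<Rightarrow> complex"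
    by (rule continuous_on_compose2[OF that]) (auto intro!: continuous_intros)
  show "continuous_on ?S N"
    unfolding N_def
  proof (rule continuous_on_cases_le)
    show "continuous_on {z \<in> ?S. Re z \<le> 0} (\<lambda>z. A1 (- z) / A (- z))"
      by (intro continuous_intros negc cont) (auto simp: nz)
    show "continuous_on {z \<in> ?S. 0 \<le> Re z} (\<lambda>z. - B1 z / B z)"
      by (intro continuous_intros continuous_on_subset[OF cont(3)] continuous_on_subset[OF cont(4)]) (auto simp: nz)
    show "continuous_on ?S Re" by (intro continuous_intros)
    fix z assume z: "z \<in> ?S" "Re z = 0"
    have "z \<noteq> 0" using z by auto
    from refl[OF z(2) this] show "A1 (- z) / A (- z) = - B1 z / B z"
      using nz[of z] nz[of "-z"] z by (simp add: field_simps eq_neg_iff_add_eq_0)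
  qed
qed auto

lemma N_asym: obtains r C where "r > 0" "\<And>z. norm z \<ge> r \<Longrightarrow> norm (N z - z) \<le> C"
proof -
  obtain r C where r: "r > 0" and *: "\<And>z. Re z \<ge> 0 \<Longrightarrow> norm z \<ge> r \<Longrightarrow> norm (- A1 z / A z - z) \<le> C \<and> norm (- B1 z / B z - z) \<le> C"
    using asym by blast
  have "norm (N z - z) \<le> C" if "norm z \<ge> r" for z
  proof (cases "Re z \<le> 0")
    case True
    have "N z - z = - (- A1 (- z) / A (- z) - (- z))" using True by (simp add: N_def)
    then show ?thesis using *[of "-z"] True that by (simp only: norm_minus_cancel) simp
  next
    case False
    then show ?thesis using *[of z] that by (simp add: N_def)
  qed
  then show thesis using r that by blast
qed

lemma D_odd: "D (- z) = - D z" by (simp add: D_def)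

lemma D_pos: "Im z > 0 \<Longrightarrow> Im (D z) > 0"
  using N_pos[of z] N_neg[of "-z"] by (simp add: D_def)

lemma D_nonzero: "Im z \<noteq> 0 \<Longrightarrow> D z \<noteq> 0"
  using D_pos[of z] D_pos[of "-z"] by (auto simp: D_odd) (metis D_odd D_pos less_irrefl linorder_neqE_linordered_idom neg_0_less_iff_less uminus_complex.sel(2) zero_complex.sel(2) neg_equal_0_iff_equal)

lemma D_hol: "D holomorphic_on {z. Im z \<noteq> 0}"
proof -
  have "(\<lambda>z. N (- z)) holomorphic_on {z. Im z \<noteq> 0}"
    by (rule holomorphic_on_reflect[OF N_hol]) simp
  then show ?thesis unfolding D_def[abs_def] by (intro holomorphic_intros N_hol)
qed

lemma D_asym: obtains r C where "r > 0" "\<And>z. norm z \<ge> r \<Longrightarrow> norm (D z - 2 * z) \<le> C"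
proof -
  obtain r C where r: "r > 0" "\<And>z. norm z \<ge> r \<Longrightarrow> norm (N z - z) \<le> C" using N_asym by blast
  have "norm (D z - 2 * z) \<le> 2 * C" if "norm z \<ge> r" for z
  proof -
    have "D z - 2 * z = (N z - z) - (N (- z) - (- z))" by (simp add: D_def)
    then show ?thesis using norm_triangle_ineq4[of "N z - z" "N (- z) - (- z)"] r(2)[of z] r(2)[of "-z"] that by simp
  qed
  then show thesis using that r by blast
qed

lemma D_right: "Re z > 0 \<Longrightarrow> D z = - B1 z / B z - A1 z / A z" by (simp add: D_def N_def)

lemma D_eq_W: "Re z > 0 \<Longrightarrow> A z \<noteq> 0 \<Longrightarrow> B z \<noteq> 0 \<Longrightarrow> D z = W z / (A z * B z)"
  by (simp add: D_right W_def field_simps)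

lemma W_hol: "W holomorphic_on right_half" unfolding W_def[abs_def] by (intro holomorphic_intros hol)

lemma W_nonzero: "Re z > 0 \<Longrightarrow> Im z \<noteq> 0 \<Longrightarrow> W z \<noteq> 0"
  using D_eq_W[of z] D_nonzero[of z] nz[of z] by auto

text \<open>Genericity enters here: the numerator of \<open>D = W / (A * B)\<close> cancels none of
  its poles.\<close>

lemma W_nonzero_at_pole: "Re t > 0 \<Longrightarrow> A t = 0 \<or> B t = 0 \<Longrightarrow> W t \<noteq> 0"
  using generic_pair[of t] W_nonzero[of t] by (cases "Im t = 0") (auto simp: W_def)

lemma A_simple: "Re t > 0 \<Longrightarrow> A t = 0 \<Longrightarrow> deriv A t \<noteq> 0"
  using herglotz_pair_zero_simple[OF hol(1,2) herg(1), of t] nz(1)[of t] nontriv(1)[of t] by force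

lemma B_simple: "Re t > 0 \<Longrightarrow> B t = 0 \<Longrightarrow> deriv B t \<noteq> 0"
  using herglotz_pair_zero_simple[OF hol(3,4) herg(2), of t] nz(2)[of t] nontriv(2)[of t] by force

text \<open>Near a zero of \<open>W\<close> neither \<open>A\<close> nor \<open>B\<close> vanishes,
  so \<open>W\<close> has there the same order as the Herglotz function \<open>D\<close>, which is
  1.\<close>

lemma W_simple: assumes t: "Re t > 0" "W t = 0" shows "deriv W t \<noteq> 0"
proof -
  let ?S = "{z \<in> right_half. A z * B z \<noteq> 0}"
  have AB: "(\<lambda>z. A z * B z) holomorphic_on right_half" by (intro holomorphic_intros hol)
  have op: "open ?S" by (rule open_nonzero_set[OF AB open_right_half])
  have h: "W holomorphic_on ?S" "(\<lambda>z. A z * B z) holomorphic_on ?S"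
    using holomorphic_on_subset[OF W_hol, of ?S] holomorphic_on_subset[OF AB, of ?S] by auto
  have tS: "Im t = 0" "t \<in> ?S" using t W_nonzero[of t] W_nonzero_at_pole[of t] by auto
  have "deriv (\<lambda>z. W z / (A z * B z)) t \<noteq> 0"
  proof (rule herglotz_zero_simple[OF _ op tS])
    show "(\<lambda>z. W z / (A z * B z)) holomorphic_on ?S" by (intro holomorphic_on_divide h) auto
    show "0 < Im (W z / (A z * B z))" if "z \<in> ?S" "0 < Im z" for z
      using that D_pos[of z] D_eq_W[of z] by auto
  qed (use t in auto)
  then show ?thesis using deriv_divide_at_zero[OF h op tS(2)] t tS by auto
qed

end

section \<open>Two potentials with the same zeros\<close>

locale two_weyl_pairs = P: weyl_pair A A1 B B1 + Q: weyl_pair a a1 b b1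
  for A A1 B B1 a a1 b b1 +
  assumes zA: "\<And>t. Re t > 0 \<Longrightarrow> Im t = 0 \<Longrightarrow> A t = 0 \<longleftrightarrow> a t = 0"
    and zB: "\<And>t. Re t > 0 \<Longrightarrow> Im t = 0 \<Longrightarrow> B t = 0 \<longleftrightarrow> b t = 0"
    and zW: "\<And>t. Re t > 0 \<Longrightarrow> Im t = 0 \<Longrightarrow> P.W t = 0 \<longleftrightarrow> Q.W t = 0"
begin

lemma A_zero_iff: "Re t > 0 \<Longrightarrow> A t = 0 \<longleftrightarrow> a t = 0" and B_zero_iff: "Re t > 0 \<Longrightarrow> B t = 0 \<longleftrightarrow> b t = 0"
  and W_zero_iff: "Re t > 0 \<Longrightarrow> P.W t = 0 \<longleftrightarrow> Q.W t = 0"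
  using zA[of t] zB[of t] zW[of t] P.nz[of t] Q.nz[of t] P.W_nonzero[of t] Q.W_nonzero[of t] by (cases "Im t = 0"; force)+

lemma swapped: "two_weyl_pairs a a1 b b1 A A1 B B1"
  by unfold_locales (use zA zB zW in auto)

text \<open>Since \<open>D = W / (A * B)\<close>, the quotient of the two functions \<open>D\<close>
  is \<open>X / Y\<close>, with numerator and denominator holomorphic on the whole
  half-plane.\<close>

definition X where "X z = P.W z * (a z * b z)"
definition Y where "Y z = Q.W z * (A z * B z)"

lemma X_hol: "X holomorphic_on right_half" and Y_hol: "Y holomorphic_on right_half"
  unfolding X_def[abs_def] Y_def[abs_def] by (intro holomorphic_intros P.W_hol Q.W_hol P.hol Q.hol)+

text \<open>Exactly one of the three factors vanishes, and simply: the zeros of \<open>P.W\<close>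
  are those of \<open>Q.W\<close>, where genericity keeps \<open>a\<close> and \<open>b\<close> from
  vanishing, and a common zero of \<open>a\<close> and \<open>b\<close> would be a zero of
  \<open>Q.W\<close>.\<close>

lemma X_simple: assumes t: "Re t > 0" "X t = 0" shows "deriv X t \<noteq> 0"
proof -
  note h = P.W_hol Q.hol(1) Q.hol(3)
  have tR: "t \<in> right_half" using t by simp
  consider "P.W t = 0" "a t \<noteq> 0" "b t \<noteq> 0" | "P.W t \<noteq> 0" "a t = 0" "b t \<noteq> 0" | "P.W t \<noteq> 0" "a t \<noteq> 0" "b t = 0"
    using t P.W_nonzero_at_pole[of t] Q.W_nonzero_at_pole[of t] A_zero_iff B_zero_iff W_zero_iff by (auto simp: X_def Q.W_def)
  then show ?thesis
  proof cases
    case 1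
    have "deriv X t = deriv P.W t * (a t * b t)"
      unfolding X_def[abs_def] by (intro deriv_mult_at_zero[OF _ _ open_right_half tR] holomorphic_intros h 1)
    then show ?thesis using P.W_simple[OF t(1)] 1 by simp
  next
    case 2
    have "X = (\<lambda>z. a z * (P.W z * b z))" by (auto simp: X_def)
    then have "deriv X t = deriv a t * (P.W t * b t)"
      using deriv_mult_at_zero[OF h(2) _ open_right_half tR, of "\<lambda>z. P.W z * b z"] 2 holomorphic_on_mult[OF h(1,3)] by simp
    then show ?thesis using Q.A_simple[OF t(1)] 2 by simp
  next
    case 3
    have "X = (\<lambda>z. b z * (P.W z * a z))" by (auto simp: X_def)
    then have "deriv X t = deriv b t * (P.W t * a t)"
      using deriv_mult_at_zero[OF h(3) _ open_right_half tR, of "\<lambda>z. P.W z * a z"] 3 holomorphic_on_mult[OF h(1,2)] by simp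
    then show ?thesis using Q.B_simple[OF t(1)] 3 by simp
  qed
qed

lemma Y_simple: "Re t > 0 \<Longrightarrow> Y t = 0 \<Longrightarrow> deriv Y t \<noteq> 0"
proof -
  interpret S: two_weyl_pairs a a1 b b1 A A1 B B1 by (rule swapped)
  have "S.X = Y" by (simp add: S.X_def[abs_def] Y_def[abs_def])
  then show "Re t > 0 \<Longrightarrow> Y t = 0 \<Longrightarrow> deriv Y t \<noteq> 0" using S.X_simple by metis
qed

definition R where "R = simple_quotient X Y"

lemma XY_zero: "Re t > 0 \<Longrightarrow> X t = 0 \<longleftrightarrow> Y t = 0"
  using A_zero_iff[of t] B_zero_iff[of t] W_zero_iff[of t] by (auto simp: X_def Y_def)

lemma R_hol: "R holomorphic_on right_half" and R_nonzero: "Re z > 0 \<Longrightarrow> R z \<noteq> 0"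
  unfolding R_def using simple_quotient[OF X_hol Y_hol open_right_half] XY_zero X_simple Y_simple by auto

lemma R_eq: "Re z > 0 \<Longrightarrow> Y z \<noteq> 0 \<Longrightarrow> R z = P.D z / Q.D z"
proof -
  assume z: "Re z > 0" "Y z \<noteq> 0"
  then have n: "A z \<noteq> 0" "B z \<noteq> 0" "Q.W z \<noteq> 0" by (auto simp: Y_def)
  then have "a z \<noteq> 0" "b z \<noteq> 0" using A_zero_iff B_zero_iff z by auto
  then show "R z = P.D z / Q.D z"
    using z n by (simp add: R_def simple_quotient_def P.D_eq_W Q.D_eq_W X_def Y_def)
qed

lemma R_eq_nonreal: "Re z > 0 \<Longrightarrow> Im z \<noteq> 0 \<Longrightarrow> R z = P.D z / Q.D z"
  using P.nz[of z] Q.W_nonzero[of z] by (intro R_eq) (auto simp: Y_def)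

section \<open>The quotient of the odd Herglotz functions\<close>

definition G where "G z = (if Re z > 0 then R z else if Re z < 0 then R (- z) else P.D z / Q.D z)"

lemma G_nonreal: "Im z \<noteq> 0 \<Longrightarrow> G z = P.D z / Q.D z"
  using R_eq_nonreal[of z] R_eq_nonreal[of "-z"] by (auto simp: G_def P.D_odd Q.D_odd)

lemma G_even: "z \<noteq> 0 \<Longrightarrow> G (- z) = G z" by (auto simp: G_def P.D_odd Q.D_odd)

lemma glue_holomorphic:
  assumes "F holomorphic_on right_half" "F holomorphic_on {z. Re z < 0}" "F holomorphic_on {z. Im z \<noteq> 0}"
  shows "F holomorphic_on - {0}"
proof -
  have "F holomorphic_on (right_half \<union> {z. Re z < 0}) \<union> {z. Im z \<noteq> 0}"
    using assms by (intro holomorphic_on_Un open_Un open_right_half open_nonreal open_halfspace_Re_lt)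
  moreover have "- {0} \<subseteq> (right_half \<union> {z. Re z < 0}) \<union> {z. Im z \<noteq> 0}" by (auto simp: complex_eq_iff)
  ultimately show ?thesis by (rule holomorphic_on_subset)
qed

lemma left_holomorphic:
  assumes "F holomorphic_on right_half" shows "(\<lambda>z. F (- z)) holomorphic_on {z. Re z < 0}"
  by (rule holomorphic_on_reflect[OF assms]) simp

lemma G_hol: "G holomorphic_on - {0}"
proof (rule glue_holomorphic)
  show "G holomorphic_on right_half" by (rule holomorphic_transform[OF R_hol]) (auto simp: G_def)
  show "G holomorphic_on {z. Re z < 0}" by (rule holomorphic_transform[OF left_holomorphic[OF R_hol]]) (auto simp: G_def)
  have "(\<lambda>z. P.D z / Q.D z) holomorphic_on {z. Im z \<noteq> 0}" by (intro holomorphic_intros P.D_hol Q.D_hol) (auto simp: Q.D_nonzero)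
  then show "G holomorphic_on {z. Im z \<noteq> 0}" by (rule holomorphic_transform) (auto simp: G_nonreal)
qed

lemma G_lim: "(G \<longlongrightarrow> 1) at_infinity"
proof -
  obtain r1 C1 where 1: "r1 > 0" "\<And>z. norm z \<ge> r1 \<Longrightarrow> norm (P.D z - 2 * z) \<le> C1" using P.D_asym by blast
  obtain r2 C2 where 2: "r2 > 0" "\<And>z. norm z \<ge> r2 \<Longrightarrow> norm (Q.D z - 2 * z) \<le> C2" using Q.D_asym by blast
  obtain r3 where 3: "r3 > 0" "\<And>z. Re z \<ge> 0 \<Longrightarrow> norm z \<ge> r3 \<Longrightarrow> A z \<noteq> 0 \<and> B z \<noteq> 0" using P.asym by blast
  \<comment> \<open>Beyond \<open>C2 + 1\<close>, the estimate
    \<open>norm (Q.D z) \<ge> 2 * norm z - C2\<close> gives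
    \<open>norm (Q.D z) \<ge> norm z\<close>.\<close>
  let ?r = "max (max r1 r2) (max r3 (C2 + 1))"
  have bd: "Q.D z \<noteq> 0 \<and> norm (P.D z / Q.D z - 1) \<le> (C1 + C2) / norm z" if z: "norm z \<ge> ?r" for z
  proof -
    have C: "norm (P.D z - 2 * z) \<le> C1" "norm (Q.D z - 2 * z) \<le> C2" "norm z \<ge> C2 + 1" using 1 2 z by auto
    have z0: "norm z > 0" using z 1(1) by linarith
    have "2 * norm z - C2 \<le> norm (Q.D z)" using norm_triangle_ineq2[of "2 * z" "2 * z - Q.D z"] C
      by (simp add: norm_mult norm_minus_commute)
    then have q: "norm z \<le> norm (Q.D z)" using C by linarith
    then have Q0: "Q.D z \<noteq> 0" using z0 by auto
    have "P.D z / Q.D z - 1 = ((P.D z - 2 * z) - (Q.D z - 2 * z)) / Q.D z" using Q0 by (simp add: field_simps)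
    then have "norm (P.D z / Q.D z - 1) = norm ((P.D z - 2 * z) - (Q.D z - 2 * z)) / norm (Q.D z)" by (simp add: norm_divide)
    also have "\<dots> \<le> (C1 + C2) / norm z"
      using C q z0 norm_triangle_ineq4[of "P.D z - 2 * z" "Q.D z - 2 * z"]
        norm_ge_zero[of "P.D z - 2 * z"] norm_ge_zero[of "Q.D z - 2 * z"] by (intro frac_le; linarith)
    finally show ?thesis using Q0 by simp
  qed
  have Geq: "G z = P.D z / Q.D z" if z: "norm z \<ge> ?r" for z
  proof -
    have R: "R w = P.D w / Q.D w" if w: "Re w > 0" "norm w \<ge> ?r" for w
    proof (rule R_eq[OF w(1)])
      have "A w \<noteq> 0" "B w \<noteq> 0" using 3 w by auto
      moreover from this have "a w \<noteq> 0" "b w \<noteq> 0" using A_zero_iff B_zero_iff w by auto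
      moreover have "Q.D w \<noteq> 0" using bd w by auto
      ultimately show "Y w \<noteq> 0" using Q.D_eq_W[OF w(1)] by (auto simp: Y_def)
    qed
    show ?thesis using R[of z] R[of "-z"] z by (auto simp: G_def P.D_odd Q.D_odd)
  qed
  have "((\<lambda>z. G z - 1) \<longlongrightarrow> 0) at_infinity"
  proof (rule Lim_null_comparison)
    show "\<forall>\<^sub>F z in at_infinity. norm (G z - 1) \<le> (C1 + C2) / norm z"
      unfolding eventually_at_infinity using Geq bd by (intro exI[of _ ?r]) auto
    show "((\<lambda>z. (C1 + C2) / norm z) \<longlongrightarrow> 0) (at_infinity :: complex filter)"
      by (rule tendsto_divide_0[OF tendsto_const]) (rule filterlim_at_top_imp_at_infinity[OF filterlim_norm_at_top])
  qed
  then show ?thesis by (rule LIM_zero_cancel)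
qed

text \<open>Symmetry under conjugation is read off \<open>P.D / Q.D\<close> away from the real axis.
  Approaching the point from above and from below carries it to the axis, where \<open>R\<close> may
  be a filled-in value.\<close>

lemma R_real: assumes t: "t > 0" shows "Im (R (of_real t)) = 0"
proof -
  let ?t = "complex_of_real t"
  have iR: "isCont R ?t"
    using holomorphic_on_imp_continuous_on[OF R_hol] t open_right_half by (simp add: continuous_on_eq_continuous_at)
  have seq: "(\<lambda>n. ?t + complex_of_real (1 / real (Suc n)) * \<i>) \<longlonglongrightarrow> ?t + complex_of_real 0 * \<i>"
    by (intro tendsto_intros LIMSEQ_Suc[OF lim_1_over_n, THEN tendsto_of_real])
  have seq': "(\<lambda>n. ?t - complex_of_real (1 / real (Suc n)) * \<i>) \<longlonglongrightarrow> ?t - complex_of_real 0 * \<i>"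
    by (intro tendsto_intros LIMSEQ_Suc[OF lim_1_over_n, THEN tendsto_of_real])
  have l1: "(\<lambda>n. R (?t + complex_of_real (1 / real (Suc n)) * \<i>)) \<longlonglongrightarrow> R ?t"
    by (rule isCont_tendsto_compose[OF iR]) (use seq in simp)
  have l2: "(\<lambda>n. R (?t - complex_of_real (1 / real (Suc n)) * \<i>)) \<longlonglongrightarrow> R ?t"
    by (rule isCont_tendsto_compose[OF iR]) (use seq' in simp)
  have Rc: "R (cnj z) = cnj (R z)" if "Re z > 0" "Im z \<noteq> 0" for z
  proof -
    have "z \<noteq> 0" "- z \<noteq> 0" using that by auto
    then have "P.D (cnj z) = cnj (P.D z)" "Q.D (cnj z) = cnj (Q.D z)"
      using P.N_cnj[of z] P.N_cnj[of "-z"] Q.N_cnj[of z] Q.N_cnj[of "-z"] by (auto simp: P.D_def Q.D_def)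
    then show ?thesis using R_eq_nonreal[of z] R_eq_nonreal[of "cnj z"] that by simp
  qed
  have "R (?t - complex_of_real (1 / real (Suc n)) * \<i>) = cnj (R (?t + complex_of_real (1 / real (Suc n)) * \<i>))" for n
  proof -
    have "?t - complex_of_real (1 / real (Suc n)) * \<i> = cnj (?t + complex_of_real (1 / real (Suc n)) * \<i>)" by simp
    moreover have "Re (?t + complex_of_real (1 / real (Suc n)) * \<i>) > 0" "Im (?t + complex_of_real (1 / real (Suc n)) * \<i>) \<noteq> 0"
      using t by (auto simp del: of_nat_Suc)
    ultimately show ?thesis using Rc by metis
  qed
  then have "(\<lambda>n. cnj (R (?t + complex_of_real (1 / real (Suc n)) * \<i>))) \<longlonglongrightarrow> R ?t" using l2 by simp
  moreover have "(\<lambda>n. cnj (R (?t + complex_of_real (1 / real (Suc n)) * \<i>))) \<longlonglongrightarrow> cnj (R ?t)" by (intro tendsto_intros l1)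
  ultimately have "R ?t = cnj (R ?t)" by (rule LIMSEQ_unique)
  then show ?thesis by (simp add: complex_eq_iff)
qed

text \<open>On the positive axis \<open>R\<close> is real, continuous and free of zeros, and it
  tends to 1; by intermediate values it keeps the sign of 1.\<close>

lemma R_positive: assumes t: "t > 0" shows "Re (R (of_real t)) > 0"
proof (rule ccontr)
  assume neg: "\<not> ?thesis"
  have ne: "Re (R (of_real s)) \<noteq> 0" if "s > 0" for s
    using R_nonzero[of "of_real s"] R_real[OF that] that by (auto simp: complex_eq_iff)
  have c: "continuous_on {t..m} (\<lambda>s. Re (R (of_real s)))" for m
  proof -
    have "continuous_on {t..m} (\<lambda>s. R (of_real s))"
      by (rule continuous_on_compose2[OF holomorphic_on_imp_continuous_on[OF R_hol]]) (use t in \<open>auto intro!: continuous_intros\<close>)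
    then show ?thesis by (intro continuous_intros)
  qed
  have "\<forall>\<^sub>F z in at_infinity. dist (G z) 1 < 1" using G_lim by (rule tendstoD) simp
  then obtain r where r: "\<And>z. norm z \<ge> r \<Longrightarrow> dist (G z) 1 < 1" unfolding eventually_at_infinity by blast
  define m where "m = max t \<bar>r\<bar>"
  have "t \<le> m" by (simp add: m_def)
  have "dist (G (of_real m)) 1 < 1" by (rule r) (auto simp: m_def)
  moreover have "m > 0" using t by (simp add: m_def)
  then have "G (of_real m) = R (of_real m)" by (simp add: G_def)
  ultimately have "Re (R (of_real m)) > 0"
    using abs_Re_le_cmod[of "R (of_real m) - 1"] by (simp add: dist_norm)
  moreover have "Re (R (of_real t)) \<le> 0" using neg by simp
  ultimately obtain s where "t \<le> s" "s \<le> m" "Re (R (of_real s)) = 0"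
    using IVT'[of "\<lambda>s. Re (R (of_real s))" t 0 m, OF _ _ _ c] \<open>t \<le> m\<close> by auto
  then show False using ne[of s] t by simp
qed

text \<open>In the upper half-plane a nonpositive value of \<open>G\<close> would make
  \<open>P.D\<close> a nonpositive multiple of \<open>Q.D\<close>, although both have positive
  imaginary part. The positive axis is \<open>R_positive\<close>, and evenness covers the
  rest.\<close>

lemma G_slit: assumes "z \<noteq> 0" shows "G z \<notin> \<real>\<^sub>\<le>\<^sub>0"
proof -
  have up: "G z \<notin> \<real>\<^sub>\<le>\<^sub>0" if z: "Im z > 0" for z
  proof
    assume "G z \<in> \<real>\<^sub>\<le>\<^sub>0"
    then have G: "Re (G z) \<le> 0" "Im (G z) = 0" by (auto simp: complex_nonpos_Reals_iff)
    have "P.D z = G z * Q.D z" using G_nonreal[of z] Q.D_nonzero[of z] z by simp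
    then have "Im (P.D z) = Re (G z) * Im (Q.D z)" using G by simp
    also have "\<dots> \<le> 0" using G Q.D_pos[OF z] by (intro mult_nonpos_nonneg) auto
    finally show False using P.D_pos[OF z] by simp
  qed
  have re: "G z \<notin> \<real>\<^sub>\<le>\<^sub>0" if z: "Im z = 0" "Re z > 0" for z
  proof -
    have "z = of_real (Re z)" using z by (simp add: complex_eq_iff)
    then have "Re (G z) > 0" using R_positive[of "Re z"] z by (simp add: G_def)
    then show ?thesis by (simp add: complex_nonpos_Reals_iff)
  qed
  consider "Im z > 0" | "Im (- z) > 0" | "Im z = 0" "Re z > 0" | "Im (- z) = 0" "Re (- z) > 0"
    using assms by (fastforce simp: complex_eq_iff)
  then show ?thesis using up[of z] up[of "-z"] re[of z] re[of "-z"] G_even[OF assms] by cases auto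
qed

lemma G_eq_1: "z \<noteq> 0 \<Longrightarrow> G z = 1" by (rule slit_valued_constant[OF G_hol G_slit G_lim])

lemma D_eq: "Im z \<noteq> 0 \<Longrightarrow> P.D z = Q.D z"
  using G_eq_1[of z] G_nonreal[of z] Q.D_nonzero[of z] by (cases "z = 0") auto

lemma D_eq_right:
  assumes z: "Re z > 0" and n: "A z \<noteq> 0" "B z \<noteq> 0"
  shows "P.D z = Q.D z"
proof -
  have "z \<noteq> 0" using z by auto
  then have R: "R z = 1" using G_eq_1[of z] z by (auto simp: G_def)
  have n': "a z \<noteq> 0" "b z \<noteq> 0" using A_zero_iff B_zero_iff z n by auto
  show ?thesis
  proof (cases "Y z = 0")
    case True
    then have "Q.W z = 0" using n by (simp add: Y_def)
    then have "P.W z = 0" using W_zero_iff z by simp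
    then show ?thesis using \<open>Q.W z = 0\<close> n n' z by (simp add: P.D_eq_W Q.D_eq_W)
  next
    case False
    then show ?thesis using R_eq[OF z False] R by auto
  qed
qed

section \<open>The difference of the Weyl functions\<close>

text \<open>The difference of the two functions \<open>N\<close> at \<open>z\<close> or, where
  \<open>B z = 0\<close>, at \<open>- z\<close>; the two agree because the functions
  \<open>D\<close> do. Genericity excludes \<open>A z = B z = 0\<close>, so at every point one of
  the formulas is free of poles.\<close>

definition e where "e z = (if B z \<noteq> 0 then - B1 z / B z + b1 z / b z else A1 z / A z - a1 z / a z)"

lemma e_eq: assumes "Re z > 0" shows "B z \<noteq> 0 \<Longrightarrow> e z = - B1 z / B z + b1 z / b z" "A z \<noteq> 0 \<Longrightarrow> e z = A1 z / A z - a1 z / a z"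
proof -
  show "B z \<noteq> 0 \<Longrightarrow> e z = - B1 z / B z + b1 z / b z" by (simp add: e_def)
  show "e z = A1 z / A z - a1 z / a z" if "A z \<noteq> 0"
  proof (cases "B z = 0")
    case False
    then have "- B1 z / B z - A1 z / A z = - b1 z / b z - a1 z / a z"
      using D_eq_right[OF assms that False] assms by (simp add: P.D_right Q.D_right)
    then show ?thesis using False by (simp add: e_def algebra_simps)
  qed (simp add: e_def)
qed

lemma e_hol: "e holomorphic_on right_half"
proof -
  let ?U = "{z \<in> right_half. B z \<noteq> 0}" and ?V = "{z \<in> right_half. A z \<noteq> 0}"
  note s = holomorphic_on_subset[OF P.hol(1)] holomorphic_on_subset[OF P.hol(2)] holomorphic_on_subset[OF P.hol(3)] holomorphic_on_subset[OF P.hol(4)]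
    holomorphic_on_subset[OF Q.hol(1)] holomorphic_on_subset[OF Q.hol(2)] holomorphic_on_subset[OF Q.hol(3)] holomorphic_on_subset[OF Q.hol(4)]
  have "(\<lambda>z. - B1 z / B z + b1 z / b z) holomorphic_on ?U" by (intro holomorphic_intros s) (auto simp: B_zero_iff)
  then have 1: "e holomorphic_on ?U" by (rule holomorphic_transform) (auto simp: e_eq)
  have "(\<lambda>z. A1 z / A z - a1 z / a z) holomorphic_on ?V" by (intro holomorphic_intros s) (auto simp: A_zero_iff)
  then have 2: "e holomorphic_on ?V" by (rule holomorphic_transform) (auto simp: e_eq)
  have "e holomorphic_on ?U \<union> ?V"
    using 1 2 by (intro holomorphic_on_Un open_nonzero_set[OF _ open_right_half] P.hol)
  moreover have "right_half \<subseteq> ?U \<union> ?V"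
  proof
    fix z assume "z \<in> right_half"
    then show "z \<in> ?U \<union> ?V" using P.W_nonzero_at_pole[of z] by (auto simp: P.W_def)
  qed
  ultimately show ?thesis by (rule holomorphic_on_subset)
qed

definition E where "E z = (if Re z > 0 then e z else if Re z < 0 then e (- z) else P.N z - Q.N z)"

lemma E_nonreal: assumes z: "Im z \<noteq> 0" shows "E z = P.N z - Q.N z"
proof -
  consider "Re z > 0" | "Re z < 0" | "Re z = 0" by linarith
  then show ?thesis
  proof cases
    case 1
    then show ?thesis using e_eq(1)[of z] P.nz[of z] z by (simp add: E_def P.N_def Q.N_def)
  next
    case 2
    then show ?thesis using e_eq(2)[of "-z"] P.nz[of "-z"] z by (simp add: E_def P.N_def Q.N_def)
  qed (simp add: E_def)
qed

lemma E_even: assumes "z \<noteq> 0" shows "E (- z) = E z"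
proof (cases "Re z = 0")
  case True
  then have "Im z \<noteq> 0" using assms by (auto simp: complex_eq_iff)
  then have "P.N z - P.N (- z) = Q.N z - Q.N (- z)" "E z = P.N z - Q.N z" "E (- z) = P.N (- z) - Q.N (- z)"
    using D_eq[of z] E_nonreal[of z] E_nonreal[of "-z"] by (simp_all add: P.D_def Q.D_def)
  then show ?thesis by algebra
qed (auto simp: E_def)

lemma E_hol: "E holomorphic_on - {0}"
proof (rule glue_holomorphic)
  show "E holomorphic_on right_half" by (rule holomorphic_transform[OF e_hol]) (auto simp: E_def)
  show "E holomorphic_on {z. Re z < 0}" by (rule holomorphic_transform[OF left_holomorphic[OF e_hol]]) (auto simp: E_def)
  have "(\<lambda>z. P.N z - Q.N z) holomorphic_on {z. Im z \<noteq> 0}" by (intro holomorphic_intros P.N_hol Q.N_hol)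
  then show "E holomorphic_on {z. Im z \<noteq> 0}" by (rule holomorphic_transform) (auto simp: E_nonreal)
qed

lemma E_constant: obtains c where "\<And>z. z \<noteq> 0 \<Longrightarrow> E z = c"
proof -
  obtain r1 C1 where 1: "r1 > 0" "\<And>z. norm z \<ge> r1 \<Longrightarrow> norm (P.N z - z) \<le> C1" using P.N_asym by blast
  obtain r2 C2 where 2: "r2 > 0" "\<And>z. norm z \<ge> r2 \<Longrightarrow> norm (Q.N z - z) \<le> C2" using Q.N_asym by blast
  obtain r3 where 3: "r3 > 0" "\<And>z. Re z \<ge> 0 \<Longrightarrow> norm z \<ge> r3 \<Longrightarrow> A z \<noteq> 0 \<and> B z \<noteq> 0" using P.asym by blast
  let ?r = "max r1 (max r2 r3)"
  let ?C = "4 * norm (P.N \<i>) + 4 * norm (Q.N \<i>)"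
  have EN: "E z = P.N z - Q.N z" if z: "norm z \<ge> ?r" for z
  proof -
    consider "Re z > 0" | "Re z < 0" | "Re z = 0" by linarith
    then show ?thesis
    proof cases
      case 1
      then show ?thesis using e_eq(1)[of z] 3(2)[of z] z by (simp add: E_def P.N_def Q.N_def)
    next
      case 2
      then show ?thesis using e_eq(2)[of "-z"] 3(2)[of "-z"] z by (simp add: E_def P.N_def Q.N_def)
    qed (simp add: E_def)
  qed
  have gr: "norm (E z) \<le> ?C / Im z" if z: "norm z \<le> 1" "Im z > 0" for z
  proof -
    have sub: "{z. Im z > 0} \<subseteq> {z. Im z \<noteq> 0}" by auto
    have "norm (P.N z) \<le> 4 * norm (P.N \<i>) / Im z"
      by (rule herglotz_growth[OF holomorphic_on_subset[OF P.N_hol sub] P.N_pos z(2,1)])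
    moreover have "norm (Q.N z) \<le> 4 * norm (Q.N \<i>) / Im z"
      by (rule herglotz_growth[OF holomorphic_on_subset[OF Q.N_hol sub] Q.N_pos z(2,1)])
    ultimately show ?thesis using E_nonreal[of z] z norm_triangle_ineq4[of "P.N z" "Q.N z"] by (simp add: add_divide_distrib)
  qed
  show thesis
  proof (rule even_punctured_constant[OF E_hol E_even])
    show "norm (E z) \<le> C1 + C2" if z: "?r \<le> norm z" for z
    proof -
      have "E z = (P.N z - z) - (Q.N z - z)" using EN[OF z] by simp
      then show ?thesis using norm_triangle_ineq4[of "P.N z - z" "Q.N z - z"] 1(2)[of z] 2(2)[of z] z by simp
    qed
    show "0 < ?r" using 1 by auto
    show "norm (E z) \<le> ?C / \<bar>Im z\<bar>" if z: "norm z \<le> 1" "Im z \<noteq> 0" for z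
    proof (cases "Im z > 0")
      case True then show ?thesis using gr[of z] z by simp
    next
      case False
      then have "norm (E (- z)) \<le> ?C / Im (- z)" using z by (intro gr) auto
      moreover have "E (- z) = E z" using z by (intro E_even) auto
      ultimately show ?thesis using False by simp
    qed
  next
    fix c assume "\<And>z. z \<noteq> 0 \<Longrightarrow> E z = c"
    then show thesis by (rule that)
  qed
qed

text \<open>Clearing denominators makes the relations holomorphic, so they pass from the nonreal
  points to the zeros of \<open>A\<close> and \<open>B\<close>. The signs differ because
  \<open>N\<close> is built from \<open>A1 / A\<close> on the left and from \<open>- B1 / B\<close>
  on the right.\<close>

lemma weyl_functions_differ_by_constant:
  obtains c where "\<And>z. Re z > 0 \<Longrightarrow> A1 z * a z - a1 z * A z = c * (A z * a z)"
    "\<And>z. Re z > 0 \<Longrightarrow> B1 z * b z - b1 z * B z = - c * (B z * b z)"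
proof -
  obtain c where c: "\<And>z. z \<noteq> 0 \<Longrightarrow> E z = c" using E_constant by blast
  have nr: "A1 z * a z - a1 z * A z = c * (A z * a z) \<and> B1 z * b z - b1 z * B z = - c * (B z * b z)"
    if z: "Re z > 0" "Im z \<noteq> 0" for z
  proof -
    have "z \<noteq> 0" using z by auto
    then have "e z = c" using c[of z] z by (simp add: E_def)
    moreover have "A z \<noteq> 0" "B z \<noteq> 0" "a z \<noteq> 0" "b z \<noteq> 0" using P.nz[of z] Q.nz[of z] z by auto
    ultimately show ?thesis using e_eq[OF z(1)] by (simp add: field_simps)
  qed
  have ext: "F z = 0" if F: "F holomorphic_on right_half" and 0: "\<And>z. Re z > 0 \<Longrightarrow> Im z \<noteq> 0 \<Longrightarrow> F z = 0" and z: "Re z > 0" for F z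
  proof (rule analytic_continuation_open[of "right_half \<inter> {z. Im z > 0}" right_half F "\<lambda>_. 0"])
    show "right_half \<inter> {z. Im z > 0} \<noteq> {}" by (rule ex_in_conv[THEN iffD1], rule exI[of _ "Complex 1 1"]) simp
    show "connected right_half" by (intro convex_connected convex_halfspace_Re_gt)
  qed (use F 0 z open_right_half open_upper_half in \<open>auto intro!: open_Int\<close>)
  show thesis
  proof (rule that)
    fix z :: complex assume z: "Re z > 0"
    have "(\<lambda>z. A1 z * a z - a1 z * A z - c * (A z * a z)) holomorphic_on right_half"
      by (intro holomorphic_intros P.hol Q.hol)
    from ext[OF this _ z] nr show "A1 z * a z - a1 z * A z = c * (A z * a z)" by simp
    have "(\<lambda>z. B1 z * b z - b1 z * B z + c * (B z * b z)) holomorphic_on right_half"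
      by (intro holomorphic_intros P.hol Q.hol)
    from ext[OF this _ z] nr show "B1 z * b z - b1 z * B z = - c * (B z * b z)" by (simp add: eq_neg_iff_add_eq_0)
  qed
qed

end

section \<open>Solutions on the line\<close>

abbreviation (input) reflect :: "(real \<Rightarrow> 'a) \<Rightarrow> real \<Rightarrow> 'a" where "reflect f \<equiv> \<lambda>x. f (- x)"

section \<open>Jost solutions on the imaginary axis\<close>

context half_line
begin

text \<open>For imaginary \<open>k\<close> both \<open>jost k\<close> and \<open>jost (- k)\<close>
  are available; their Wronskian is constant and is read off at infinity.\<close>

lemma wronskian_J:
  assumes k: "Re k = 0" "k \<noteq> 0" shows "J k * J1 (- k) - J1 k * J (- k) = 2 * k"
proof -
  have k': "Re k \<ge> 0" "Re (- k) \<ge> 0" "- k \<noteq> 0" using k by auto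
  let ?F = "\<lambda>x. (exp (k * complex_of_real x) * jost k x) * (exp (- k * complex_of_real x) * jost' (- k) x)
      - (exp (k * complex_of_real x) * jost' k x) * (exp (- k * complex_of_real x) * jost (- k) x)"
  have lim: "(?F \<longlongrightarrow> 1 * (- (- k)) - (- k) * 1) at_top"
    by (intro tendsto_intros jost_tendsto k' k)
  have s: "sol q (k\<^sup>2) (jost (- k)) (jost' (- k))" using sol_jost[of "-k"] by simp
  have "?F x = J k * J1 (- k) - J1 k * J (- k)" if x: "x \<ge> 0" for x
  proof -
    have gen: "(u * j) * (w * m) - (u * j') * (w * m') = (u * w) * (j * m - j' * m')" for u w j m j' m' :: complex
      by (simp add: algebra_simps)
    have "?F x = (exp (k * complex_of_real x) * exp (- k * complex_of_real x)) * (jost k x * jost' (- k) x - jost' k x * jost (- k) x)"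
      by (rule gen)
    also have "exp (k * complex_of_real x) * exp (- k * complex_of_real x) = 1" by (simp add: exp_minus)
    also have "jost k x * jost' (- k) x - jost' k x * jost (- k) x = J k * J1 (- k) - J1 k * J (- k)"
      using sol_wronskian[OF sol_jost s x] by (simp only: jost_0)
    finally show ?thesis by (simp only: mult_1)
  qed
  then have "\<forall>\<^sub>F x in at_top. ?F x = J k * J1 (- k) - J1 k * J (- k)"
    by (rule eventually_mono[OF eventually_ge_at_top[of "0::real"]])
  from tendsto_cong[THEN iffD1, OF this lim]
  have "((\<lambda>x::real. J k * J1 (- k) - J1 k * J (- k)) \<longlongrightarrow> 1 * (- (- k)) - (- k) * 1) at_top" .
  then show ?thesis by (simp add: tendsto_const_iff)
qed

text \<open>The solution is \<open>c1 * jost k + c2 * jost (- k)\<close>, and the normalization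
  makes \<open>c2 * exp (2 k x)\<close> converge to \<open>1 - c1\<close>. A shift by half a period
  flips its sign, so the limit is 0; since the exponential has modulus 1, also
  \<open>c2 = 0\<close>.\<close>

lemma jost_unique:
  assumes s: "sol q (k\<^sup>2) y v" and k: "Re k = 0" "k \<noteq> 0"
    and lim: "((\<lambda>x. exp (k * complex_of_real x) * y x) \<longlongrightarrow> 1) at_top"
  shows "y 0 = J k" "v 0 = J1 k"
proof -
  have k': "Re k \<ge> 0" "Re (- k) \<ge> 0" "- k \<noteq> 0" using k by auto
  define c1 where "c1 = (y 0 * J1 (- k) - v 0 * J (- k)) / (2 * k)"
  define c2 where "c2 = (v 0 * J k - y 0 * J1 k) / (2 * k)"
  have cc: "y 0 = c1 * J k + c2 * J (- k)" "v 0 = c1 * J1 k + c2 * J1 (- k)"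
  proof -
    have kc: "2 * k * c1 = y 0 * J1 (- k) - v 0 * J (- k)" "2 * k * c2 = v 0 * J k - y 0 * J1 k"
      using k by (simp_all add: c1_def c2_def)
    have "2 * k * (c1 * J k + c2 * J (- k)) = y 0 * (J k * J1 (- k) - J1 k * J (- k))"
      using kc by algebra
    then show "y 0 = c1 * J k + c2 * J (- k)" unfolding wronskian_J[OF k] using k by simp
    have "2 * k * (c1 * J1 k + c2 * J1 (- k)) = v 0 * (J k * J1 (- k) - J1 k * J (- k))"
      using kc by algebra
    then show "v 0 = c1 * J1 k + c2 * J1 (- k)" unfolding wronskian_J[OF k] using k by simp
  qed
  have s2: "sol q (k\<^sup>2) (jost (- k)) (jost' (- k))" using sol_jost[of "-k"] by simp
  have yx: "y x = c1 * jost k x + c2 * jost (- k) x" if "x \<ge> 0" for x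
    using sol_unique(1)[OF s sol_lincomb[OF sol_jost s2] _ _ that, of c1 c2] cc by (simp add: jost_0)
  let ?e = "\<lambda>x. exp (2 * k * complex_of_real x)"
  have e: "((\<lambda>x. c2 * ?e x) \<longlongrightarrow> (1 - c1 * 1) / 1) at_top"
  proof (rule Lim_transform_eventually)
    show "((\<lambda>x. (exp (k * complex_of_real x) * y x - c1 * (exp (k * complex_of_real x) * jost k x)) / (exp (- k * complex_of_real x) * jost (- k) x)) \<longlongrightarrow> (1 - c1 * 1) / 1) at_top"
      by (intro tendsto_intros lim jost_tendsto(1) k k') auto
    have "((\<lambda>x. exp (- k * complex_of_real x) * jost (- k) x) \<longlongrightarrow> 1) at_top" by (rule jost_tendsto[OF k'(2,3)])
    then have "\<forall>\<^sub>F x in at_top. exp (- k * complex_of_real x) * jost (- k) x \<noteq> 0"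
      by (rule tendsto_imp_eventually_ne) simp
    then show "\<forall>\<^sub>F x in at_top. (exp (k * complex_of_real x) * y x - c1 * (exp (k * complex_of_real x) * jost k x)) / (exp (- k * complex_of_real x) * jost (- k) x) = c2 * ?e x"
      using eventually_ge_at_top[of 0]
    proof eventually_elim
      case (elim x)
      have "?e x * exp (- k * complex_of_real x) = exp (k * complex_of_real x)" by (simp flip: exp_add add: algebra_simps)
      then have "c2 * ?e x * (exp (- k * complex_of_real x) * jost (- k) x) = c2 * (exp (k * complex_of_real x) * jost (- k) x)"
        by (metis mult.assoc)
      then show ?case using elim yx[OF elim(2)] by (simp add: divide_eq_eq) (auto simp: algebra_simps)
    qed
  qed
  have Imk: "Im k \<noteq> 0" using k by (auto simp: complex_eq_iff)
  \<comment> \<open>Half a period: \<open>2 * k * h\<close> equals \<open>\<i> * pi\<close>.\<close>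
  define h where "h = pi / (2 * Im k)"
  have eh: "?e (h + x) = - ?e x" for x
  proof -
    have "2 * k * complex_of_real h = \<i> * of_real pi" using k Imk by (simp add: h_def complex_eq_iff)
    moreover have "2 * k * complex_of_real (h + x) = 2 * k * complex_of_real x + 2 * k * complex_of_real h" by (simp add: distrib_left)
    ultimately show ?thesis by (simp add: exp_add)
  qed
  have "filterlim (\<lambda>x. h + x) at_top at_top" by (rule filterlim_tendsto_add_at_top[OF tendsto_const filterlim_ident])
  from filterlim_compose[OF e this] have "((\<lambda>x. - (c2 * ?e x)) \<longlongrightarrow> (1 - c1 * 1) / 1) at_top"
    by (simp only: eh mult_minus_right)
  from tendsto_unique[OF _ tendsto_minus[OF this] ] e have "- ((1 - c1 * 1) / 1) = (1 - c1 * 1) / 1" by simp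
  then have c1: "c1 = 1" by (simp add: eq_neg_iff_add_eq_0)
  have "((\<lambda>x. norm (c2 * ?e x)) \<longlongrightarrow> norm ((1 - c1 * 1) / 1)) at_top" by (rule tendsto_norm[OF e])
  then have "((\<lambda>x::real. norm c2) \<longlongrightarrow> 0) at_top" using k c1 by (simp add: norm_mult)
  then have "c2 = 0" by (simp add: tendsto_const_iff)
  then show "y 0 = J k" "v 0 = J1 k" using cc c1 by auto
qed

lemma J_herglotz_nonreal:
  assumes "Re k \<ge> 0" "Im k \<noteq> 0" shows "Im k * Im (- J1 k * cnj (J k)) > 0"
proof (cases "Im k > 0")
  case True then show ?thesis using J_herglotz[of k] assms by simp
next
  case False
  have k0: "k \<noteq> 0" using assms by auto
  have "Im (- J1 (cnj k) * cnj (J (cnj k))) > 0" using False assms by (intro J_herglotz) auto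
  moreover have "- J1 (cnj k) * cnj (J (cnj k)) = cnj (- J1 k * cnj (J k))" using J_cnj[OF assms(1) k0] by simp
  moreover have "Im (cnj w) = - Im w" for w by simp
  ultimately have "Im (- J1 k * cnj (J k)) < 0" by (metis neg_0_less_iff_less)
  then show ?thesis using False assms by (intro mult_neg_neg) auto
qed

lemma J_asym: "\<exists>r>0. \<exists>C. \<forall>z. Re z \<ge> 0 \<longrightarrow> norm z \<ge> r \<longrightarrow> J z \<noteq> 0 \<and> norm (- J1 z / J z - z) \<le> C"
proof -
  define T where "T = tail 0 * exp (2 * tail 0)"
  have t0: "tail 0 \<ge> 0" using tail_nonneg by simp
  have T: "T \<ge> 0" using t0 by (simp add: T_def)
  show ?thesis
  \<comment> \<open>\<open>norm z \<ge> 1 + 2 * T\<close> gives \<open>norm (J z) \<ge> 1/2\<close>.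
    The numerator \<open>(J1 z + z) + z * (J z - 1)\<close> is at most \<open>2 * T\<close>, hence
    \<open>4 * T\<close>.\<close>
  proof (rule exI[of _ "1 + 2 * T"], intro conjI exI[of _ "4 * T"] allI impI)
    show "0 < 1 + 2 * T" using T by simp
    fix z assume z: "Re z \<ge> 0" "1 + 2 * T \<le> norm z"
    have z1: "norm z \<ge> 1" "z \<noteq> 0" using z T by auto
    have "2 * tail 0 / norm z \<le> 2 * tail 0" using z1 t0 by (simp add: divide_le_eq mult_le_cancel_left1)
    then have ex: "exp (2 * tail 0 / norm z) \<le> exp (2 * tail 0)" by simp
    have "norm (J z - 1) \<le> tail 0 / norm z * exp (2 * tail 0 / norm z)" by (rule J_bounds[OF z(1) z1(2)])
    also have "\<dots> \<le> tail 0 / norm z * exp (2 * tail 0)" using ex t0 by (intro mult_left_mono) auto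
    finally have a: "norm (J z - 1) \<le> T / norm z" by (simp add: T_def)
    have "norm (J1 z + z) \<le> tail 0 * exp (2 * tail 0 / norm z)" by (rule J_bounds[OF z(1) z1(2)])
    also have "\<dots> \<le> T" unfolding T_def using ex t0 by (intro mult_left_mono) auto
    finally have b: "norm (J1 z + z) \<le> T" .
    have "T / norm z \<le> 1/2" using z z1 by (simp add: divide_le_eq)
    moreover have "1 - norm (J z - 1) \<le> norm (J z)" using norm_triangle_ineq2[of 1 "1 - J z"] by (simp add: norm_minus_commute)
    ultimately have J: "1/2 \<le> norm (J z)" using a by linarith
    then show "J z \<noteq> 0" by auto
    then have "- J1 z / J z - z = - ((J1 z + z) + z * (J z - 1)) / J z" by (simp add: field_simps)
    then have "norm (- J1 z / J z - z) = norm ((J1 z + z) + z * (J z - 1)) / norm (J z)" by (simp only: norm_divide norm_minus_cancel)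
    also have "\<dots> \<le> (2 * T) / (1/2)"
    proof (intro frac_le)
      have "norm z * norm (J z - 1) \<le> norm z * (T / norm z)" by (intro mult_left_mono a) auto
      then have "norm (z * (J z - 1)) \<le> T" using z1 by (simp add: norm_mult)
      then show "norm ((J1 z + z) + z * (J z - 1)) \<le> 2 * T" using b norm_triangle_ineq[of "J1 z + z" "z * (J z - 1)"] by linarith
    qed (use J T in auto)
    finally show "norm (- J1 z / J z - z) \<le> 4 * T" by simp
  qed
qed

end

section \<open>From the half-lines to the line\<close>

definition fullsol :: "(real \<Rightarrow> real) \<Rightarrow> complex \<Rightarrow> (real \<Rightarrow> complex) \<Rightarrow> (real \<Rightarrow> complex) \<Rightarrow> bool" where
  "fullsol q s y v \<longleftrightarrow> loc_AC UNIV y v \<and> loc_AC UNIV v (\<lambda>x. (complex_of_real (q x) + s) * y x)"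

lemma sol_reflectI:
  assumes "loc_AC {..0} y v" "loc_AC {..0} v (\<lambda>x. (complex_of_real (q x) + s) * y x)"
  shows "sol (reflect q) s (reflect y) (\<lambda>x. - v (- x))"
  using loc_AC_reflect[OF assms(1)] loc_AC_cmult[OF loc_AC_reflect[OF assms(2)], of "-1"] by (simp add: sol_def)

lemma sol_reflectD:
  assumes "sol (reflect q) s (reflect y) (\<lambda>x. - v (- x))"
  shows "loc_AC {..0} y v" "loc_AC {..0} v (\<lambda>x. (complex_of_real (q x) + s) * y x)"
  using loc_AC_reflect[of "{0..}" "reflect y" "\<lambda>x. - v (- x)"]
    loc_AC_cmult[OF loc_AC_reflect[of "{0..}" "\<lambda>x. - v (- x)" "\<lambda>x. (complex_of_real (q (- x)) + s) * y (- x)"], of "-1"] assms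
  by (simp_all add: sol_def)

lemma fullsol_iff: "fullsol q s y v \<longleftrightarrow> sol q s y v \<and> sol (reflect q) s (reflect y) (\<lambda>x. - v (- x))"
proof
  assume "fullsol q s y v"
  then show "sol q s y v \<and> sol (reflect q) s (reflect y) (\<lambda>x. - v (- x))"
    by (auto simp: fullsol_def sol_def[of q] intro!: sol_reflectI elim: loc_AC_subset)
next
  assume "sol q s y v \<and> sol (reflect q) s (reflect y) (\<lambda>x. - v (- x))"
  then show "fullsol q s y v" using sol_reflectD[of q s y v] by (auto simp: fullsol_def sol_def[of q] intro!: loc_AC_Un)
qed

text \<open>The operators provide the second derivative almost everywhere only; redefining it on a
  null set gives the pointwise form required by \<open>sol\<close> and
  \<open>fullsol\<close>.\<close>

lemma schrodinger_eqD:
  assumes s: "schrodinger_eq q I y g" and g: "AE x in lebesgue_on I. g x = - s * y x"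
    and I: "is_interval I" "I \<in> sets lebesgue"
  obtains v where "loc_AC I y v" "loc_AC I v (\<lambda>x. (complex_of_real (q x) + s) * y x)"
proof -
  obtain v w where v: "loc_AC I y v" "loc_AC I v w" "AE x in lebesgue_on I. - w x + complex_of_real (q x) * y x = g x"
    using s by (auto simp: schrodinger_eq_def)
  have "AE x in lebesgue_on I. w x = (complex_of_real (q x) + s) * y x"
    using v(3) g
  proof eventually_elim
    case (elim x)
    then have "- w x + complex_of_real (q x) * y x = - s * y x" by simp
    then show ?case by algebra
  qed
  from loc_AC_cong[OF v(2) refl this I] show thesis using that v(1) by blast
qed

lemma schrodinger_eqI:
  assumes "loc_AC I y v" "loc_AC I v (\<lambda>x. (complex_of_real (q x) + s) * y x)"
  shows "schrodinger_eq q I y (\<lambda>x. - s * y x)"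
  unfolding schrodinger_eq_def
  by (intro exI conjI, rule assms(1), rule assms(2)) (simp add: algebra_simps)

lemma schrodinger_eq_fullsol: "schrodinger_eq q UNIV y (\<lambda>x. - s * y x) \<longleftrightarrow> (\<exists>v. fullsol q s y v)"
  using schrodinger_eqD[of q UNIV y "\<lambda>x. - s * y x" s] schrodinger_eqI[of UNIV y _ q s]
  by (auto simp: fullsol_def)

section \<open>Square integrability and null sets\<close>

lemma continuous_L2_iff:
  fixes f :: "real \<Rightarrow> complex"
  assumes c: "continuous_on I f" and I: "I \<in> sets lebesgue"
  shows "f \<in> L2 I \<longleftrightarrow> (\<lambda>x. (norm (f x))\<^sup>2) integrable_on I"
proof
  assume "f \<in> L2 I" then show "(\<lambda>x. (norm (f x))\<^sup>2) integrable_on I"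
    using I by (auto simp: L2_def intro: integrable_on_lebesgue_on)
next
  assume i: "(\<lambda>x. (norm (f x))\<^sup>2) integrable_on I"
  have "f \<in> borel_measurable (lebesgue_on I)" by (rule continuous_imp_measurable_on_sets_lebesgue[OF c I])
  moreover have "(\<lambda>x. (norm (f x))\<^sup>2) absolutely_integrable_on I"
    by (rule nonnegative_absolutely_integrable_1[OF i]) simp
  ultimately show "f \<in> L2 I" using absolutely_integrable_imp_integrable[OF _ I] by (simp add: L2_def)
qed

lemma integrable_reflect_half:
  fixes f :: "real \<Rightarrow> real"
  assumes "\<And>x. f x \<ge> 0" shows "f integrable_on {..0} \<longleftrightarrow> reflect f integrable_on {0..}"
proof -
  have "reflect f absolutely_integrable_on {0..} \<longleftrightarrow> f absolutely_integrable_on {..0}"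
    using has_absolute_integral_reflect_real[of "{0..}" "{..0}" f] by auto
  then show ?thesis using absolutely_integrable_on_iff_nonneg[of "{..0}" f] absolutely_integrable_on_iff_nonneg[of "{0..}" "reflect f"] assms by simp
qed

lemma L2_UNIV_iff:
  assumes c: "continuous_on UNIV f"
  shows "f \<in> L2 UNIV \<longleftrightarrow> f \<in> L2 {0..} \<and> reflect f \<in> L2 {0..}"
proof -
  let ?g = "\<lambda>x. (norm (f x))\<^sup>2"
  have cr: "continuous_on {0..} (reflect f)" by (rule continuous_on_compose2[OF c]) (auto intro!: continuous_intros)
  have "?g integrable_on UNIV \<longleftrightarrow> ?g integrable_on {0..} \<and> ?g integrable_on {..0}"
  proof
    assume i: "?g integrable_on UNIV"
    then have "?g absolutely_integrable_on UNIV" by (intro nonnegative_absolutely_integrable_1) auto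
    then have "?g absolutely_integrable_on {0..}" "?g absolutely_integrable_on {..0}"
      by (auto intro: set_integrable_subset)
    then show "?g integrable_on {0..} \<and> ?g integrable_on {..0}" by (simp add: set_lebesgue_integral_eq_integral(1))
  next
    assume i: "?g integrable_on {0..} \<and> ?g integrable_on {..0}"
    have "{0..} \<inter> {..0} = {0::real}" "{0..} \<union> {..0} = (UNIV::real set)" by auto
    then show "?g integrable_on UNIV" using integrable_Un[of "{0..}" "{..0}" ?g] i by simp
  qed
  then show ?thesis
    using continuous_L2_iff[OF c] continuous_L2_iff[OF continuous_on_subset[OF c], of "{0..}"] continuous_L2_iff[OF cr]
      integrable_reflect_half[of ?g] by simp
qed

lemma L2_cmult: assumes "f \<in> L2 I" shows "(\<lambda>x. c * f x) \<in> L2 I"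
  using assms by (auto simp: L2_def norm_mult power_mult_distrib)

lemma not_AE_zero:
  fixes f :: "real \<Rightarrow> complex"
  assumes nz: "\<And>x. a \<le> x \<Longrightarrow> x \<le> b \<Longrightarrow> f x \<noteq> 0" "a < b" "{a..b} \<subseteq> I" and I: "I \<in> sets lebesgue"
  shows "\<not> (AE x in lebesgue_on I. f x = 0)"
proof
  assume "AE x in lebesgue_on I. f x = 0"
  then have "AE x in lebesgue. x \<in> I \<longrightarrow> f x = 0" using I by (subst (asm) AE_restrict_space_iff) auto
  then have "negligible {x. \<not> (x \<in> I \<longrightarrow> f x = 0)}" by (simp add: completion.AE_iff_null_sets negligible_iff_null_sets)
  then have "negligible {a..b}" by (rule negligible_subset) (use nz in auto)
  then show False using \<open>a < b\<close> negligible_interval(1)[of a b] by (simp add: box_eq_empty not_le)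
qed

lemma eigenvalue_imp_spectrum: "eigenvalue I A z \<Longrightarrow> z \<in> op_spectrum I A"
  by (fastforce simp: eigenvalue_def op_spectrum_def resolvent_set_def)

section \<open>Jost solutions and scattering coefficients on the line\<close>

locale full_line =
  fixes q :: "real \<Rightarrow> real"
  assumes Q1: "q \<in> Q1"
begin

lemma q_UNIV: "q absolutely_integrable_on UNIV"
  using Q1 by (simp add: Q1_def set_integrable_def)

sublocale R: half_line q
  by unfold_locales (rule set_integrable_subset[OF q_UNIV], auto)

sublocale L: half_line "reflect q"
proof unfold_locales
  have "q absolutely_integrable_on {..0}" by (rule set_integrable_subset[OF q_UNIV]) auto
  then show "reflect q absolutely_integrable_on {0..}"
    using has_absolute_integral_reflect_real[of "{0..}" "{..0}" q] by auto
qed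

text \<open>The left half-line is the right half-line of the reflected potential; reflection changes
  the sign of derivatives, hence \<open>- \<beta>\<close>.\<close>

definition full where "full \<alpha> \<beta> s x = (if x \<ge> 0 then ivp q \<alpha> \<beta> s x else ivp (reflect q) \<alpha> (- \<beta>) s (- x))"
definition full' where "full' \<alpha> \<beta> s x = (if x \<ge> 0 then ivp' q \<alpha> \<beta> s x else - ivp' (reflect q) \<alpha> (- \<beta>) s (- x))"

lemma full_0: "full \<alpha> \<beta> s 0 = \<alpha>" "full' \<alpha> \<beta> s 0 = \<beta>" by (simp_all add: full_def full'_def R.ivp_0)

lemma full_left: "x \<ge> 0 \<Longrightarrow> full \<alpha> \<beta> s (- x) = ivp (reflect q) \<alpha> (- \<beta>) s x"
   "x \<ge> 0 \<Longrightarrow> full' \<alpha> \<beta> s (- x) = - ivp' (reflect q) \<alpha> (- \<beta>) s x"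
  by (auto simp: full_def full'_def R.ivp_0 L.ivp_0)

lemma sol_cong:
  assumes "sol p s y v" "\<And>x. x \<ge> 0 \<Longrightarrow> y x = z x" "\<And>x. x \<ge> 0 \<Longrightarrow> v x = w x" shows "sol p s z w"
  using loc_AC_cong_simple[of "{0..}" y v z w] loc_AC_cong_simple[of "{0..}" v "\<lambda>x. (complex_of_real (p x) + s) * y x" w "\<lambda>x. (complex_of_real (p x) + s) * z x"] assms
  by (auto simp: sol_def is_interval_ci)

lemma fullsol_full: "fullsol q s (full \<alpha> \<beta> s) (full' \<alpha> \<beta> s)"
  unfolding fullsol_iff
proof
  show "sol q s (full \<alpha> \<beta> s) (full' \<alpha> \<beta> s)" by (rule sol_cong[OF R.sol_ivp]) (auto simp: full_def full'_def)
  show "sol (reflect q) s (reflect (full \<alpha> \<beta> s)) (\<lambda>x. - full' \<alpha> \<beta> s (- x))"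
    by (rule sol_cong[OF L.sol_ivp]) (simp_all add: full_left)
qed

lemma fullsol_unique:
  assumes y: "fullsol q s y v" shows "y = full (y 0) (v 0) s"
proof
  fix x
  have 1: "sol q s y v" and 2: "sol (reflect q) s (reflect y) (\<lambda>x. - v (- x))" using y by (auto simp: fullsol_iff)
  show "y x = full (y 0) (v 0) s x"
    using R.sol_eq_ivp(1)[OF 1, of x] L.sol_eq_ivp(1)[OF 2, of "-x"] by (auto simp: full_def)
qed

text \<open>Uniqueness of the scattering coefficients rests on this: an identity between solutions
  becomes an identity between Cauchy data.\<close>

lemma full_inj: assumes "full \<alpha> \<beta> s = full \<gamma> \<delta> s" shows "\<alpha> = \<gamma>" "\<beta> = \<delta>"
proof -
  show a: "\<alpha> = \<gamma>" using full_0(1) assms by metis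
  define u where "u = ivp q 0 1 s"
  have "\<beta> * u x = \<delta> * u x" if "x \<ge> 0" for x
    using fun_cong[OF assms, of x] that a R.ivp_lincomb(1)[OF that, of \<alpha> \<beta> s] R.ivp_lincomb(1)[OF that, of \<gamma> \<delta> s]
    by (auto simp: full_def u_def)
  moreover have "\<exists>x\<ge>0. u x \<noteq> 0"
  proof (rule ccontr)
    assume "\<not> ?thesis"
    then have z: "u x = 0" if "x \<ge> 0" for x using that by auto
    have s: "sol q s u (ivp' q 0 1 s)" unfolding u_def by (rule R.sol_ivp)
    have "ivp' q 0 1 s 0 = 0"
    proof (rule continuous_zero_if_integrals_zero)
      show "continuous_on {0..b} (ivp' q 0 1 s)" for b by (rule sol_continuous(2)[OF s]) simp
      show "integral {0..b} (ivp' q 0 1 s) = 0" if "0 \<le> b" for b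
        using loc_AC_diff_eq[of "{0..}" u "ivp' q 0 1 s" 0 b] s z that by (simp add: sol_def)
    qed simp
    then show False by (simp add: R.ivp_0)
  qed
  ultimately show "\<beta> = \<delta>" by auto
qed

lemma full_lincomb: "full (a * \<alpha> + b * \<gamma>) (a * \<beta> + b * \<delta>) s x = a * full \<alpha> \<beta> s x + b * full \<gamma> \<delta> s x"
proof (cases "x \<ge> 0")
  case True
  then show ?thesis
    using R.ivp_lincomb(1)[of x "a * \<alpha> + b * \<gamma>" "a * \<beta> + b * \<delta>" s] R.ivp_lincomb(1)[of x \<alpha> \<beta> s] R.ivp_lincomb(1)[of x \<gamma> \<delta> s]
    by (simp add: full_def algebra_simps)
next
  case False
  then have f: "full \<alpha> \<beta> s x = ivp (reflect q) \<alpha> (- \<beta>) s (- x)" for \<alpha> \<beta> by (simp add: full_def)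
  have x: "- x \<ge> 0" using False by simp
  show ?thesis
    unfolding f L.ivp_lincomb(1)[OF x, of "a * \<alpha> + b * \<gamma>" "- (a * \<beta> + b * \<delta>)" s]
      L.ivp_lincomb(1)[OF x, of \<alpha> "-\<beta>" s] L.ivp_lincomb(1)[OF x, of \<gamma> "-\<delta>" s]
    by algebra
qed

text \<open>With \<open>k = - \<i> * l\<close> the normalization says that
  \<open>exp (k x) y\<close> tends to 1, so \<open>jost_unique\<close> determines the data at 0 and
  the definite description evaluates to a solution given by them.\<close>

lemma jost_right_eq:
  assumes l: "l \<noteq> 0"
  shows "jost_right q (complex_of_real l) = full (R.J (- \<i> * l)) (R.J1 (- \<i> * l)) ((- \<i> * l)\<^sup>2)"
proof -
  let ?k = "- \<i> * complex_of_real l"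
  have k: "Re ?k = 0" "?k \<noteq> 0" "Re ?k \<ge> 0" using l by auto
  have l2: "(complex_of_real l)\<^sup>2 = - (?k\<^sup>2)" by (simp add: power_mult_distrib)
  have eq: "(schrodinger_eq q UNIV y (\<lambda>x. (complex_of_real l)\<^sup>2 * y x) \<and> ((\<lambda>x. exp (- \<i> * complex_of_real l * complex_of_real x) * y x) \<longlongrightarrow> 1) at_top)
     \<longleftrightarrow> y = full (R.J ?k) (R.J1 ?k) (?k\<^sup>2)" for y
  proof
    assume y: "schrodinger_eq q UNIV y (\<lambda>x. (complex_of_real l)\<^sup>2 * y x) \<and> ((\<lambda>x. exp (- \<i> * complex_of_real l * complex_of_real x) * y x) \<longlongrightarrow> 1) at_top"
    then obtain v where v: "fullsol q (?k\<^sup>2) y v" unfolding l2 schrodinger_eq_fullsol by blast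
    then have "sol q (?k\<^sup>2) y v" by (simp add: fullsol_iff)
    from R.jost_unique[OF this k(1,2)] y have "y 0 = R.J ?k" "v 0 = R.J1 ?k" by auto
    then show "y = full (R.J ?k) (R.J1 ?k) (?k\<^sup>2)" using fullsol_unique[OF v] by simp
  next
    assume y: "y = full (R.J ?k) (R.J1 ?k) (?k\<^sup>2)"
    have "((\<lambda>x. exp (?k * complex_of_real x) * y x) \<longlongrightarrow> 1) at_top"
    proof (rule Lim_transform_eventually[OF R.jost_tendsto(1)[OF k(3,2)]])
      show "\<forall>\<^sub>F x in at_top. exp (?k * complex_of_real x) * R.jost ?k x = exp (?k * complex_of_real x) * y x"
        using eventually_ge_at_top[of 0] by eventually_elim (simp add: y full_def R.jost_def)
    qed
    then show "schrodinger_eq q UNIV y (\<lambda>x. (complex_of_real l)\<^sup>2 * y x) \<and> ((\<lambda>x. exp (- \<i> * complex_of_real l * complex_of_real x) * y x) \<longlongrightarrow> 1) at_top"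
      unfolding l2 schrodinger_eq_fullsol using fullsol_full y by blast
  qed
  show ?thesis unfolding jost_right_def eq by simp
qed

lemma jost_left_eq:
  assumes l: "l \<noteq> 0"
  shows "jost_left q (complex_of_real l) = full (L.J (\<i> * l)) (- L.J1 (\<i> * l)) ((\<i> * l)\<^sup>2)"
proof -
  let ?k = "\<i> * complex_of_real l"
  have k: "Re ?k = 0" "?k \<noteq> 0" "Re ?k \<ge> 0" using l by auto
  have l2: "(complex_of_real l)\<^sup>2 = - (?k\<^sup>2)" by (simp add: power_mult_distrib)
  have flip: "((\<lambda>x. exp (- \<i> * complex_of_real l * complex_of_real x) * y x) \<longlongrightarrow> 1) at_bot
     \<longleftrightarrow> ((\<lambda>x. exp (?k * complex_of_real x) * y (- x)) \<longlongrightarrow> 1) at_top" for y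
    unfolding at_bot_mirror filterlim_filtermap by simp
  have eq: "(schrodinger_eq q UNIV y (\<lambda>x. (complex_of_real l)\<^sup>2 * y x) \<and> ((\<lambda>x. exp (- \<i> * complex_of_real l * complex_of_real x) * y x) \<longlongrightarrow> 1) at_bot)
     \<longleftrightarrow> y = full (L.J ?k) (- L.J1 ?k) (?k\<^sup>2)" for y
    unfolding flip
  proof
    assume y: "schrodinger_eq q UNIV y (\<lambda>x. (complex_of_real l)\<^sup>2 * y x) \<and> ((\<lambda>x. exp (?k * complex_of_real x) * y (- x)) \<longlongrightarrow> 1) at_top"
    then obtain v where v: "fullsol q (?k\<^sup>2) y v" unfolding l2 schrodinger_eq_fullsol by blast
    then have "sol (reflect q) (?k\<^sup>2) (reflect y) (\<lambda>x. - v (- x))" by (simp add: fullsol_iff)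
    from L.jost_unique[OF this k(1,2)] y have "y 0 = L.J ?k" "- v 0 = L.J1 ?k" by auto
    then have "y 0 = L.J ?k" "v 0 = - L.J1 ?k" by (metis minus_minus)+
    then show "y = full (L.J ?k) (- L.J1 ?k) (?k\<^sup>2)" using fullsol_unique[OF v] by simp
  next
    assume y: "y = full (L.J ?k) (- L.J1 ?k) (?k\<^sup>2)"
    have "((\<lambda>x. exp (?k * complex_of_real x) * y (- x)) \<longlongrightarrow> 1) at_top"
    proof (rule Lim_transform_eventually[OF L.jost_tendsto(1)[OF k(3,2)]])
      show "\<forall>\<^sub>F x in at_top. exp (?k * complex_of_real x) * L.jost ?k x = exp (?k * complex_of_real x) * y (- x)"
        using eventually_ge_at_top[of 0] by eventually_elim (simp add: y full_left L.jost_def)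
    qed
    then show "schrodinger_eq q UNIV y (\<lambda>x. (complex_of_real l)\<^sup>2 * y x) \<and> ((\<lambda>x. exp (?k * complex_of_real x) * y (- x)) \<longlongrightarrow> 1) at_top"
      unfolding l2 schrodinger_eq_fullsol using fullsol_full y by blast
  qed
  show ?thesis unfolding jost_left_def eq by simp
qed

text \<open>In terms of data at 0 the scattering relation is a linear system with determinant
  \<open>2 * z\<close> up to sign, which yields the formulas for \<open>a\<close> and
  \<open>b\<close>; the claim is \<open>b = 0\<close>. Vanishing of \<open>r_minus\<close> gives it
  only once \<open>a \<noteq> 0\<close> is known, since division by 0 yields 0.\<close>

lemma reflectionless_imp:
  assumes rl: "reflectionless q" and z: "Re z = 0" "z \<noteq> 0"
  shows "L.J1 z * R.J (- z) + R.J1 (- z) * L.J z = 0"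
proof -
  define l where "l = Im z"
  have l: "l \<noteq> 0" and zl: "z = \<i> * complex_of_real l" using z by (auto simp: l_def complex_eq_iff)
  let ?s = "z\<^sup>2"
  have s: "(- z)\<^sup>2 = z\<^sup>2" by simp
  have jr: "jost_right q (complex_of_real l) = full (R.J (- z)) (R.J1 (- z)) ?s"
    using jost_right_eq[OF l] by (simp add: zl)
  have jl: "jost_left q (complex_of_real l) = full (L.J z) (- L.J1 z) ?s"
    using jost_left_eq[OF l] by (simp add: zl)
  have jl': "jost_left q (- complex_of_real l) = full (L.J (- z)) (- L.J1 (- z)) ?s"
    using jost_left_eq[of "-l"] l by (simp add: zl)
  define a where "a = (R.J (- z) * L.J1 (- z) + R.J1 (- z) * L.J (- z)) / (2 * z)"
  define b where "b = - (R.J1 (- z) * L.J z + R.J (- z) * L.J1 z) / (2 * z)"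
  have w: "L.J z * L.J1 (- z) - L.J1 z * L.J (- z) = 2 * z" by (rule L.wronskian_J[OF z])
  have iff: "(\<forall>x. jost_right q (complex_of_real l) x = a' * jost_left q (complex_of_real l) x + b' * jost_left q (- complex_of_real l) x)
     \<longleftrightarrow> R.J (- z) = a' * L.J z + b' * L.J (- z) \<and> R.J1 (- z) = a' * (- L.J1 z) + b' * (- L.J1 (- z))" for a' b'
    unfolding jr jl jl' full_lincomb[symmetric] fun_eq_iff[symmetric] using full_inj by metis
  have sol: "R.J (- z) = a' * L.J z + b' * L.J (- z) \<and> R.J1 (- z) = a' * (- L.J1 z) + b' * (- L.J1 (- z)) \<longleftrightarrow> a' = a \<and> b' = b" for a' b'
  proof
    assume e: "R.J (- z) = a' * L.J z + b' * L.J (- z) \<and> R.J1 (- z) = a' * (- L.J1 z) + b' * (- L.J1 (- z))"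
    have "R.J (- z) * L.J1 (- z) + R.J1 (- z) * L.J (- z) = a' * (L.J z * L.J1 (- z) - L.J1 z * L.J (- z))"
      "- (R.J1 (- z) * L.J z + R.J (- z) * L.J1 z) = b' * (L.J z * L.J1 (- z) - L.J1 z * L.J (- z))"
      using e[THEN conjunct1] e[THEN conjunct2] by algebra+
    then show "a' = a \<and> b' = b" unfolding a_def b_def w using z by simp
  next
    assume ab: "a' = a \<and> b' = b"
    have za: "2 * z * a = R.J (- z) * L.J1 (- z) + R.J1 (- z) * L.J (- z)" and zb: "2 * z * b = - (R.J1 (- z) * L.J z + R.J (- z) * L.J1 z)"
      using z by (simp_all add: a_def b_def)
    have "2 * z * R.J (- z) = (2 * z * a) * L.J z + (2 * z * b) * L.J (- z)" using za zb w by algebra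
    moreover have "2 * z * R.J1 (- z) = (2 * z * a) * (- L.J1 z) + (2 * z * b) * (- L.J1 (- z))" using za zb w by algebra
    moreover have "2 * z \<noteq> 0" using z by simp
    ultimately have "2 * z * R.J (- z) = 2 * z * (a * L.J z + b * L.J (- z))" "2 * z * R.J1 (- z) = 2 * z * (a * (- L.J1 z) + b * (- L.J1 (- z)))"
      by (simp_all only: distrib_left mult.assoc)
    then show "R.J (- z) = a' * L.J z + b' * L.J (- z) \<and> R.J1 (- z) = a' * (- L.J1 z) + b' * (- L.J1 (- z))"
      using \<open>2 * z \<noteq> 0\<close> ab by (metis mult_left_cancel)
  qed
  have key: "(\<forall>x. jost_right q (complex_of_real l) x = a' * jost_left q (complex_of_real l) x + b' * jost_left q (- complex_of_real l) x)
     \<longleftrightarrow> a' = a \<and> b' = b" for a' b'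
    unfolding iff by (rule sol)
  have "scattering_coeffs q l = (a, b)"
    unfolding scattering_coeffs_def key by (rule the_equality) auto
  moreover have "r_minus q l = 0" using rl l by (simp add: reflectionless_def)
  ultimately have "b = 0 \<or> a = 0" by (simp add: r_minus_def coeff_a_def coeff_b_def)
  \<comment> \<open>If \<open>a = 0\<close>, the data of the right solution are \<open>b\<close>
    times those of a left one with the derivative reversed. The quantity \<open>- J1 * cnj J\<close>
    on the right would be \<open>- (norm b)\<^sup>2\<close> times its counterpart on the left,
    against the common sign given by \<open>J_herglotz_nonreal\<close>.\<close>
  moreover have "a \<noteq> 0"
  proof
    assume a0: "a = 0"
    have e: "R.J (- z) = b * L.J (- z)" "R.J1 (- z) = b * (- L.J1 (- z))" using sol[of a b] a0 by auto
    have im: "Im (- complex_of_real r * w) = - r * Im w" for r w by simp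
    have "- R.J1 (- z) * cnj (R.J (- z)) = - of_real ((norm b)\<^sup>2) * (- L.J1 (- z) * cnj (L.J (- z)))"
      unfolding e complex_norm_square by simp
    then have "Im (- R.J1 (- z) * cnj (R.J (- z))) = - (norm b)\<^sup>2 * Im (- L.J1 (- z) * cnj (L.J (- z)))"
      by (simp only: im)
    then have "Im (- z) * Im (- R.J1 (- z) * cnj (R.J (- z))) = - (norm b)\<^sup>2 * (Im (- z) * Im (- L.J1 (- z) * cnj (L.J (- z))))" by simp
    moreover have "Im (- z) * Im (- R.J1 (- z) * cnj (R.J (- z))) > 0" "Im (- z) * Im (- L.J1 (- z) * cnj (L.J (- z))) > 0"
      using z l by (intro R.J_herglotz_nonreal L.J_herglotz_nonreal; simp add: l_def)+
    moreover have "0 \<le> (norm b)\<^sup>2 * p" if "p > 0" for p using that by simp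
    ultimately show False by (metis mult_minus_left neg_le_0_iff_le not_less)
  qed
  ultimately have "b = 0" by simp
  moreover have "n = 0" if "n / (2 * z) = 0" for n using that z by simp
  ultimately have "- (R.J1 (- z) * L.J z + R.J (- z) * L.J1 z) = 0" unfolding b_def by blast
  then show ?thesis by algebra
qed

end

section \<open>Eigenvalues\<close>

lemma L2_continuous_half_iff:
  assumes "continuous_on {..0} f"
  shows "f \<in> L2 {..0} \<longleftrightarrow> reflect f \<in> L2 {0..}"
proof -
  have "continuous_on {0..} (reflect f)" by (rule continuous_on_compose2[OF assms]) (auto intro!: continuous_intros)
  from continuous_L2_iff[OF assms] continuous_L2_iff[OF this] show ?thesis
    using integrable_reflect_half[of "\<lambda>x. (norm (f x))\<^sup>2"] by simp
qed

lemma sol_continuous_atLeast: "sol q s y v \<Longrightarrow> continuous_on {0..} y"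
  by (intro continuous_on_atLeastI sol_continuous(1)) auto

lemma continuous_atMost_iff: "continuous_on {..0::real} f \<longleftrightarrow> continuous_on {0..} (reflect f)" for f :: "real \<Rightarrow> complex"
proof
  assume "continuous_on {..0} f"
  then show "continuous_on {0..} (reflect f)" by (rule continuous_on_compose2) (auto intro!: continuous_intros)
next
  assume "continuous_on {0..} (reflect f)"
  then have "continuous_on {..0} (\<lambda>x. reflect f (- x))" by (rule continuous_on_compose2) (auto intro!: continuous_intros)
  then show "continuous_on {..0} f" by simp
qed

lemma is_interval_half: "is_interval {0::real..}" "is_interval {..0::real}" "is_interval (UNIV :: real set)"
  by (auto intro: is_interval_ci is_interval_ic is_interval_univ)

context half_line
begin

lemma jost_eventually_nonzero:
  assumes k: "Re k \<ge> 0" "k \<noteq> 0"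
  obtains a where "a \<ge> 0" "\<And>x. x \<ge> a \<Longrightarrow> jost k x \<noteq> 0"
proof -
  have "\<forall>\<^sub>F x in at_top. exp (k * complex_of_real x) * jost k x \<noteq> 0"
    by (rule tendsto_imp_eventually_ne[OF jost_tendsto(1)[OF k]]) simp
  then obtain a where "\<And>x. x \<ge> a \<Longrightarrow> exp (k * complex_of_real x) * jost k x \<noteq> 0"
    unfolding eventually_at_top_linorder by blast
  then show thesis using that[of "max a 0"] by auto
qed

end

context full_line
begin

section \<open>Eigenvalues as zeros\<close>

text \<open>A square-integrable solution is a multiple of the Jost solution, by
  \<open>sol_L2_imp\<close>, and the boundary condition forces the latter to vanish at 0.\<close>

lemma T_plus_eigenvalue_iff:
  assumes t: "t > 0"
  shows "eigenvalue {0..} (T_plus q) (- ((complex_of_real t)\<^sup>2)) \<longleftrightarrow> R.J t = 0"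
proof
  assume "eigenvalue {0..} (T_plus q) (- ((complex_of_real t)\<^sup>2))"
  then obtain y g where y: "y \<in> L2 {0..}" "schrodinger_eq q {0..} y g" "y 0 = 0"
    and g: "AE x in lebesgue_on {0..}. g x = - ((complex_of_real t)\<^sup>2) * y x" and nz: "\<not> (AE x in lebesgue_on {0..}. y x = 0)"
    by (auto simp: eigenvalue_def T_plus_def)
  obtain v where v: "loc_AC {0..} y v" "loc_AC {0..} v (\<lambda>x. (complex_of_real (q x) + (complex_of_real t)\<^sup>2) * y x)"
    by (rule schrodinger_eqD[OF y(2) g is_interval_half(1)]) auto
  have s: "sol q ((complex_of_real t)\<^sup>2) y v" using v by (simp add: sol_def)
  have "v 0 * R.J t = 0" using R.sol_L2_imp[OF s t y(1)] y(3) by simp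
  moreover have "v 0 \<noteq> 0"
  proof
    assume "v 0 = 0"
    then have "y x = 0" if "x \<ge> 0" for x using R.sol_unique_0[OF s y(3) _ that] by simp
    then show False using nz by (auto simp: AE_restrict_space_iff intro!: AE_I2)
  qed
  ultimately show "R.J t = 0" by simp
next
  assume J: "R.J t = 0"
  let ?k = "complex_of_real t" and ?y = "R.jost (complex_of_real t)"
  have k: "Re ?k \<ge> 0" "?k \<noteq> 0" using t by auto
  have s: "sol q (?k\<^sup>2) ?y (R.jost' ?k)" by (rule R.sol_jost)
  have L2: "?y \<in> L2 {0..}" by (rule R.jost_L2[OF t])
  have sc: "schrodinger_eq q {0..} ?y (\<lambda>x. - (?k\<^sup>2) * ?y x)"
    using s by (intro schrodinger_eqI) (auto simp: sol_def)
  have mem: "(?y, \<lambda>x. - (?k\<^sup>2) * ?y x) \<in> T_plus q"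
    unfolding T_plus_def using L2 L2_cmult[OF L2, of "- (?k\<^sup>2)"] sc J by (simp add: R.jost_0)
  obtain a where a: "a \<ge> 0" "\<And>x. x \<ge> a \<Longrightarrow> ?y x \<noteq> 0" using R.jost_eventually_nonzero[OF k] by blast
  have "\<not> (AE x in lebesgue_on {0..}. ?y x = 0)"
    by (rule not_AE_zero[of a "a+1"]) (use a in auto)
  then show "eigenvalue {0..} (T_plus q) (- ((complex_of_real t)\<^sup>2))"
    unfolding eigenvalue_def using mem by (intro bexI[OF _ mem]) auto
qed

lemma T_minus_eigenvalue_iff:
  assumes t: "t > 0"
  shows "eigenvalue {..0} (T_minus q) (- ((complex_of_real t)\<^sup>2)) \<longleftrightarrow> L.J t = 0"
proof
  assume "eigenvalue {..0} (T_minus q) (- ((complex_of_real t)\<^sup>2))"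
  then obtain y g where y: "y \<in> L2 {..0}" "schrodinger_eq q {..0} y g" "y 0 = 0"
    and g: "AE x in lebesgue_on {..0}. g x = - ((complex_of_real t)\<^sup>2) * y x" and nz: "\<not> (AE x in lebesgue_on {..0}. y x = 0)"
    by (auto simp: eigenvalue_def T_minus_def)
  obtain v where v: "loc_AC {..0} y v" "loc_AC {..0} v (\<lambda>x. (complex_of_real (q x) + (complex_of_real t)\<^sup>2) * y x)"
    by (rule schrodinger_eqD[OF y(2) g is_interval_half(2)]) auto
  have s: "sol (reflect q) ((complex_of_real t)\<^sup>2) (reflect y) (\<lambda>x. - v (- x))" by (rule sol_reflectI[OF v])
  have c: "continuous_on {..0} y" unfolding continuous_atMost_iff by (rule sol_continuous_atLeast[OF s])
  have "- v 0 * L.J t = 0" using L.sol_L2_imp[OF s t] y L2_continuous_half_iff[OF c] by simp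
  moreover have "v 0 \<noteq> 0"
  proof
    assume "v 0 = 0"
    then have "reflect y x = 0" if "x \<ge> 0" for x using L.sol_unique_0[OF s _ _ that] y(3) by simp
    from this[of "- _"] have "y x = 0" if "x \<le> 0" for x using that by simp
    then show False using nz by (auto simp: AE_restrict_space_iff intro!: AE_I2)
  qed
  ultimately show "L.J t = 0" by simp
next
  assume J: "L.J t = 0"
  let ?k = "complex_of_real t" and ?y = "reflect (L.jost (complex_of_real t))"
  have k: "Re ?k \<ge> 0" "?k \<noteq> 0" using t by auto
  have s: "sol (reflect q) (?k\<^sup>2) (reflect ?y) (\<lambda>x. - (- L.jost' ?k (- (- x))))" using L.sol_jost by simp
  have c: "continuous_on {..0} ?y" unfolding continuous_atMost_iff by (rule sol_continuous_atLeast[OF s])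
  have L2: "?y \<in> L2 {..0}" using L2_continuous_half_iff[OF c] L.jost_L2[OF t] by simp
  have sc: "schrodinger_eq q {..0} ?y (\<lambda>x. - (?k\<^sup>2) * ?y x)"
    by (rule schrodinger_eqI[where v = "\<lambda>x. - L.jost' ?k (- x)"])
       (use sol_reflectD[where y = ?y and v = "\<lambda>x. - L.jost' ?k (- x)", OF s] in auto)
  have mem: "(?y, \<lambda>x. - (?k\<^sup>2) * ?y x) \<in> T_minus q"
    unfolding T_minus_def using L2 L2_cmult[OF L2, of "- (?k\<^sup>2)"] sc J by (simp add: L.jost_0)
  obtain a where a: "a \<ge> 0" "\<And>x. x \<ge> a \<Longrightarrow> L.jost ?k x \<noteq> 0" using L.jost_eventually_nonzero[OF k] by blast
  have "\<not> (AE x in lebesgue_on {..0}. ?y x = 0)"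
    by (rule not_AE_zero[of "- a - 1" "- a"]) (use a in auto)
  then show "eigenvalue {..0} (T_minus q) (- ((complex_of_real t)\<^sup>2))"
    unfolding eigenvalue_def using mem by (intro bexI[OF _ mem]) auto
qed

lemma full_continuous: "continuous_on UNIV (full \<alpha> \<beta> s)"
proof -
  have "loc_AC UNIV (full \<alpha> \<beta> s) (full' \<alpha> \<beta> s)" using fullsol_full by (simp add: fullsol_def)
  then have "continuous_on {- (b + 1)..b + 1} (full \<alpha> \<beta> s)" for b by (rule loc_AC_continuous) simp
  then show ?thesis
    unfolding continuous_on_eq_continuous_at[OF open_UNIV]
  proof (intro ballI)
    fix x :: real
    have "continuous_on {- (\<bar>x\<bar> + 1)<..<\<bar>x\<bar> + 1} (full \<alpha> \<beta> s)"
      using \<open>\<And>b. continuous_on {- (b + 1)..b + 1} (full \<alpha> \<beta> s)\<close>[of "\<bar>x\<bar>"] by (rule continuous_on_subset) auto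
    moreover have "x \<in> {- (\<bar>x\<bar> + 1)<..<\<bar>x\<bar> + 1}" by auto
    ultimately show "isCont (full \<alpha> \<beta> s) x" by (metis continuous_on_eq_continuous_at open_greaterThanLessThan)
  qed
qed

text \<open>Square integrability at the two ends singles out the multiples of the right and of the
  left Jost solution. An eigenfunction exists iff these are proportional, that is, iff their
  Wronskian vanishes.\<close>

lemma T_line_eigenvalue_iff:
  assumes t: "t > 0"
  shows "eigenvalue UNIV (T_line q) (- ((complex_of_real t)\<^sup>2)) \<longleftrightarrow> R.J1 t * L.J t + L.J1 t * R.J t = 0"
proof
  assume "eigenvalue UNIV (T_line q) (- ((complex_of_real t)\<^sup>2))"
  then obtain y g where y: "y \<in> L2 UNIV" "schrodinger_eq q UNIV y g"
    and g: "AE x in lebesgue_on UNIV. g x = - ((complex_of_real t)\<^sup>2) * y x" and nz: "\<not> (AE x in lebesgue_on UNIV. y x = 0)"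
    by (auto simp: eigenvalue_def T_line_def)
  obtain v where "loc_AC UNIV y v" "loc_AC UNIV v (\<lambda>x. (complex_of_real (q x) + (complex_of_real t)\<^sup>2) * y x)"
    by (rule schrodinger_eqD[OF y(2) g is_interval_half(3)]) auto
  then have f: "fullsol q ((complex_of_real t)\<^sup>2) y v" by (simp add: fullsol_def)
  then have s: "sol q ((complex_of_real t)\<^sup>2) y v" "sol (reflect q) ((complex_of_real t)\<^sup>2) (reflect y) (\<lambda>x. - v (- x))"
    by (simp_all add: fullsol_iff)
  have yf: "y = full (y 0) (v 0) ((complex_of_real t)\<^sup>2)" by (rule fullsol_unique[OF f])
  then have "continuous_on UNIV y" using full_continuous by metis
  then have L2: "y \<in> L2 {0..}" "reflect y \<in> L2 {0..}" using L2_UNIV_iff y(1) by blast+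
  have 1: "v 0 * R.J t = y 0 * R.J1 t" by (rule R.sol_L2_imp[OF s(1) t L2(1)])
  have 2: "- v 0 * L.J t = y 0 * L.J1 t" using L.sol_L2_imp[OF s(2) t L2(2)] by simp
  have ne: "y 0 \<noteq> 0 \<or> v 0 \<noteq> 0"
  proof (rule ccontr)
    assume "\<not> ?thesis"
    then have "y x = 0" for x
      using R.sol_unique_0[OF s(1), of x] L.sol_unique_0[OF s(2), of "-x"] by (cases "x \<ge> 0") auto
    then show False using nz by simp
  qed
  show "R.J1 t * L.J t + L.J1 t * R.J t = 0"
  proof (cases "y 0 = 0")
    case True
    then show ?thesis using 1 2 ne by auto
  next
    case False
    have "y 0 * (R.J1 t * L.J t + L.J1 t * R.J t) = 0" using 1 2 by algebra
    then show ?thesis using False by simp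
  qed
next
  assume W: "R.J1 t * L.J t + L.J1 t * R.J t = 0"
  let ?k = "complex_of_real t"
  have k: "Re ?k \<ge> 0" "?k \<noteq> 0" using t by auto
  have nt: "R.J t \<noteq> 0 \<or> R.J1 t \<noteq> 0" "L.J t \<noteq> 0 \<or> L.J1 t \<noteq> 0" using R.J_nontrivial[OF k] L.J_nontrivial[OF k] by auto
  \<comment> \<open>The factor of proportionality of the Cauchy data; if \<open>L.J t = 0\<close> it
    has to be read off the derivatives.\<close>
  obtain c where c: "R.J t = c * L.J t" "- R.J1 t = c * L.J1 t"
  proof (cases "L.J t = 0")
    case True
    then show thesis using W nt by (intro that[of "- R.J1 t / L.J1 t"]) auto
  next
    case False
    have "R.J1 t * L.J t = - (L.J1 t * R.J t)" using W by algebra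
    then have "- R.J1 t = R.J t / L.J t * L.J1 t" using False by (simp add: field_simps)
    then show thesis using False by (intro that[of "R.J t / L.J t"]) auto
  qed
  define y where "y = full (R.J ?k) (R.J1 ?k) (?k\<^sup>2)"
  have yr: "y x = R.jost ?k x" if "x \<ge> 0" for x using that by (simp add: y_def full_def R.jost_def)
  have yl: "y (- x) = c * L.jost ?k x" if x: "x \<ge> 0" for x
    using L.ivp_lincomb(1)[OF x, of "R.J ?k" "- R.J1 ?k" "?k\<^sup>2"] L.ivp_lincomb(1)[OF x, of "L.J ?k" "L.J1 ?k" "?k\<^sup>2"] c
    by (simp add: y_def full_left[OF x] L.jost_def algebra_simps)
  have cy: "continuous_on UNIV y" unfolding y_def by (rule full_continuous)
  have L2_cong: "f \<in> L2 {0..}" if "g \<in> L2 {0..}" "\<And>x. x \<ge> 0 \<Longrightarrow> f x = g x" "continuous_on {0..} f" "continuous_on {0..} g" for f g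
    using that continuous_L2_iff[OF that(3)] continuous_L2_iff[OF that(4)] integrable_cong[of "{0..}" "\<lambda>x. (norm (f x))\<^sup>2" "\<lambda>x. (norm (g x))\<^sup>2"] by auto
  have "y \<in> L2 {0..}"
    by (rule L2_cong[OF R.jost_L2[OF t] yr continuous_on_subset[OF cy] sol_continuous_atLeast[OF R.sol_jost]]) auto
  moreover have "reflect y \<in> L2 {0..}"
    by (rule L2_cong[OF L2_cmult[OF L.jost_L2[OF t]] yl])
       (auto intro!: continuous_intros continuous_on_compose2[OF cy] sol_continuous_atLeast[OF L.sol_jost])
  ultimately have L2: "y \<in> L2 UNIV" using L2_UNIV_iff[OF cy] by blast
  have sc: "schrodinger_eq q UNIV y (\<lambda>x. - (?k\<^sup>2) * y x)"
    unfolding schrodinger_eq_fullsol y_def using fullsol_full by blast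
  have mem: "(y, \<lambda>x. - (?k\<^sup>2) * y x) \<in> T_line q"
    unfolding T_line_def using L2 L2_cmult[OF L2, of "- (?k\<^sup>2)"] sc by simp
  obtain a where a: "a \<ge> 0" "\<And>x. x \<ge> a \<Longrightarrow> R.jost ?k x \<noteq> 0" using R.jost_eventually_nonzero[OF k] by blast
  have "\<not> (AE x in lebesgue_on UNIV. y x = 0)"
    by (rule not_AE_zero[of a "a+1"]) (use a yr in auto)
  then show "eigenvalue UNIV (T_line q) (- ((complex_of_real t)\<^sup>2))"
    unfolding eigenvalue_def using mem by (intro bexI[OF _ mem]) auto
qed

section \<open>The decoupled operator and genericity\<close>

lemma zero_mem_T: "(\<lambda>x. 0, \<lambda>x. 0) \<in> T_plus q" "(\<lambda>x. 0, \<lambda>x. 0) \<in> T_minus q"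
proof -
  have "schrodinger_eq q I (\<lambda>x. 0) (\<lambda>x. 0)" for I
    unfolding schrodinger_eq_def by (intro exI[of _ "\<lambda>x. 0"] conjI loc_AC_const) auto
  then show "(\<lambda>x. 0, \<lambda>x. 0) \<in> T_plus q" "(\<lambda>x. 0, \<lambda>x. 0) \<in> T_minus q"
    by (auto simp: T_plus_def T_minus_def L2_def)
qed

lemma AE_lebesgue_on_iff:
  assumes "I \<in> sets lebesgue"
  shows "(AE x in lebesgue_on I. P x) \<longleftrightarrow> (AE x in lebesgue. x \<in> I \<longrightarrow> P x)"
  by (rule AE_restrict_space_iff) (use assms in simp)

lemma AE_half_imp_UNIV:
  fixes P Q :: "real \<Rightarrow> bool"
  assumes "AE x in lebesgue_on {0..}. P x" "AE x in lebesgue_on {..0}. Q x" "\<And>x. x \<ge> 0 \<Longrightarrow> P x \<Longrightarrow> S x" "\<And>x. x < 0 \<Longrightarrow> Q x \<Longrightarrow> S x"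
  shows "AE x in lebesgue_on UNIV. S x"
proof -
  have "AE x in lebesgue. x \<in> {0..} \<longrightarrow> P x" "AE x in lebesgue. x \<in> {..0} \<longrightarrow> Q x"
    using AE_lebesgue_on_iff[of "{0..}" P] AE_lebesgue_on_iff[of "{..0}" Q] assms(1,2) by simp_all
  then have "AE x in lebesgue. S x"
  proof eventually_elim
    case (elim x)
    then show ?case using assms(3)[of x] assms(4)[of x] by (cases "x < 0") auto
  qed
  then show ?thesis using AE_lebesgue_on_iff[of UNIV S] by simp
qed

lemma UNIV_imp_AE_half:
  fixes S :: "real \<Rightarrow> bool"
  assumes "AE x in lebesgue_on UNIV. S x" "I \<in> sets lebesgue"
  shows "AE x in lebesgue_on I. S x"
proof -
  have "AE x in lebesgue. S x" using assms(1) AE_lebesgue_on_iff[of UNIV S] by simp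
  then have "AE x in lebesgue. x \<in> I \<longrightarrow> S x" by eventually_elim simp
  then show ?thesis using assms(2) AE_lebesgue_on_iff[of I S] by blast
qed

lemma AE_atMost_nonzero: "AE x in lebesgue_on {..0}. x \<noteq> (0::real)"
proof -
  have "{0::real} \<in> null_sets lebesgue" by (simp flip: negligible_iff_null_sets)
  then have "AE x in lebesgue. x \<notin> {0::real}" by (rule AE_not_in)
  then have "AE x in lebesgue. x \<in> {..0} \<longrightarrow> x \<noteq> (0::real)" by eventually_elim simp
  then show ?thesis using AE_lebesgue_on_iff[of "{..0::real}" "\<lambda>x. x \<noteq> 0"] by simp
qed

text \<open>An eigenfunction on one half-line is extended by zero to the other.\<close>

lemma T_prime_eigenvalue:
  assumes "eigenvalue {0..} (T_plus q) z \<or> eigenvalue {..0} (T_minus q) z"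
  shows "eigenvalue UNIV (T_prime q) z"
  using assms
proof
  assume "eigenvalue {0..} (T_plus q) z"
  then obtain y g where y: "(y, g) \<in> T_plus q" "AE x in lebesgue_on {0..}. g x = z * y x" "\<not> (AE x in lebesgue_on {0..}. y x = 0)"
    by (auto simp: eigenvalue_def)
  have mem: "(glue (\<lambda>x. 0) y, glue (\<lambda>x. 0) g) \<in> T_prime q" using y zero_mem_T by (auto simp: T_prime_def)
  have "AE x in lebesgue_on UNIV. glue (\<lambda>x. 0) g x = z * glue (\<lambda>x. 0) y x"
    by (rule AE_half_imp_UNIV[OF y(2), of "\<lambda>x. True"]) (auto simp: glue_def)
  moreover have "\<not> (AE x in lebesgue_on UNIV. glue (\<lambda>x. 0) y x = 0)"
  proof
    assume "AE x in lebesgue_on UNIV. glue (\<lambda>x. 0) y x = 0"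
    then have "AE x in lebesgue_on {0..}. glue (\<lambda>x. 0) y x = 0" by (rule UNIV_imp_AE_half) simp
    moreover have "AE x in lebesgue_on {0..}. x \<ge> (0::real)" by (rule AE_I2) (simp add: space_restrict_space)
    ultimately have "AE x in lebesgue_on {0..}. y x = 0" by eventually_elim (simp add: glue_def)
    then show False using y(3) by simp
  qed
  ultimately show ?thesis unfolding eigenvalue_def by (intro bexI[OF _ mem]) auto
next
  assume "eigenvalue {..0} (T_minus q) z"
  then obtain y g where y: "(y, g) \<in> T_minus q" "AE x in lebesgue_on {..0}. g x = z * y x" "\<not> (AE x in lebesgue_on {..0}. y x = 0)"
    by (auto simp: eigenvalue_def)
  have mem: "(glue y (\<lambda>x. 0), glue g (\<lambda>x. 0)) \<in> T_prime q" using y zero_mem_T by (auto simp: T_prime_def)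
  have "AE x in lebesgue_on UNIV. glue g (\<lambda>x. 0) x = z * glue y (\<lambda>x. 0) x"
    by (rule AE_half_imp_UNIV[OF _ y(2), of "\<lambda>x. True"]) (auto simp: glue_def)
  moreover have "\<not> (AE x in lebesgue_on UNIV. glue y (\<lambda>x. 0) x = 0)"
  proof
    assume "AE x in lebesgue_on UNIV. glue y (\<lambda>x. 0) x = 0"
    then have "AE x in lebesgue_on {..0}. glue y (\<lambda>x. 0) x = 0" by (rule UNIV_imp_AE_half) simp
    moreover have "AE x in lebesgue_on {..0}. x \<le> (0::real)" by (rule AE_I2) (simp add: space_restrict_space)
    \<comment> \<open>At 0 the function \<open>glue\<close> takes its right-hand value, so the point
      0 is discarded from \<open>{..0}\<close>.\<close>
    ultimately have "AE x in lebesgue_on {..0}. y x = 0" using AE_atMost_nonzero by eventually_elim (simp add: glue_def)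
    then show False using y(3) by simp
  qed
  ultimately show ?thesis unfolding eigenvalue_def by (intro bexI[OF _ mem]) auto
qed

text \<open>A violation would make \<open>- (t\<^sup>2)\<close> an eigenvalue of both
  \<open>T_line q\<close> and \<open>T_prime q\<close>; eigenvalues belong to the spectrum, so the
  potential would be special.\<close>

lemma generic_imp:
  fixes t :: real
  assumes "generic q" and t: "t > 0" and W: "R.J1 t * L.J t + L.J1 t * R.J t = 0"
  shows "R.J t \<noteq> 0 \<and> L.J t \<noteq> 0"
proof (rule ccontr)
  let ?z = "- ((complex_of_real t)\<^sup>2)"
  have z: "?z = complex_of_real (- (t\<^sup>2))" by simp
  assume "\<not> ?thesis"
  then have "eigenvalue UNIV (T_prime q) ?z"
    using T_plus_eigenvalue_iff[OF t] T_minus_eigenvalue_iff[OF t] T_prime_eigenvalue by blast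
  moreover have "eigenvalue UNIV (T_line q) ?z" using T_line_eigenvalue_iff[OF t] W by blast
  ultimately have "- (t\<^sup>2) \<in> neg_spectrum UNIV (T_line q) \<inter> neg_spectrum UNIV (T_prime q)"
    using t eigenvalue_imp_spectrum by (simp add: neg_spectrum_def flip: z)
  then show False using assms(1) by (auto simp: special_def)
qed

lemma weyl_pair:
  assumes "generic q" "reflectionless q"
  shows "weyl_pair R.J R.J1 L.J L.J1"
proof
  show "\<exists>r>0. \<exists>C. \<forall>z. Re z \<ge> 0 \<longrightarrow> norm z \<ge> r \<longrightarrow> R.J z \<noteq> 0 \<and> L.J z \<noteq> 0 \<and> norm (- R.J1 z / R.J z - z) \<le> C \<and> norm (- L.J1 z / L.J z - z) \<le> C"
  proof -
    obtain r1 C1 where 1: "r1 > 0" "\<And>z. Re z \<ge> 0 \<Longrightarrow> norm z \<ge> r1 \<Longrightarrow> R.J z \<noteq> 0 \<and> norm (- R.J1 z / R.J z - z) \<le> C1" using R.J_asym by blast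
    obtain r2 C2 where 2: "r2 > 0" "\<And>z. Re z \<ge> 0 \<Longrightarrow> norm z \<ge> r2 \<Longrightarrow> L.J z \<noteq> 0 \<and> norm (- L.J1 z / L.J z - z) \<le> C2" using L.J_asym by blast
    show ?thesis
      by (rule exI[of _ "max r1 r2"], intro conjI exI[of _ "max C1 C2"]) (use 1 2 in \<open>auto simp: le_max_iff_disj\<close>)
  qed
  fix z
  show "R.J1 z * L.J z + L.J1 z * R.J z = 0 \<Longrightarrow> Re z > 0 \<Longrightarrow> Im z = 0 \<Longrightarrow> R.J z \<noteq> 0 \<and> L.J z \<noteq> 0"
  proof -
    assume z: "R.J1 z * L.J z + L.J1 z * R.J z = 0" "Re z > 0" "Im z = 0"
    then have zt: "z = complex_of_real (Re z)" by (simp add: complex_eq_iff)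
    show "R.J z \<noteq> 0 \<and> L.J z \<noteq> 0" using generic_imp[OF assms(1) z(2)] z(1) zt by metis
  qed
qed (use R.J_holomorphic L.J_holomorphic R.J_continuous L.J_continuous R.J_herglotz L.J_herglotz R.J_cnj L.J_cnj
    R.J_nontrivial L.J_nontrivial reflectionless_imp[OF assms(2)] in \<open>auto\<close>)

end

lemma negligible_reflect:
  assumes "negligible (N :: real set)" shows "negligible (uminus ` N)"
  by (rule negligible_differentiable_image_negligible[OF _ assms])
     (auto intro!: differentiable_on_minus differentiable_on_ident)

theorem theorem4p3:
  fixes q q' :: "real \<Rightarrow> real"
  assumes "q \<in> Q1" and "generic q" and "reflectionless q"
    and "q' \<in> Q1" and "generic q'" and "reflectionless q'"
    and "neg_eigenvalues UNIV (T_line q') = neg_eigenvalues UNIV (T_line q)"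
    and "neg_eigenvalues {0..} (T_plus q') = neg_eigenvalues {0..} (T_plus q)"
    and "neg_eigenvalues {..0} (T_minus q') = neg_eigenvalues {..0} (T_minus q)"
  shows "AE x in lebesgue. q' x = q x"
proof -
  interpret P: full_line q' by unfold_locales (rule assms)
  interpret Q: full_line q by unfold_locales (rule assms)
  interpret WP: weyl_pair P.R.J P.R.J1 P.L.J P.L.J1 by (rule P.weyl_pair[OF assms(5,6)])
  interpret WQ: weyl_pair Q.R.J Q.R.J1 Q.L.J Q.L.J1 by (rule Q.weyl_pair[OF assms(2,3)])
  have ev: "eigenvalue I A (- ((complex_of_real t)\<^sup>2)) \<longleftrightarrow> eigenvalue I B (- ((complex_of_real t)\<^sup>2))"
    if "neg_eigenvalues I A = neg_eigenvalues I B" "t > 0" for I A B t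
  proof -
    have "- (t\<^sup>2) \<in> neg_eigenvalues I A \<longleftrightarrow> - (t\<^sup>2) \<in> neg_eigenvalues I B" using that by simp
    then show ?thesis using that(2) by (simp add: neg_eigenvalues_def)
  qed
  interpret T: two_weyl_pairs P.R.J P.R.J1 P.L.J P.L.J1 Q.R.J Q.R.J1 Q.L.J Q.L.J1
  proof
    fix z :: complex assume z: "Re z > 0" "Im z = 0"
    then have zt: "z = complex_of_real (Re z)" by (simp add: complex_eq_iff)
    show "P.R.J z = 0 \<longleftrightarrow> Q.R.J z = 0"
      using P.T_plus_eigenvalue_iff[OF z(1)] Q.T_plus_eigenvalue_iff[OF z(1)] ev[OF assms(8) z(1)] zt by metis
    show "P.L.J z = 0 \<longleftrightarrow> Q.L.J z = 0"
      using P.T_minus_eigenvalue_iff[OF z(1)] Q.T_minus_eigenvalue_iff[OF z(1)] ev[OF assms(9) z(1)] zt by metis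
    show "WP.W z = 0 \<longleftrightarrow> WQ.W z = 0"
      using P.T_line_eigenvalue_iff[OF z(1)] Q.T_line_eigenvalue_iff[OF z(1)] ev[OF assms(7) z(1)] zt
      unfolding WP.W_def WQ.W_def neg_equal_0_iff_equal by metis
  qed
  obtain c where c: "\<And>z. Re z > 0 \<Longrightarrow> P.R.J1 z * Q.R.J z - Q.R.J1 z * P.R.J z = c * (P.R.J z * Q.R.J z)"
    "\<And>z. Re z > 0 \<Longrightarrow> P.L.J1 z * Q.L.J z - Q.L.J1 z * P.L.J z = - c * (P.L.J z * Q.L.J z)"
    using T.weyl_functions_differ_by_constant by blast
  \<comment> \<open>The discrepancies of the two half-lines are \<open>c\<close> and
    \<open>- c\<close>; \<open>borg_marchenko\<close> accepts either.\<close>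
  interpret BR: two_half_lines q' q ..
  interpret BL: two_half_lines "reflect q'" "reflect q" ..
  obtain N where N: "negligible N" "\<And>x. x > 0 \<Longrightarrow> x \<notin> N \<Longrightarrow> q' x = q x"
    using BR.borg_marchenko[OF c(1)] by blast
  obtain M where M: "negligible M" "\<And>x. x > 0 \<Longrightarrow> x \<notin> M \<Longrightarrow> q' (- x) = q (- x)"
    using BL.borg_marchenko[OF c(2)] by blast
  have "negligible (N \<union> uminus ` M \<union> {0})" using N(1) negligible_reflect[OF M(1)] by simp
  then have "N \<union> uminus ` M \<union> {0} \<in> null_sets lebesgue" by (simp add: negligible_iff_null_sets)
  moreover have eq: "q' x = q x" if "x \<notin> N \<union> uminus ` M \<union> {0}" for x
  proof (cases "x > 0")
    case True then show ?thesis using N that by auto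
  next
    case False
    then have "- x > 0" "- x \<notin> M" using that by (auto simp: image_iff)
    then show ?thesis using M(2)[of "-x"] by simp
  qed
  ultimately show ?thesis by (intro AE_I'[of "N \<union> uminus ` M \<union> {0}"]) blast+
qed

end
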